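(* Let $\lambda_{0},\lambda_{1}$ be real numbers with $\min\{\lambda_{0},\lambda_{1}\}>\frac{5+\sqrt{17}}{2}$. Let $b\geq 3$ be an integer, $W\subseteq\{0,1,\ldots,b-1\}$ nonempty, and $K=C_{b,W}$. If $0\in W$, then \[ (\mathscr{W}_{\lambda_{0}}\cap K)+(\mathscr{W}_{\lambda_{1}}\cap K)\supseteq\mathscr{W}_{2}\cap\mathscr{V}_{1,(b)}\cap K. \] In any case (whether or not $0\in W$), \[ \dim\big((\mathscr{W}_{\lambda_{0}}\cap K)\times(\mathscr{W}_{\lambda_{1}}\cap K)\big)\geq\dim(K)=\frac{\log|W|}{\log b}. \] Consequently, for any real $\lambda>\frac{5+\sqrt{17}}{2}$, \[ \dim_{P}(\mathscr{W}_{\lambda}\cap K)=\frac{\log|W|}{\log b}=\dim_{P}(K). \]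
   Context: $\dim$ denotes Hausdorff dimension and $\dim_{P}$ packing dimension. $C_{b,W}$ is the set of all real numbers $\sum_{i=1}^{\infty}a_{i}b^{-i}$ with all $a_{i}\in W$. For $\xi\in\mathbb{R}$, the irrationality exponent $\mu(\xi)$ is the supremum of all $\mu$ such that $|\xi-p/q|\leq q^{-\mu}$ has infinitely many rational solutions $p/q$ ($q\geq 1$), and $\mathscr{W}_{\lambda}=\{\xi:\mu(\xi)=\lambda\}$ (so $\mathscr{W}_2$ is the set of irrational numbers that are not very well approximable). $\theta_{b}(\xi)$ is the supremum of all $\mu$ such that there are infinitely many rational numbers of the form $p/b^{N}$ ($p,N$ integers, $N\ge0$) with $|\xi-p/b^{N}|\leq (b^{N})^{-\mu}$, and $\mathscr{V}_{1,(b)}=\{\xi:\theta_{b}(\xi)=1\}$. *)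

theory Defs
  imports "HOL-Analysis.Analysis" "HOL-Library.Set_Algebras"
begin

(* The power (diam U)^s with the usual conventions 0^0 = 1 for nonempty U and
   (diam {})^s = 0; these differ from the library's 0 powr 0 = 0. *)
definition diam_powr :: "real \<Rightarrow> 'a::metric_space set \<Rightarrow> ennreal" where
  "diam_powr s U =
     (if U = {} then 0 else if s = 0 then 1 else ennreal (diameter U powr s))"

(* Boundedness of the covering sets is required explicitly because the library's
   diameter is a meaningful value only for bounded sets. Finite covers are
   included, by padding with empty sets. *)
definition hausdorff_premeasure :: "real \<Rightarrow> real \<Rightarrow> 'a::metric_space set \<Rightarrow> ennreal" where
  "hausdorff_premeasure \<delta> s A =
     (INF U \<in> {U :: nat \<Rightarrow> 'a set. A \<subseteq> (\<Union>i. U i) \<and> (\<forall>i. bounded (U i) \<and> diameter (U i) \<le> \<delta>)}.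
        (\<Sum>i. diam_powr s (U i)))"

definition hausdorff_measure :: "real \<Rightarrow> 'a::metric_space set \<Rightarrow> ennreal" where
  "hausdorff_measure s A = (SUP \<delta>\<in>{0<..}. hausdorff_premeasure \<delta> s A)"

definition hausdorff_dim :: "'a::metric_space set \<Rightarrow> ereal" where
  "hausdorff_dim A = (INF s\<in>{s. 0 \<le> s \<and> hausdorff_measure s A = 0}. ereal s)"

(* A packing is given by the pairs (centre, radius) of its balls. An infinite sum
   of nonnegative terms is the supremum of its finite partial sums, so the
   supremum over finite packings is the supremum over all packings. The
   ball of radius r has diameter 2 * r. *)
definition packing_premeasure_at ::
    "real \<Rightarrow> real \<Rightarrow> 'a::euclidean_space set \<Rightarrow> ennreal" where
  "packing_premeasure_at \<delta> s A =
     (SUP F \<in> {F. finite F \<and> F \<subseteq> A \<times> {0<..\<delta>} \<and> disjoint_family_on (\<lambda>(x, r). cball x r) F}.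
        (\<Sum>(x, r)\<in>F. ennreal ((2 * r) powr s)))"

(* The limit as \<delta> tends to 0, which is an infimum by monotonicity in \<delta>. *)
definition packing_premeasure :: "real \<Rightarrow> 'a::euclidean_space set \<Rightarrow> ennreal" where
  "packing_premeasure s A = (INF \<delta>\<in>{0<..}. packing_premeasure_at \<delta> s A)"

definition packing_measure :: "real \<Rightarrow> 'a::euclidean_space set \<Rightarrow> ennreal" where
  "packing_measure s A =
     (INF U \<in> {U :: nat \<Rightarrow> 'a set. A \<subseteq> (\<Union>i. U i)}. (\<Sum>i. packing_premeasure s (U i)))"

definition packing_dim :: "'a::euclidean_space set \<Rightarrow> ereal" where
  "packing_dim A = (INF s\<in>{s. 0 \<le> s \<and> packing_measure s A = 0}. ereal s)"

(* The digit a i here is the coefficient of b^{-(i+1)}. *)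
definition missing_digit_set :: "nat \<Rightarrow> nat set \<Rightarrow> real set" where
  "missing_digit_set b W =
     {(\<Sum>i. real (a i) / real b ^ Suc i) | a :: nat \<Rightarrow> nat. \<forall>i. a i \<in> W}"

(* In both exponents the solutions are counted as rational numbers, not as pairs of
   a numerator and a denominator: otherwise the multiples of a single fraction equal
   to \<xi> would count as infinitely many solutions for every \<mu>. *)
definition irrationality_exponent :: "real \<Rightarrow> ereal" where
  "irrationality_exponent \<xi> =
     (SUP \<mu> \<in> {\<mu> :: real. infinite {x :: real. \<exists>(p :: int) (q :: nat).
          q \<ge> 1 \<and> x = real_of_int p / real q \<and> \<bar>\<xi> - x\<bar> \<le> real q powr (- \<mu>)}}. ereal \<mu>)"

definition exact_exponent_set :: "real \<Rightarrow> real set" where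
  "exact_exponent_set \<tau> = {\<xi>. irrationality_exponent \<xi> = ereal \<tau>}"

definition b_ary_exponent :: "nat \<Rightarrow> real \<Rightarrow> ereal" where
  "b_ary_exponent b \<xi> =
     (SUP \<mu> \<in> {\<mu> :: real. infinite {x :: real. \<exists>(p :: int) (N :: nat).
          x = real_of_int p / real b ^ N \<and> \<bar>\<xi> - x\<bar> \<le> (real b ^ N) powr (- \<mu>)}}. ereal \<mu>)"

definition exact_b_ary_exponent_set :: "nat \<Rightarrow> real \<Rightarrow> real set" where
  "exact_b_ary_exponent_set b \<tau> = {\<xi>. b_ary_exponent b \<xi> = ereal \<tau>}"

end

theory Submission
  imports Defs "HOL-Computational_Algebra.Primes"
begin

text \<open>Cut the digit expansion of a generic point x of K (irrationality exponent 2, b-ary exponent 1, 0 in W)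
  into blocks whose endpoints grow alternately by the factors lam0 and lam1, and let x = x0 + x1 where x0 keeps the
  digits in the even blocks and x1 those in the odd blocks. The truncation of x0 before a block of zeros of relative
  length lam0 approximates x0 to order lam0. Any other rational p/q is kept away from x0 by comparison with this
  truncation when q is not too large, and beyond that range because x0 differs from x by a rational
  with a small denominator, up to a negligible error, while x is not very well approximable. The two ranges overlap
  exactly when both exponents exceed (5 + sqrt 17) / 2. Since the truncations have to be almost reduced fractions,
  the endpoints of the blocks are chosen with care.

  The generic points carry the s-dimensional Hausdorff measure of K, s = log |W| / log b: rationals with denominators
  of the same size are separated, and K meets only few neighbourhoods of separated points. Hence the sumset of
  the two sets of exponents lam0 and lam1 has dimension s, and so has their product. A translation by a rational
  removes the assumption 0 in W. Letting lam1 tend to infinity, one summand has Hausdorff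
  dimension tending to 0, so that the other one has packing dimension at least s.\<close>

subsection \<open>Hausdorff measure\<close>

text \<open>Let q = b^u, and let a block of zeros of one summand occupy the positions from n to m
  and its next block of digits those from m to n', with m about lam0 n and n' about lam1 m.
  Comparison with the truncation at n works while u < m - n. Beyond that, p/q is moved by the
  truncation of the other summand at m to a fraction of denominator q b^m; since x is not very well
  approximable, this guarantees a distance of about b^(-2(u+m)). That distance must exceed the error
  b^(-n') for u up to n'/(lam0 - 1), and 2(u+m) must stay below lam0 u for u from m - n on. These
  two demands lead to t^2 - 5 t + 2. The b-ary exponent 1 excludes long runs of zero digits. It
  serves twice: the error of a truncation is not much smaller than the block of zeros dictates, and
  close to every desired endpoint there are enough nonzero digits to find one where the truncation
  hardly cancels. Heavy cancellation could push the exponent above the prescribed value. For the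
  packing dimension, covers of one summand are needed at scales dictated by a cover of the other;
  this is what packings provide.\<close>

lemma diameter_leI:
  fixes S :: "'a::metric_space set"
  assumes "0 \<le> d" "\<And>x y. x \<in> S \<Longrightarrow> y \<in> S \<Longrightarrow> dist x y \<le> d"
  shows "diameter S \<le> d"
  unfolding diameter_def using assms by (auto intro!: cSUP_least)

lemma diam_powr_le:
  assumes "0 \<le> s" "0 < d" "bounded U" "diameter U \<le> d"
  shows "diam_powr s U \<le> ennreal (d powr s)"
  using assms by (auto simp: diam_powr_def intro!: ennreal_leI powr_mono2 diameter_ge_0)

lemma diam_powr_antimono:
  assumes "0 \<le> s" "s \<le> t" "bounded U" "diameter U \<le> 1"
  shows "diam_powr t U \<le> diam_powr s U"
proof -
  have d: "0 \<le> diameter U" using assms(3) by (rule diameter_ge_0)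
  have "diameter U powr t \<le> 1" if "t \<noteq> 0"
    using powr_mono2[of t "diameter U" 1] d assms that by simp
  moreover have "diameter U powr t \<le> diameter U powr s"
    using powr_mono'[of s t "diameter U"] d assms by simp
  ultimately show ?thesis
    using assms(1,2) by (auto simp: diam_powr_def intro!: ennreal_leI)
qed

lemma hausdorff_premeasure_le_cover:
  assumes "A \<subseteq> (\<Union>i. U i)" "\<And>i. bounded (U i)" "\<And>i. diameter (U i) \<le> \<delta>"
  shows "hausdorff_premeasure \<delta> s A \<le> (\<Sum>i. diam_powr s (U i))"
  unfolding hausdorff_premeasure_def using assms by (intro INF_lower) auto

lemma hausdorff_premeasure_lessD:
  assumes "hausdorff_premeasure \<delta> s A < c"
  shows "\<exists>U. A \<subseteq> (\<Union>i. U i) \<and> (\<forall>i. bounded (U i)) \<and> (\<forall>i. diameter (U i) \<le> \<delta>) \<and>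
    (\<Sum>i. diam_powr s (U i)) < c"
  using assms unfolding hausdorff_premeasure_def INF_less_iff by blast

lemma hausdorff_premeasure_mono:
  assumes "A \<subseteq> B"
  shows "hausdorff_premeasure \<delta> s A \<le> hausdorff_premeasure \<delta> s B"
  unfolding hausdorff_premeasure_def using assms by (intro INF_superset_mono) auto

lemma hausdorff_premeasure_UN:
  "hausdorff_premeasure \<delta> s (\<Union>n::nat. A n) \<le> (\<Sum>n. hausdorff_premeasure \<delta> s (A n))"
proof (rule ennreal_le_epsilon)
  fix e :: real assume fin: "(\<Sum>n. hausdorff_premeasure \<delta> s (A n)) < top" and e: "0 < e"
  have "\<exists>U. A n \<subseteq> (\<Union>i. U i) \<and> (\<forall>i. bounded (U i) \<and> diameter (U i) \<le> \<delta>) \<and>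
      (\<Sum>i. diam_powr s (U i)) \<le> hausdorff_premeasure \<delta> s (A n) + ennreal (e * (1/2) ^ Suc n)" for n
  proof -
    \<comment> \<open>Finiteness makes \<open>a < a + e\<close> strict in the extended reals, so
      that a nearly optimal cover exists.\<close>
    have "hausdorff_premeasure \<delta> s (A n) < top"
      using fin by (meson ennreal_suminf_lessD)
    then have "hausdorff_premeasure \<delta> s (A n) + 0
      < hausdorff_premeasure \<delta> s (A n) + ennreal (e * (1/2) ^ Suc n)"
      using e by (intro ennreal_add_left_cancel_less[THEN iffD2]) auto
    then obtain U where "A n \<subseteq> (\<Union>i. U i)" "\<forall>i. bounded (U i)" "\<forall>i. diameter (U i) \<le> \<delta>"
        "(\<Sum>i. diam_powr s (U i)) < hausdorff_premeasure \<delta> s (A n) + ennreal (e * (1/2) ^ Suc n)"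
      using hausdorff_premeasure_lessD[of \<delta> s "A n"] unfolding add_0_right by meson
    then show ?thesis by (intro exI[of _ U]) (simp add: less_imp_le)
  qed
  from choice[OF allI, OF this] obtain U where *: "\<forall>n. A n \<subseteq> (\<Union>i. U n i) \<and>
      (\<forall>i. bounded (U n i) \<and> diameter (U n i) \<le> \<delta>) \<and>
      (\<Sum>i. diam_powr s (U n i)) \<le> hausdorff_premeasure \<delta> s (A n) + ennreal (e * (1/2) ^ Suc n)"
    by (rule exE)
  then have U: "\<And>n. A n \<subseteq> (\<Union>i. U n i)" "\<And>n i. bounded (U n i)"
      "\<And>n i. diameter (U n i) \<le> \<delta>"
      "\<And>n. (\<Sum>i. diam_powr s (U n i)) \<le> hausdorff_premeasure \<delta> s (A n) + ennreal (e * (1/2) ^ Suc n)"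
    by simp_all
  define V where "V k = (case prod_decode k of (n, i) \<Rightarrow> U n i)" for k
  have "(\<Union>n. A n) \<subseteq> (\<Union>k. V k)"
  proof
    fix x assume "x \<in> (\<Union>n. A n)"
    then obtain n i where "x \<in> U n i" using U(1) by blast
    then have "x \<in> V (prod_encode (n, i))" by (simp add: V_def)
    then show "x \<in> (\<Union>k. V k)" by blast
  qed
  then have "hausdorff_premeasure \<delta> s (\<Union>n. A n) \<le> (\<Sum>k. diam_powr s (V k))"
    by (rule hausdorff_premeasure_le_cover) (auto simp: V_def U split: prod.split)
  also have "\<dots> = (\<Sum>n. \<Sum>i. diam_powr s (U n i))"
    using suminf_ennreal_2dimen[of "\<lambda>n. \<Sum>i. diam_powr s (U n i)" "\<lambda>(n, i). diam_powr s (U n i)"]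
    by (simp add: V_def o_def case_prod_unfold)
  also have "\<dots> \<le> (\<Sum>n. hausdorff_premeasure \<delta> s (A n) + ennreal (e * (1/2) ^ Suc n))"
    by (intro suminf_le U) auto
  also have "\<dots> = (\<Sum>n. hausdorff_premeasure \<delta> s (A n)) + (\<Sum>n. ennreal (e * (1/2) ^ Suc n))"
    by (intro suminf_add[symmetric]) auto
  also have "(\<Sum>n. ennreal (e * (1/2) ^ Suc n)) = ennreal e"
    using sums_mult[OF power_half_series, of e] e by (intro sums_unique[symmetric] sums_ennreal[THEN iffD2]) auto
  finally show "hausdorff_premeasure \<delta> s (\<Union>n. A n)
      \<le> (\<Sum>n. hausdorff_premeasure \<delta> s (A n)) + ennreal e" .
qed

lemma hausdorff_premeasure_finite_cover:
  assumes "finite F" "A \<subseteq> (\<Union>x\<in>F. C x)" "\<And>x. x \<in> F \<Longrightarrow> bounded (C x)"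
    "\<And>x. x \<in> F \<Longrightarrow> diameter (C x) \<le> d" "0 < d" "d \<le> \<delta>" "0 \<le> s"
  shows "hausdorff_premeasure \<delta> s A \<le> ennreal (real (card F) * d powr s)"
proof -
  obtain f where f: "bij_betw f {..<card F} F"
    using ex_bij_betw_nat_finite[OF assms(1)] by (auto simp: atLeast0LessThan)
  define U where "U i = (if i < card F then C (f i) else {})" for i
  have fF: "f i \<in> F" if "i < card F" for i using f that by (auto simp: bij_betw_def)
  have "A \<subseteq> (\<Union>i. U i)"
  proof
    fix a assume "a \<in> A"
    then obtain x where x: "x \<in> F" "a \<in> C x" using assms(2) by blast
    from x(1) have "x \<in> f ` {..<card F}" by (simp only: bij_betw_imp_surj_on[OF f])
    then obtain i where "i < card F" "f i = x" by auto
    then show "a \<in> (\<Union>i. U i)" using x by (auto simp: U_def)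
  qed
  then have "hausdorff_premeasure \<delta> s A \<le> (\<Sum>i. diam_powr s (U i))"
  proof (rule hausdorff_premeasure_le_cover)
    fix i
    show "bounded (U i)"
    proof (cases "i < card F")
      case True
      then show ?thesis using assms(3)[OF fF[OF True]] by (simp add: U_def)
    qed (simp add: U_def)
    show "diameter (U i) \<le> \<delta>"
    proof (cases "i < card F")
      case True
      then show ?thesis using assms(4)[OF fF[OF True]] assms(6) by (simp add: U_def)
    qed (use assms(5,6) in \<open>simp add: U_def\<close>)
  qed
  also have "\<dots> = (\<Sum>i<card F. diam_powr s (U i))"
    by (intro suminf_finite) (auto simp: U_def diam_powr_def)
  also have "\<dots> \<le> (\<Sum>i<card F. ennreal (d powr s))"
  proof (rule sum_mono)
    fix i assume "i \<in> {..<card F}"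
    then have i: "i < card F" by simp
    show "diam_powr s (U i) \<le> ennreal (d powr s)"
      using i assms(3,4)[OF fF[OF i]] assms(5,7) by (intro diam_powr_le) (simp_all add: U_def)
  qed
  also have "\<dots> = ennreal (real (card F) * d powr s)"
    by (simp add: ennreal_mult ennreal_of_nat_eq_real_of_nat)
  finally show ?thesis .
qed

section \<open>Sets of Hausdorff measure zero\<close>

lemma hausdorff_measure_zeroI:
  assumes "\<And>\<delta> e. \<delta> > 0 \<Longrightarrow> e > 0 \<Longrightarrow> hausdorff_premeasure \<delta> s A \<le> ennreal e"
  shows "hausdorff_measure s A = 0"
proof -
  have "hausdorff_premeasure \<delta> s A \<le> 0" if "\<delta> > 0" for \<delta>
  proof (rule ennreal_le_epsilon)
    fix e :: real assume "0 < e"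
    show "hausdorff_premeasure \<delta> s A \<le> 0 + ennreal e"
      using assms[OF that \<open>0 < e\<close>] by simp
  qed
  then have "hausdorff_measure s A \<le> 0"
    unfolding hausdorff_measure_def by (intro SUP_least) simp
  then show ?thesis by simp
qed

lemma hausdorff_measure_zeroD:
  assumes "hausdorff_measure s A = 0" "\<delta> > 0"
  shows "hausdorff_premeasure \<delta> s A = 0"
proof -
  have "hausdorff_premeasure \<delta> s A \<le> hausdorff_measure s A"
    unfolding hausdorff_measure_def using assms(2) by (intro SUP_upper) auto
  then show ?thesis using assms(1) by simp
qed

lemma hausdorff_null_subset:
  assumes "hausdorff_measure s B = 0" "A \<subseteq> B"
  shows "hausdorff_measure s A = 0"
proof (rule hausdorff_measure_zeroI)
  fix \<delta> e :: real assume "\<delta> > 0" "e > 0"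
  show "hausdorff_premeasure \<delta> s A \<le> ennreal e"
    using hausdorff_premeasure_mono[OF assms(2), of \<delta> s] hausdorff_measure_zeroD[OF assms(1) \<open>\<delta> > 0\<close>]
    by simp
qed

lemma hausdorff_null_UN:
  assumes "\<And>n::nat. hausdorff_measure s (A n) = 0"
  shows "hausdorff_measure s (\<Union>n. A n) = 0"
proof (rule hausdorff_measure_zeroI)
  fix \<delta> e :: real assume "\<delta> > 0" "e > 0"
  have "hausdorff_premeasure \<delta> s (\<Union>n. A n) \<le> 0"
    using hausdorff_premeasure_UN[of \<delta> s A] hausdorff_measure_zeroD[OF assms \<open>\<delta> > 0\<close>] by simp
  then show "hausdorff_premeasure \<delta> s (\<Union>n. A n) \<le> ennreal e" by simp
qed

lemma hausdorff_null_Un: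
  assumes "hausdorff_measure s A = 0" "hausdorff_measure s B = 0"
  shows "hausdorff_measure s (A \<union> B) = 0"
proof -
  define C where "C n = (if n = 0 then A else B)" for n :: nat
  have "A \<union> B \<subseteq> C 0 \<union> C 1" by (simp add: C_def)
  also have "\<dots> \<subseteq> (\<Union>n. C n)" by blast
  finally have "A \<union> B \<subseteq> (\<Union>n. C n)" .
  moreover have "hausdorff_measure s (\<Union>n. C n) = 0"
    by (rule hausdorff_null_UN) (simp add: C_def assms)
  ultimately show ?thesis by (rule hausdorff_null_subset[rotated])
qed

lemma hausdorff_null_exponent_mono:
  assumes "hausdorff_measure s A = 0" "0 \<le> s" "s \<le> t"
  shows "hausdorff_measure t A = 0"
proof (rule hausdorff_measure_zeroI)
  fix \<delta> e :: real assume "\<delta> > 0" "e > 0"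
  \<comment> \<open>Only for diameters at most 1 does raising the exponent decrease the
    terms.\<close>
  then have "hausdorff_premeasure (min \<delta> 1) s A < ennreal e"
    using hausdorff_measure_zeroD[OF assms(1)] by simp
  from hausdorff_premeasure_lessD[OF this] obtain U where U: "A \<subseteq> (\<Union>i. U i)"
      "\<forall>i. bounded (U i)" "\<forall>i. diameter (U i) \<le> min \<delta> 1" "(\<Sum>i. diam_powr s (U i)) < ennreal e"
    by (elim exE conjE) (rule that)
  note U = U(1) U(2,3)[rule_format] U(4)
  have "hausdorff_premeasure \<delta> t A \<le> (\<Sum>i. diam_powr t (U i))"
    by (rule hausdorff_premeasure_le_cover[OF U(1,2)]) (use U(3) in simp)
  also have "\<dots> \<le> (\<Sum>i. diam_powr s (U i))"
  proof (rule suminf_le)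
    show "diam_powr t (U i) \<le> diam_powr s (U i)" for i
      using U(3)[of i] by (intro diam_powr_antimono assms U(2)) simp
  qed auto
  finally show "hausdorff_premeasure \<delta> t A \<le> ennreal e" using U(4) by simp
qed

lemma hausdorff_null_lipschitz_image:
  assumes "hausdorff_measure s A = 0" "0 \<le> s" "0 < L"
    and lip: "\<And>x y. x \<in> A \<Longrightarrow> y \<in> A \<Longrightarrow> dist (f x) (f y) \<le> L * dist x y"
  shows "hausdorff_measure s (f ` A) = 0"
proof (rule hausdorff_measure_zeroI)
  fix \<delta> e :: real assume \<delta>: "\<delta> > 0" and e: "e > 0"
  have "hausdorff_premeasure (\<delta> / L) s A < ennreal (e / L powr s)"
    using hausdorff_measure_zeroD[OF assms(1)] \<delta> e \<open>0 < L\<close> by simp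
  from hausdorff_premeasure_lessD[OF this] obtain U where U: "A \<subseteq> (\<Union>i. U i)"
      "\<forall>i. bounded (U i)" "\<forall>i. diameter (U i) \<le> \<delta> / L"
      "(\<Sum>i. diam_powr s (U i)) < ennreal (e / L powr s)"
    by (elim exE conjE) (rule that)
  note U = U(1) U(2,3)[rule_format] U(4)
  \<comment> \<open>Only the part of \<open>U i\<close> inside A is mapped, as the Lipschitz bound
    is assumed on A.\<close>
  define V where "V i = f ` (U i \<inter> A)" for i
  have d: "dist u v \<le> L * diameter (U i)" if "u \<in> V i" "v \<in> V i" for u v i
  proof -
    from that obtain x y where xy: "x \<in> U i" "x \<in> A" "y \<in> U i" "y \<in> A" "u = f x" "v = f y"
      by (auto simp: V_def)
    then have "dist u v \<le> L * dist x y" using lip by simp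
    also have "\<dots> \<le> L * diameter (U i)"
      using diameter_bounded_bound[OF U(2) xy(1,3)] \<open>0 < L\<close> by simp
    finally show ?thesis .
  qed
  have bV: "bounded (V i)" for i
    unfolding bounded_two_points using d by blast
  have dV: "diameter (V i) \<le> L * diameter (U i)" for i
    using d diameter_ge_0[OF U(2)] \<open>0 < L\<close> by (intro diameter_leI) auto
  have "hausdorff_premeasure \<delta> s (f ` A) \<le> (\<Sum>i. diam_powr s (V i))"
  proof (rule hausdorff_premeasure_le_cover)
    show "f ` A \<subseteq> (\<Union>i. V i)" using U(1) unfolding V_def by blast
    show "bounded (V i)" for i by (rule bV)
    show "diameter (V i) \<le> \<delta>" for i
      using dV[of i] U(3)[of i] \<open>0 < L\<close> by (simp add: field_simps)
  qed
  also have "\<dots> \<le> (\<Sum>i. ennreal (L powr s) * diam_powr s (U i))"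
  proof (intro suminf_le)
    fix i
    have "diameter (V i) powr s \<le> L powr s * diameter (U i) powr s"
      using powr_mono2[OF assms(2) diameter_ge_0[OF bV] dV[of i]] \<open>0 < L\<close> diameter_ge_0[OF U(2)]
      by (simp add: powr_mult)
    then have "ennreal (diameter (V i) powr s) \<le> ennreal (L powr s) * ennreal (diameter (U i) powr s)"
      by (simp add: ennreal_mult[symmetric] ennreal_leI)
    \<comment> \<open>Needed for the conventions of \<open>diam_powr\<close>: a nonempty set counts
      1 for s = 0, so an image may contribute only if its source does.\<close>
    moreover have "V i = {} \<or> U i \<noteq> {}" by (auto simp: V_def)
    ultimately show "diam_powr s (V i) \<le> ennreal (L powr s) * diam_powr s (U i)"
      using \<open>0 < L\<close> by (auto simp: diam_powr_def)
  qed auto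
  also have "\<dots> = ennreal (L powr s) * (\<Sum>i. diam_powr s (U i))"
    by (rule ennreal_suminf_cmult)
  also have "\<dots> \<le> ennreal (L powr s) * ennreal (e / L powr s)"
    using U(4) by (intro mult_left_mono) auto
  also have "\<dots> = ennreal e" using \<open>0 < L\<close> e by (simp add: ennreal_mult[symmetric])
  finally show "hausdorff_premeasure \<delta> s (f ` A) \<le> ennreal e" .
qed

text \<open>Borel-Cantelli for Hausdorff measure: every point of A lies in balls of arbitrarily
  large index, so each tail of the family covers A, and the tails of a convergent series tend to
  0.\<close>

lemma hausdorff_null_limsup:
  fixes A :: "'a::metric_space set"
  assumes "0 \<le> s" "\<And>n. finite (P n)" "\<And>n. 0 < r n" "r \<longlonglongrightarrow> 0"
    and sm: "summable (\<lambda>n. real (card (P n)) * (2 * r n) powr s)"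
    and cov: "\<And>x m. x \<in> A \<Longrightarrow> \<exists>n\<ge>m. \<exists>p\<in>P n. dist p x \<le> r n"
  shows "hausdorff_measure s A = 0"
proof (rule hausdorff_measure_zeroI)
  fix \<delta> e :: real assume \<delta>: "\<delta> > 0" and e: "e > 0"
  let ?f = "\<lambda>n. real (card (P n)) * (2 * r n) powr s"
  have "\<forall>\<^sub>F n in sequentially. r n < \<delta> / 2"
    using \<open>r \<longlonglongrightarrow> 0\<close> \<delta> by (intro order_tendstoD(2)[of r 0]) auto
  then obtain m1 where m1: "\<And>n. n \<ge> m1 \<Longrightarrow> r n < \<delta> / 2" by (auto simp: eventually_sequentially)
  obtain m2 where m2: "\<And>m. m \<ge> m2 \<Longrightarrow> norm (\<Sum>i. ?f (i + m)) < e"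
    using suminf_exist_split[OF e sm] by blast
  define m where "m = max m1 m2"
  have "A \<subseteq> (\<Union>n. \<Union>p\<in>P (n + m). cball p (r (n + m)))"
  proof
    fix x assume "x \<in> A"
    then obtain n p where n: "n \<ge> m" "p \<in> P n" "dist p x \<le> r n" using cov by blast
    then have "x \<in> (\<Union>p\<in>P (n - m + m). cball p (r (n - m + m)))" by auto
    then show "x \<in> (\<Union>n. \<Union>p\<in>P (n + m). cball p (r (n + m)))" by blast
  qed
  then have "hausdorff_premeasure \<delta> s A
      \<le> hausdorff_premeasure \<delta> s (\<Union>n. \<Union>p\<in>P (n + m). cball p (r (n + m)))"
    by (rule hausdorff_premeasure_mono)
  also have "\<dots> \<le> (\<Sum>n. hausdorff_premeasure \<delta> s (\<Union>p\<in>P (n + m). cball p (r (n + m))))"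
    by (rule hausdorff_premeasure_UN)
  also have "\<dots> \<le> (\<Sum>n. ennreal (?f (n + m)))"
  proof (intro suminf_le)
    fix n
    show "hausdorff_premeasure \<delta> s (\<Union>p\<in>P (n + m). cball p (r (n + m))) \<le> ennreal (?f (n + m))"
    proof (rule hausdorff_premeasure_finite_cover)
      show "diameter (cball p (r (n + m))) \<le> 2 * r (n + m)" for p
      proof (rule diameter_leI)
        show "0 \<le> 2 * r (n + m)" using assms(3)[of "n + m"] by simp
        fix x y assume "x \<in> cball p (r (n + m))" "y \<in> cball p (r (n + m))"
        then show "dist x y \<le> 2 * r (n + m)"
          using dist_triangle3[of x y p] by simp
      qed
      have "m1 \<le> n + m" by (simp add: m_def)
      from m1[OF this] show "2 * r (n + m) \<le> \<delta>" by simp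
    qed (use assms(1-3) in auto)
  qed auto
  also have "\<dots> = ennreal (\<Sum>n. ?f (n + m))"
    using summable_ignore_initial_segment[OF sm] by (intro suminf_ennreal2) auto
  also have "\<dots> \<le> ennreal e"
    using m2[of m] by (intro ennreal_leI) (auto simp: m_def)
  finally show "hausdorff_premeasure \<delta> s A \<le> ennreal e" .
qed

section \<open>Bounds for the Hausdorff dimension\<close>

lemma hausdorff_dim_geI:
  assumes "hausdorff_measure s A \<noteq> 0"
  shows "ereal s \<le> hausdorff_dim A"
  unfolding hausdorff_dim_def
proof (rule INF_greatest)
  fix t assume "t \<in> {t. 0 \<le> t \<and> hausdorff_measure t A = 0}"
  then show "ereal s \<le> ereal t"
    using hausdorff_null_exponent_mono[of t A s] assms by force
qed

lemma hausdorff_dim_nonneg: "0 \<le> hausdorff_dim A"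
  unfolding hausdorff_dim_def by (rule INF_greatest) auto

lemma hausdorff_dim_leI:
  assumes "0 \<le> s" "\<And>t. t > s \<Longrightarrow> hausdorff_measure t A = 0"
  shows "hausdorff_dim A \<le> ereal s"
proof (rule ereal_le_epsilon2)
  fix e :: real assume "e > 0"
  then have "s + e \<in> {t. 0 \<le> t \<and> hausdorff_measure t A = 0}"
    using assms(1) assms(2)[of "s + e"] by simp
  then have "hausdorff_dim A \<le> ereal (s + e)"
    unfolding hausdorff_dim_def by (rule INF_lower)
  then show "hausdorff_dim A \<le> ereal s + ereal e" by simp
qed

subsection \<open>Exponents of approximation\<close>

text \<open>Here all denominators q are counted, reduced or not. For irrational \<xi> and positive
  \<mu> this agrees with counting rational numbers, and it spares all questions of lowest
  terms.\<close>

abbreviation approximable :: "real \<Rightarrow> real \<Rightarrow> bool" where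
  "approximable \<xi> \<mu> \<equiv> \<exists>\<^sub>F q in sequentially. \<exists>p::int. \<bar>\<xi> - p / real q\<bar> \<le> real q powr (-\<mu>)"

abbreviation inapproximable :: "real \<Rightarrow> real \<Rightarrow> bool" where
  "inapproximable \<xi> \<mu> \<equiv> \<forall>\<^sub>F q in sequentially. \<forall>p::int. real q powr (-\<mu>) < \<bar>\<xi> - p / real q\<bar>"

abbreviation b_approximable :: "nat \<Rightarrow> real \<Rightarrow> real \<Rightarrow> bool" where
  "b_approximable b \<xi> \<mu> \<equiv> \<exists>\<^sub>F N in sequentially. \<exists>p::int.
    \<bar>\<xi> - p / real b ^ N\<bar> \<le> (real b ^ N) powr (-\<mu>)"

abbreviation b_inapproximable :: "nat \<Rightarrow> real \<Rightarrow> real \<Rightarrow> bool" where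
  "b_inapproximable b \<xi> \<mu> \<equiv> \<forall>\<^sub>F N in sequentially. \<forall>p::int.
    (real b ^ N) powr (-\<mu>) < \<bar>\<xi> - p / real b ^ N\<bar>"

text \<open>A common form of both exponents: the denominators are the values of D, which is
  \<open>Suc\<close> for all rational numbers and the power of b for the b-ary ones.\<close>

definition rational_solutions :: "('i \<Rightarrow> nat) \<Rightarrow> real \<Rightarrow> real \<Rightarrow> real set" where
  "rational_solutions D \<xi> \<mu> =
     {x. \<exists>(p::int) n. x = real_of_int p / real (D n) \<and> \<bar>\<xi> - x\<bar> \<le> real (D n) powr (- \<mu>)}"

lemma irrationality_exponent_eq:
  "irrationality_exponent \<xi> = (SUP \<mu>\<in>{\<mu>. infinite (rational_solutions Suc \<xi> \<mu>)}. ereal \<mu>)"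
proof -
  have "{x :: real. \<exists>(p :: int) (q :: nat). q \<ge> 1 \<and> x = real_of_int p / real q
      \<and> \<bar>\<xi> - x\<bar> \<le> real q powr (- \<mu>)} = rational_solutions Suc \<xi> \<mu>" for \<mu>
    unfolding rational_solutions_def
  proof (intro Collect_cong iffI; elim exE conjE)
    fix x p q assume "1 \<le> (q::nat)" "x = real_of_int p / real q" "\<bar>\<xi> - x\<bar> \<le> real q powr - \<mu>"
    then show "\<exists>p n. x = real_of_int p / real (Suc n) \<and> \<bar>\<xi> - x\<bar> \<le> real (Suc n) powr - \<mu>"
      by (intro exI[of _ p] exI[of _ "q - 1"]) simp
  next
    fix x p n assume "x = real_of_int p / real (Suc n)" "\<bar>\<xi> - x\<bar> \<le> real (Suc n) powr - \<mu>"
    then show "\<exists>p q. 1 \<le> q \<and> x = real_of_int p / real q \<and> \<bar>\<xi> - x\<bar> \<le> real q powr - \<mu>"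
      by (intro exI[of _ p] exI[of _ "Suc n"]) simp
  qed
  then show ?thesis unfolding irrationality_exponent_def by simp
qed

lemma b_ary_exponent_eq:
  "b_ary_exponent b \<xi> = (SUP \<mu>\<in>{\<mu>. infinite (rational_solutions (\<lambda>N. b ^ N) \<xi> \<mu>)}. ereal \<mu>)"
  unfolding b_ary_exponent_def rational_solutions_def by simp

lemma finite_fractions:
  fixes D :: "nat \<Rightarrow> nat"
  assumes "\<And>n. 1 \<le> D n"
  shows "finite {x::real. \<exists>(p::int) n. n < N \<and> x = real_of_int p / real (D n) \<and> \<bar>\<xi> - x\<bar> \<le> 1}"
proof -
  let ?S = "\<lambda>n. (\<lambda>p. real_of_int p / real (D n)) ` {p::int. \<bar>p\<bar> \<le> \<lceil>(\<bar>\<xi>\<bar> + 1) * real (D n)\<rceil>}"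
  have "{x::real. \<exists>(p::int) n. n < N \<and> x = real_of_int p / real (D n) \<and> \<bar>\<xi> - x\<bar> \<le> 1} \<subseteq> (\<Union>n<N. ?S n)"
  proof
    fix x assume "x \<in> {x::real. \<exists>(p::int) n. n < N \<and> x = real_of_int p / real (D n) \<and> \<bar>\<xi> - x\<bar> \<le> 1}"
    then obtain p n where n: "n < N" and x: "x = real_of_int p / real (D n)" "\<bar>\<xi> - x\<bar> \<le> 1" by blast
    have D: "0 < real (D n)" using assms[of n] by simp
    have "\<bar>real_of_int p\<bar> = \<bar>x\<bar> * real (D n)" using x(1) D by (simp add: abs_mult)
    also have "\<dots> \<le> (\<bar>\<xi>\<bar> + 1) * real (D n)" using x(2) D by (intro mult_right_mono) auto
    finally have "real_of_int \<bar>p\<bar> \<le> (\<bar>\<xi>\<bar> + 1) * real (D n)" by simp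
    then have "\<bar>p\<bar> \<le> \<lceil>(\<bar>\<xi>\<bar> + 1) * real (D n)\<rceil>" by linarith
    then show "x \<in> (\<Union>n<N. ?S n)" using n x(1) by auto
  qed
  moreover have "finite {p::int. \<bar>p\<bar> \<le> k}" for k
    by (rule finite_subset[of _ "{-k..k}"]) auto
  then have "finite (\<Union>n<N. ?S n)" by simp
  ultimately show ?thesis by (rule finite_subset)
qed

lemma finite_rational_solutions:
  fixes D :: "nat \<Rightarrow> nat"
  assumes D: "\<And>n. 1 \<le> D n" and "0 \<le> \<mu>"
    and ev: "\<forall>\<^sub>F n in sequentially. \<forall>p::int. real (D n) powr (- \<mu>) < \<bar>\<xi> - p / D n\<bar>"
  shows "finite (rational_solutions D \<xi> \<mu>)"
proof -
  obtain N where N: "\<And>n p. n \<ge> N \<Longrightarrow> real (D n) powr (- \<mu>) < \<bar>\<xi> - real_of_int p / D n\<bar>"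
    using ev unfolding eventually_sequentially by blast
  have "rational_solutions D \<xi> \<mu> \<subseteq>
      {x::real. \<exists>(p::int) n. n < N \<and> x = real_of_int p / real (D n) \<and> \<bar>\<xi> - x\<bar> \<le> 1}"
  proof
    fix x assume "x \<in> rational_solutions D \<xi> \<mu>"
    then obtain p n where x: "x = real_of_int p / real (D n)" "\<bar>\<xi> - x\<bar> \<le> real (D n) powr (- \<mu>)"
      unfolding rational_solutions_def by blast
    then have "n < N" using N[of n p] by force
    moreover have "real (D n) powr (- \<mu>) \<le> 1"
      using powr_mono[of "- \<mu>" 0 "real (D n)"] D[of n] \<open>0 \<le> \<mu>\<close> by simp
    ultimately show "x \<in> {x::real. \<exists>(p::int) n. n < N \<and> x = real_of_int p / real (D n) \<and> \<bar>\<xi> - x\<bar> \<le> 1}"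
      using x by force
  qed
  then show ?thesis using finite_fractions[OF D] by (rule finite_subset)
qed

lemma finite_rational_solutions_gap:
  assumes "finite (rational_solutions D \<xi> \<mu>)" "\<xi> \<notin> \<rat>"
  obtains d where "0 < d" "\<And>x. x \<in> rational_solutions D \<xi> \<mu> \<Longrightarrow> d \<le> \<bar>\<xi> - x\<bar>"
proof (rule that)
  let ?d = "Min (insert 1 ((\<lambda>x. \<bar>\<xi> - x\<bar>) ` rational_solutions D \<xi> \<mu>))"
  have "\<bar>\<xi> - x\<bar> > 0" if "x \<in> rational_solutions D \<xi> \<mu>" for x
  proof -
    have "x \<in> \<rat>" using that unfolding rational_solutions_def by auto
    then show ?thesis using assms(2) by auto
  qed
  then show "0 < ?d" using assms(1) by (subst Min_gr_iff) auto
  show "?d \<le> \<bar>\<xi> - x\<bar>" if "x \<in> rational_solutions D \<xi> \<mu>" for x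
    using that assms(1) by (intro Min_le) auto
qed

lemma infinite_rational_solutions_iff:
  fixes D :: "nat \<Rightarrow> nat"
  assumes D: "\<And>n. 1 \<le> D n" "filterlim D at_top sequentially" and "0 < \<mu>" "\<xi> \<notin> \<rat>"
  shows "infinite (rational_solutions D \<xi> \<mu>) \<longleftrightarrow>
    (\<exists>\<^sub>F n in sequentially. \<exists>p::int. \<bar>\<xi> - p / D n\<bar> \<le> real (D n) powr (- \<mu>))" (is "_ = ?R")
proof
  assume inf: "infinite (rational_solutions D \<xi> \<mu>)"
  show ?R
  proof (rule ccontr)
    assume "\<not> ?R"
    then have "finite (rational_solutions D \<xi> \<mu>)"
      using \<open>0 < \<mu>\<close> D(1) by (intro finite_rational_solutions) (auto simp: not_frequently not_le)
    then show False using inf by simp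
  qed
next
  assume R: ?R
  show "infinite (rational_solutions D \<xi> \<mu>)"
  proof
    assume fin: "finite (rational_solutions D \<xi> \<mu>)"
    obtain d where d: "0 < d" "\<And>x. x \<in> rational_solutions D \<xi> \<mu> \<Longrightarrow> d \<le> \<bar>\<xi> - x\<bar>"
      using finite_rational_solutions_gap[OF fin \<open>\<xi> \<notin> \<rat>\<close>] by metis
    have "(\<lambda>n. real (D n) powr (- \<mu>)) \<longlonglongrightarrow> 0"
      using \<open>0 < \<mu>\<close> by (intro tendsto_neg_powr filterlim_compose[OF filterlim_real_sequentially D(2)]) auto
    then have "\<forall>\<^sub>F n in sequentially. real (D n) powr (- \<mu>) < d"
      using d(1) by (rule order_tendstoD(2))
    from frequently_eventually_frequently[OF R this]
    obtain n and p :: int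
      where n: "\<bar>\<xi> - p / D n\<bar> \<le> real (D n) powr (- \<mu>)" "real (D n) powr (- \<mu>) < d"
      by (auto dest!: frequently_ex)
    then have "real_of_int p / D n \<in> rational_solutions D \<xi> \<mu>" unfolding rational_solutions_def by auto
    then have "d \<le> \<bar>\<xi> - real_of_int p / D n\<bar>" by (rule d(2))
    then show False using n by simp
  qed
qed

text \<open>Approximability is monotone in \<mu>, so the supremum is \<tau> as soon as the smaller
  \<mu> occur and no larger one does. Only positive \<mu> are asked for, since there the solutions
  can be counted by denominators.\<close>

lemma exponent_SUP_eq_iff:
  fixes D :: "nat \<Rightarrow> nat"
  assumes D: "\<And>n. 1 \<le> D n" "filterlim D at_top sequentially" and "0 < \<tau>" "\<xi> \<notin> \<rat>"
  shows "(SUP \<mu>\<in>{\<mu>. infinite (rational_solutions D \<xi> \<mu>)}. ereal \<mu>) = ereal \<tau> \<longleftrightarrow>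
    (\<forall>\<mu>. 0 < \<mu> \<longrightarrow> \<mu> < \<tau> \<longrightarrow> (\<exists>\<^sub>F n in sequentially. \<exists>p::int. \<bar>\<xi> - p / D n\<bar> \<le> real (D n) powr (- \<mu>))) \<and>
    (\<forall>\<mu>>\<tau>. \<forall>\<^sub>F n in sequentially. \<forall>p::int. real (D n) powr (- \<mu>) < \<bar>\<xi> - p / D n\<bar>)"
proof -
  let ?I = "{\<mu>. infinite (rational_solutions D \<xi> \<mu>)}"
  let ?F = "\<lambda>\<mu>. \<exists>\<^sub>F n in sequentially. \<exists>p::int. \<bar>\<xi> - p / D n\<bar> \<le> real (D n) powr (- \<mu>)"
  have F: "\<mu> \<in> ?I \<longleftrightarrow> ?F \<mu>" if "0 < \<mu>" for \<mu>
    using infinite_rational_solutions_iff[OF D that \<open>\<xi> \<notin> \<rat>\<close>] by simp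
  have nF: "\<not> ?F \<mu> \<longleftrightarrow> (\<forall>\<^sub>F n in sequentially. \<forall>p::int. real (D n) powr (- \<mu>) < \<bar>\<xi> - p / D n\<bar>)" for \<mu>
    by (simp add: not_frequently not_le)
  have mono: "?F \<mu>'" if "?F \<mu>" "\<mu>' \<le> \<mu>" for \<mu> \<mu>'
    using that(1)
  proof (rule frequently_elim1)
    fix n assume "\<exists>p::int. \<bar>\<xi> - p / D n\<bar> \<le> real (D n) powr (- \<mu>)"
    moreover have "real (D n) powr (- \<mu>) \<le> real (D n) powr (- \<mu>')"
      using D(1)[of n] that(2) by (intro powr_mono) auto
    ultimately show "\<exists>p::int. \<bar>\<xi> - p / D n\<bar> \<le> real (D n) powr (- \<mu>')" by (meson order_trans)
  qed
  show ?thesis unfolding nF[symmetric]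
  proof (intro iffI conjI allI impI)
    assume S: "(SUP \<mu>\<in>?I. ereal \<mu>) = ereal \<tau>"
    {
      fix \<mu> assume "0 < \<mu>" "\<mu> < \<tau>"
      then have "ereal \<mu> < (SUP \<mu>\<in>?I. ereal \<mu>)" using S by simp
      then obtain \<nu> where "\<nu> \<in> ?I" "\<mu> < \<nu>" unfolding less_SUP_iff by auto
      then show "?F \<mu>" using F[of \<nu>] mono[of \<nu> \<mu>] \<open>0 < \<mu>\<close> by auto
    next
      fix \<mu> assume "\<tau> < \<mu>"
      show "\<not> ?F \<mu>"
      proof
        assume "?F \<mu>"
        then have "\<mu> \<in> ?I" using F[of \<mu>] \<open>0 < \<tau>\<close> \<open>\<tau> < \<mu>\<close> by auto
        then have "ereal \<mu> \<le> (SUP \<mu>\<in>?I. ereal \<mu>)" by (rule SUP_upper)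
        then show False using S \<open>\<tau> < \<mu>\<close> by simp
      qed
    }
  next
    assume A: "(\<forall>\<mu>. 0 < \<mu> \<longrightarrow> \<mu> < \<tau> \<longrightarrow> ?F \<mu>) \<and> (\<forall>\<mu>>\<tau>. \<not> ?F \<mu>)"
    show "(SUP \<mu>\<in>?I. ereal \<mu>) = ereal \<tau>"
    proof (rule antisym)
      show "(SUP \<mu>\<in>?I. ereal \<mu>) \<le> ereal \<tau>"
      proof (rule SUP_least)
        fix \<mu> assume "\<mu> \<in> ?I"
        show "ereal \<mu> \<le> ereal \<tau>"
        proof (rule ccontr)
          assume "\<not> ereal \<mu> \<le> ereal \<tau>"
          then have "\<tau> < \<mu>" by simp
          then show False using A F[of \<mu>] \<open>\<mu> \<in> ?I\<close> \<open>0 < \<tau>\<close> by auto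
        qed
      qed
      show "ereal \<tau> \<le> (SUP \<mu>\<in>?I. ereal \<mu>)"
      proof (rule ereal_le_epsilon2)
        fix e :: real assume "e > 0"
        \<comment> \<open>The maximum with \<tau>/2 keeps \<mu> positive when e is large.\<close>
        define \<mu> where "\<mu> = max (\<tau> / 2) (\<tau> - e)"
        have \<mu>: "0 < \<mu>" "\<mu> < \<tau>" "\<tau> \<le> \<mu> + e" using \<open>0 < \<tau>\<close> \<open>e > 0\<close> by (auto simp: \<mu>_def max_def)
        then have "\<mu> \<in> ?I" using A F by blast
        then have "ereal \<mu> \<le> (SUP \<mu>\<in>?I. ereal \<mu>)" by (rule SUP_upper)
        then have "ereal \<mu> + ereal e \<le> (SUP \<mu>\<in>?I. ereal \<mu>) + ereal e" by (rule add_right_mono)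
        moreover have "ereal \<tau> \<le> ereal \<mu> + ereal e" using \<mu>(3) by simp
        ultimately show "ereal \<tau> \<le> (SUP \<mu>\<in>?I. ereal \<mu>) + ereal e" by (rule order_trans[rotated])
      qed
    qed
  qed
qed

lemma exact_exponent_set_iff:
  assumes "0 < \<tau>" "\<xi> \<notin> \<rat>"
  shows "\<xi> \<in> exact_exponent_set \<tau> \<longleftrightarrow>
    (\<forall>\<mu>. 0 < \<mu> \<longrightarrow> \<mu> < \<tau> \<longrightarrow> approximable \<xi> \<mu>) \<and>
    (\<forall>\<mu>>\<tau>. inapproximable \<xi> \<mu>)"
proof -
  have fr: "frequently (\<lambda>n. P (Suc n)) sequentially \<longleftrightarrow> frequently P sequentially" for P
    unfolding frequently_def by (simp only: eventually_sequentially_Suc[of "\<lambda>n. \<not> P n"])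
  have 1: "(\<exists>\<^sub>F n in sequentially. \<exists>p::int. \<bar>\<xi> - p / real (Suc n)\<bar> \<le> real (Suc n) powr (- \<mu>)) \<longleftrightarrow>
      approximable \<xi> \<mu>" for \<mu>
    by (rule fr)
  have 2: "(\<forall>\<^sub>F n in sequentially. \<forall>p::int. real (Suc n) powr (- \<mu>) < \<bar>\<xi> - p / real (Suc n)\<bar>) \<longleftrightarrow>
      inapproximable \<xi> \<mu>" for \<mu>
    by (rule eventually_sequentially_Suc)
  show ?thesis
    unfolding exact_exponent_set_def mem_Collect_eq irrationality_exponent_eq
    using exponent_SUP_eq_iff[of Suc \<tau> \<xi>] filterlim_Suc assms unfolding 1 2 by simp
qed

lemma exact_b_ary_exponent_set_iff:
  assumes "2 \<le> b" "0 < \<tau>" "\<xi> \<notin> \<rat>"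
  shows "\<xi> \<in> exact_b_ary_exponent_set b \<tau> \<longleftrightarrow>
    (\<forall>\<mu>. 0 < \<mu> \<longrightarrow> \<mu> < \<tau> \<longrightarrow> b_approximable b \<xi> \<mu>) \<and>
    (\<forall>\<mu>>\<tau>. b_inapproximable b \<xi> \<mu>)"
proof -
  have "filterlim (\<lambda>N. b ^ N) at_top sequentially"
  proof (rule filterlim_at_top_mono)
    show "filterlim (\<lambda>N::nat. N) at_top sequentially" by (rule filterlim_ident)
    have "N \<le> b ^ N" for N using assms(1) less_exp[of N] power_mono[of 2 b N] by linarith
    then show "\<forall>\<^sub>F N in sequentially. N \<le> b ^ N" by simp
  qed
  then show ?thesis
    unfolding exact_b_ary_exponent_set_def mem_Collect_eq b_ary_exponent_eq
    by (subst exponent_SUP_eq_iff) (use assms in auto)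
qed

text \<open>A fraction with denominator q that differs from \<xi> = a/c is at distance at least 1/(c
  q), too far for an exponent above 1 once q is large. Hence exact exponents above 1 occur for
  irrational numbers only.\<close>

lemma irrationality_exponent_rational:
  assumes "\<xi> \<in> \<rat>"
  shows "irrationality_exponent \<xi> \<le> 1"
  unfolding irrationality_exponent_eq
proof (rule SUP_least)
  fix \<mu> assume "\<mu> \<in> {\<mu>. infinite (rational_solutions Suc \<xi> \<mu>)}"
  then have inf: "infinite (rational_solutions Suc \<xi> \<mu>)" by simp
  from assms obtain a c :: int where ac: "c > 0" "\<xi> = real_of_int a / real_of_int c"
    by (auto elim: Rats_cases')
  show "ereal \<mu> \<le> 1"
  proof (rule ccontr)
    assume "\<not> ereal \<mu> \<le> 1"
    then have \<mu>: "\<mu> > 1" by (simp add: one_ereal_def)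
    have "(\<lambda>n. real (Suc n) powr (- (\<mu> - 1))) \<longlonglongrightarrow> 0"
      using \<mu> by (intro tendsto_neg_powr filterlim_compose[OF filterlim_real_sequentially filterlim_Suc]) auto
    then have "\<forall>\<^sub>F n in sequentially. real (Suc n) powr (- (\<mu> - 1)) < 1 / c"
      using ac(1) by (intro order_tendstoD(2)) auto
    then obtain N where N: "\<And>n. n \<ge> N \<Longrightarrow> real (Suc n) powr (- (\<mu> - 1)) < 1 / c"
      unfolding eventually_sequentially by blast
    have "rational_solutions Suc \<xi> \<mu> \<subseteq> insert \<xi>
        {x::real. \<exists>(p::int) n. n < N \<and> x = real_of_int p / real (Suc n) \<and> \<bar>\<xi> - x\<bar> \<le> 1}"
    proof
      fix x assume "x \<in> rational_solutions Suc \<xi> \<mu>"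
      then obtain p n where x: "x = real_of_int p / real (Suc n)" "\<bar>\<xi> - x\<bar> \<le> real (Suc n) powr (- \<mu>)"
        unfolding rational_solutions_def by blast
      show "x \<in> insert \<xi>
        {x::real. \<exists>(p::int) n. n < N \<and> x = real_of_int p / real (Suc n) \<and> \<bar>\<xi> - x\<bar> \<le> 1}"
      proof (cases "x = \<xi>")
        case False
        define z where "z = a * int (Suc n) - p * c"
        have eq: "\<xi> - x = real_of_int z / (c * real (Suc n))"
          using ac(1) by (simp add: x(1) ac(2) z_def field_simps del: of_nat_Suc)
        then have "z \<noteq> 0" using False by auto
        then have "1 \<le> \<bar>real_of_int z\<bar>" by linarith
        then have "1 / (c * real (Suc n)) \<le> \<bar>\<xi> - x\<bar>"
          using ac(1) by (simp add: eq abs_mult divide_right_mono del: of_nat_Suc)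
        also have "\<dots> \<le> real (Suc n) powr (- \<mu>)" by (rule x(2))
        also have "\<dots> = real (Suc n) powr (- (\<mu> - 1)) / real (Suc n)"
          by (simp add: powr_diff powr_minus field_simps del: of_nat_Suc)
        finally have "\<not> real (Suc n) powr (- (\<mu> - 1)) < 1 / c"
          using ac(1) by (simp add: field_simps del: of_nat_Suc)
        then have "n < N" using N[of n] by force
        moreover have "real (Suc n) powr (- \<mu>) \<le> 1"
          using powr_mono[of "- \<mu>" 0 "real (Suc n)"] \<mu> by simp
        ultimately show ?thesis using x by force
      qed simp
    qed
    then have "finite (rational_solutions Suc \<xi> \<mu>)"
      using finite_fractions[of Suc N \<xi>] by (auto intro: finite_subset)
    then show False using inf by simp
  qed
qed

lemma exact_exponent_set_irrational:
  assumes "\<xi> \<in> exact_exponent_set \<tau>" "1 < \<tau>"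
  shows "\<xi> \<notin> \<rat>"
proof
  assume "\<xi> \<in> \<rat>"
  then show False using irrationality_exponent_rational[of \<xi>] assms
    by (simp add: exact_exponent_set_def one_ereal_def)
qed

text \<open>A rational number is hit exactly by fractions with arbitrarily large, unreduced
  denominators.\<close>

lemma irrational_if_eventually_positive:
  assumes "\<forall>\<^sub>F q in sequentially. \<forall>p::int. 0 < \<bar>x - p / real q\<bar>"
  shows "x \<notin> \<rat>"
proof
  assume "x \<in> \<rat>"
  then obtain a c :: int where ac: "c > 0" "x = real_of_int a / real_of_int c"
    by (auto elim: Rats_cases')
  obtain N where N: "\<forall>q\<ge>N. \<forall>p::int. 0 < \<bar>x - p / real q\<bar>"
    using assms unfolding eventually_sequentially by (rule exE)
  have "(N + 1) * 1 \<le> (N + 1) * nat c" using ac(1) by (intro mult_left_mono) auto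
  then have "N \<le> (N + 1) * nat c" by (rule order_trans[rotated]) simp
  then have "0 < \<bar>x - real_of_int (a * (N + 1)) / real ((N + 1) * nat c)\<bar>" using N by blast
  moreover have "real_of_int (a * (N + 1)) / real ((N + 1) * nat c) = real (N + 1) * a / (real (N + 1) * c)"
    using ac(1) by (simp only: of_nat_mult of_nat_nat of_int_mult of_int_of_nat_eq mult.commute less_imp_le)
  then have "x - real_of_int (a * (N + 1)) / real ((N + 1) * nat c) = 0"
    using ac by (simp only: mult_divide_mult_cancel_left of_nat_eq_0_iff)
  ultimately show False by simp
qed

text \<open>Dirichlet's theorem bounds the denominator from above but not from below, so the
  argument is indirect: if there are finitely many solutions, all at distance at least d, the choice
  N > 1/d produces one that is too close.\<close>

lemma frequently_dirichlet:
  assumes "\<xi> \<notin> \<rat>" "0 < \<mu>" "\<mu> \<le> 2"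
  shows "approximable \<xi> \<mu>"
proof (rule ccontr)
  assume "\<not> ?thesis"
  then have "inapproximable \<xi> \<mu>"
    by (simp add: not_frequently not_le)
  then have "\<forall>\<^sub>F n in sequentially. \<forall>p::int. real (Suc n) powr (- \<mu>) < \<bar>\<xi> - p / real (Suc n)\<bar>"
    by (rule eventually_sequentially_Suc[THEN iffD2])
  then have fin: "finite (rational_solutions Suc \<xi> \<mu>)"
    using assms(2) by (intro finite_rational_solutions) auto
  obtain d where d: "0 < d" "\<And>x. x \<in> rational_solutions Suc \<xi> \<mu> \<Longrightarrow> d \<le> \<bar>\<xi> - x\<bar>"
    using finite_rational_solutions_gap[OF fin assms(1)] by metis
  obtain N :: nat where N: "1 / d < N" using reals_Archimedean2 by blast
  then have N0: "0 < N" using d(1) by (metis divide_less_0_1_iff gr_zeroI less_asym' of_nat_0)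
  obtain h k where hk: "0 < k" "k \<le> int N" "\<bar>real_of_int k * \<xi> - real_of_int h\<bar> < 1 / N"
    using Dirichlet_approx[OF N0] by metis
  define x where "x = h / real (Suc (nat k - 1))"
  have k: "real (Suc (nat k - 1)) = k" using hk(1) by simp
  have "\<xi> - x = (k * \<xi> - h) / k" using hk(1) by (simp add: x_def k field_simps)
  then have "\<bar>\<xi> - x\<bar> = \<bar>k * \<xi> - h\<bar> / k" using hk(1) by (simp add: abs_divide)
  also have "\<dots> < (1 / N) / k" using hk by (intro divide_strict_right_mono) auto
  finally have lt: "\<bar>\<xi> - x\<bar> < 1 / (real N * real_of_int k)" by simp
  have "1 / (real N * real_of_int k) \<le> 1 / (real_of_int k * real_of_int k)"
    using hk(1,2) by (intro divide_left_mono mult_right_mono mult_pos_pos) auto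
  also have "\<dots> = real_of_int k powr (- 2)" using hk(1) by (simp add: powr_minus_divide power2_eq_square)
  also have "\<dots> \<le> k powr (- \<mu>)" using assms(3) hk(1) by (intro powr_mono) auto
  finally have "\<bar>\<xi> - x\<bar> \<le> k powr (- \<mu>)" using lt by simp
  then have "x \<in> rational_solutions Suc \<xi> \<mu>"
    unfolding rational_solutions_def x_def k[symmetric] by blast
  then have "d \<le> \<bar>\<xi> - x\<bar>" by (rule d(2))
  moreover have "1 / (real N * real_of_int k) \<le> 1 / (real N * 1)"
    using hk(1) N0 by (intro divide_left_mono mult_left_mono) auto
  moreover have "1 / (real N * 1) < d" using N d(1) N0 by (simp add: field_simps)
  ultimately show False using lt by linarith
qed

text \<open>Adding a/c multiplies the denominator by c. This constant factor is absorbed by lowering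
  \<mu> slightly, which a supremum does not notice. Translating back by -r gives the other
  inequality.\<close>

lemma exact_exponent_set_translate:
  assumes "\<xi> \<in> exact_exponent_set \<tau>" "1 < \<tau>" "r \<in> \<rat>"
  shows "\<xi> + r \<in> exact_exponent_set \<tau>"
proof -
  have irr: "\<xi> \<notin> \<rat>" using assms by (blast dest: exact_exponent_set_irrational)
  have irr': "\<xi> + r \<notin> \<rat>" using irr Rats_diff[of "\<xi> + r" r] assms(3) by auto
  let ?F = "\<lambda>\<xi> \<mu>. approximable \<xi> \<mu>"
  have nF: "\<not> ?F \<xi> \<mu> \<longleftrightarrow> (\<forall>\<^sub>F n in sequentially. \<forall>p::int. real n powr (- \<mu>) < \<bar>\<xi> - p / n\<bar>)" for \<xi> \<mu>
    by (simp add: not_frequently not_le)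
  have shift: "?F (\<xi> + r) \<mu>'" if F: "?F \<xi> \<mu>" and \<mu>: "0 < \<mu>'" "\<mu>' < \<mu>" and "r \<in> \<rat>" for \<xi> r \<mu> \<mu>'
  proof -
    from \<open>r \<in> \<rat>\<close> obtain a c :: int where ac: "c > 0" "r = real_of_int a / real_of_int c"
      by (auto elim: Rats_cases')
    have "(\<lambda>n. real n powr (- (\<mu> - \<mu>'))) \<longlonglongrightarrow> 0"
      using \<mu> by (intro tendsto_neg_powr filterlim_real_sequentially) auto
    then have "\<forall>\<^sub>F n in sequentially. real n powr (- (\<mu> - \<mu>')) < c powr (- \<mu>')"
      using ac(1) by (intro order_tendstoD(2)) auto
    with F have fr: "\<exists>\<^sub>F q in sequentially. (\<exists>p::int. \<bar>\<xi> - p / real q\<bar> \<le> real q powr (- \<mu>)) \<and>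
        real q powr (- (\<mu> - \<mu>')) < c powr (- \<mu>') \<and> q > 0"
      by (intro frequently_eventually_frequently[OF F] eventually_conj eventually_gt_at_top)
    show ?thesis
      unfolding frequently_sequentially
    proof (intro allI)
      fix N
      from fr obtain q p where q: "q \<ge> N" "\<bar>\<xi> - real_of_int p / real q\<bar> \<le> real q powr (- \<mu>)"
          "real q powr (- (\<mu> - \<mu>')) < c powr (- \<mu>')" "q > 0"
        unfolding frequently_sequentially by blast
      define q' where "q' = q * nat c"
      have rq': "real q' = real q * c" using ac(1) by (simp add: q'_def)
      have "q' \<ge> N" using q(1) ac(1) by (simp add: q'_def) (metis One_nat_def Suc_leI mult.right_neutral mult_le_mono zero_less_nat_eq)
      moreover have "\<xi> + r - real_of_int (p * c + a * q) / real q' = \<xi> - real_of_int p / real q"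
        using ac(1) q(4) by (simp add: rq' ac(2) field_simps)
      moreover have "real q powr (- \<mu>) \<le> real q' powr (- \<mu>')"
      proof -
        have "real q powr (- \<mu>) = real q powr (- (\<mu> - \<mu>')) * real q powr (- \<mu>')"
          by (simp add: powr_add[symmetric])
        also have "\<dots> \<le> c powr (- \<mu>') * real q powr (- \<mu>')" using q(3) by (intro mult_right_mono) auto
        also have "\<dots> = real q' powr (- \<mu>')" using ac(1) by (simp add: rq' powr_mult)
        finally show ?thesis .
      qed
      ultimately show "\<exists>q\<ge>N. \<exists>p::int. \<bar>\<xi> + r - p / real q\<bar> \<le> real q powr (- \<mu>')"
        using q(2) by (intro exI[of _ q'] conjI exI[of _ "p * c + a * q"]) auto
    qed
  qed
  have A: "(\<forall>\<mu>. 0 < \<mu> \<longrightarrow> \<mu> < \<tau> \<longrightarrow> ?F \<xi> \<mu>) \<and> (\<forall>\<mu>>\<tau>. \<not> ?F \<xi> \<mu>)"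
    using assms(1,2) exact_exponent_set_iff[of \<tau> \<xi>] irr nF by simp
  have "?F (\<xi> + r) \<mu>" if "0 < \<mu>" "\<mu> < \<tau>" for \<mu>
    using shift[of \<xi> "(\<mu> + \<tau>) / 2" \<mu> r] A that assms(3) by auto
  moreover have "\<not> ?F (\<xi> + r) \<mu>" if "\<mu> > \<tau>" for \<mu>
  proof
    assume "?F (\<xi> + r) \<mu>"
    then have "?F (\<xi> + r + (- r)) ((\<mu> + \<tau>) / 2)"
      using that assms(2,3) by (intro shift[of "\<xi> + r" \<mu>]) auto
    moreover have "(\<mu> + \<tau>) / 2 > \<tau>" using that by simp
    ultimately show False using A by simp
  qed
  ultimately show ?thesis
    using exact_exponent_set_iff[of \<tau> "\<xi> + r"] irr' assms(2) nF by simp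
qed

subsection \<open>Numbers with sparse good approximations\<close>

text \<open>The other root of t^2 - 5 t + 2 is (5 - sqrt 17)/2, so both linear factors are positive.
  The bound 9/2 is a convenient rational substitute for the larger root.\<close>

lemma sqrt17_threshold:
  assumes "\<tau> > (5 + sqrt 17) / 2"
  shows "\<tau>\<^sup>2 - 5 * \<tau> + 2 > 0" "\<tau> > 9 / 2"
proof -
  have s: "sqrt 17 > 4" by (rule real_less_rsqrt) simp
  then show "\<tau> > 9 / 2" using assms by simp
  have "(\<tau> - (5 + sqrt 17) / 2) * (\<tau> - (5 - sqrt 17) / 2) > 0"
    using assms s by (intro mult_pos_pos) auto
  also have "(\<tau> - (5 + sqrt 17) / 2) * (\<tau> - (5 - sqrt 17) / 2) = \<tau>\<^sup>2 - 5 * \<tau> + (25 - (sqrt 17)\<^sup>2) / 4"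
    by (simp add: field_simps power2_eq_square)
  finally show "\<tau>\<^sup>2 - 5 * \<tau> + 2 > 0" by simp
qed

text \<open>Both inequalities become equations when the exponents equal (5 + sqrt 17) / 2, the larger root of
  t^2 - 5 t + 2.\<close>

lemma threshold_inequalities:
  assumes "\<tau> > (5 + sqrt 17) / 2" "\<tau>' > (5 + sqrt 17) / 2"
  shows "2 * (1 / (\<tau> - 1) + 1 / \<tau>') < 1" "2 * (1 + \<tau> / (\<tau> - 1)) < \<tau>"
proof -
  define s where "s = (5 + sqrt 17) / 2"
  have s4: "s > 4" using real_less_rsqrt[of 4 17] by (simp add: s_def)
  have s: "s\<^sup>2 - 5 * s + 2 = 0"
    by (simp add: s_def power2_eq_square field_simps)
  have "1 / (\<tau> - 1) < 1 / (s - 1)" "1 / \<tau>' < 1 / s"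
    using assms s4 by (auto simp: s_def[symmetric] intro!: divide_strict_left_mono mult_pos_pos)
  moreover have "2 * (1 / (s - 1) + 1 / s) = 1"
    using s s4 by (simp add: field_simps power2_eq_square)
  ultimately show "2 * (1 / (\<tau> - 1) + 1 / \<tau>') < 1"
    using add_strict_mono[of "1 / (\<tau> - 1)" "1 / (s - 1)" "1 / \<tau>'" "1 / s"] by argo
  show "2 * (1 + \<tau> / (\<tau> - 1)) < \<tau>"
    using sqrt17_threshold[OF assms(1)] by (simp add: field_simps power2_eq_square)
qed

text \<open>For \<epsilon> = 0 the three cases of the gap estimate are strict inequalities, so they
  persist for small \<epsilon>: \<tau> < \<mu> when p/q equals the truncation, one threshold
  inequality for the shift error to be negligible, and the other for the resulting bound to be
  strong enough.\<close>

lemma threshold_epsilon: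
  assumes "\<tau> > (5 + sqrt 17) / 2" "\<tau>' > (5 + sqrt 17) / 2" "\<mu> > \<tau>"
  obtains \<epsilon> :: real where "0 < \<epsilon>" "\<epsilon> < 1/2" "(\<tau> + \<epsilon>) * (1 + \<epsilon>) < \<mu> * (1 - \<epsilon>)"
    "(2 + \<epsilon>) * (1 / (\<tau> - 1) + 1 / (\<tau>' - \<epsilon>)) < 1"
    "(2 + \<epsilon>) * (1 + (\<tau> + \<epsilon>) / (\<tau> - 1 - 2 * \<epsilon>)) < \<mu>"
proof -
  note T = sqrt17_threshold[OF assms(1)] sqrt17_threshold[OF assms(2)] threshold_inequalities[OF assms(1,2)]
  have "((\<lambda>\<epsilon>. (\<tau> + \<epsilon>) * (1 + \<epsilon>) - \<mu> * (1 - \<epsilon>)) \<longlongrightarrow> (\<tau> + 0) * (1 + 0) - \<mu> * (1 - 0)) (at_right 0)"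
    by (intro tendsto_intros)
  then have 1: "\<forall>\<^sub>F \<epsilon> in at_right 0. (\<tau> + \<epsilon>) * (1 + \<epsilon>) - \<mu> * (1 - \<epsilon>) < 0"
    by (rule order_tendstoD(2)) (use assms(3) in simp)
  have "((\<lambda>\<epsilon>. (2 + \<epsilon>) * (1 / (\<tau> - 1) + 1 / (\<tau>' - \<epsilon>))) \<longlongrightarrow> (2 + 0) * (1 / (\<tau> - 1) + 1 / (\<tau>' - 0))) (at_right 0)"
    by (intro tendsto_intros) (use T in auto)
  then have 2: "\<forall>\<^sub>F \<epsilon> in at_right 0. (2 + \<epsilon>) * (1 / (\<tau> - 1) + 1 / (\<tau>' - \<epsilon>)) < 1"
    by (rule order_tendstoD(2)) (use T in simp)
  have "((\<lambda>\<epsilon>. (2 + \<epsilon>) * (1 + (\<tau> + \<epsilon>) / (\<tau> - 1 - 2 * \<epsilon>))) \<longlongrightarrow>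
      (2 + 0) * (1 + (\<tau> + 0) / (\<tau> - 1 - 2 * 0))) (at_right 0)"
    by (intro tendsto_intros) (use T in auto)
  then have 3: "\<forall>\<^sub>F \<epsilon> in at_right 0. (2 + \<epsilon>) * (1 + (\<tau> + \<epsilon>) / (\<tau> - 1 - 2 * \<epsilon>)) < \<mu>"
    by (rule order_tendstoD(2)) (use T assms(3) in simp)
  have 4: "\<forall>\<^sub>F \<epsilon>::real in at_right 0. \<epsilon> \<in> {0<..<1/2}"
    by (rule eventually_at_right_real) simp
  obtain \<epsilon> where "(\<tau> + \<epsilon>) * (1 + \<epsilon>) - \<mu> * (1 - \<epsilon>) < 0"
    "(2 + \<epsilon>) * (1 / (\<tau> - 1) + 1 / (\<tau>' - \<epsilon>)) < 1"
    "(2 + \<epsilon>) * (1 + (\<tau> + \<epsilon>) / (\<tau> - 1 - 2 * \<epsilon>)) < \<mu>" "\<epsilon> \<in> {0<..<1/2::real}"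
    using eventually_happens[OF eventually_conj[OF 1 eventually_conj[OF 2 eventually_conj[OF 3 4]]]] by auto
  then show thesis by (intro that) auto
qed

lemma fraction_distance:
  fixes p p' :: int and q q' :: nat
  assumes "0 < q" "0 < q'" "real_of_int p / q \<noteq> real_of_int p' / q'"
  shows "1 / (real q * real q') \<le> \<bar>real_of_int p / q - real_of_int p' / q'\<bar>"
proof -
  define z where "z = p * int q' - p' * int q"
  have eq: "real_of_int p / q - real_of_int p' / q' = real_of_int z / (real q * real q')"
    using assms by (simp add: z_def field_simps)
  then have "z \<noteq> 0" using assms(3) by auto
  then have "1 \<le> \<bar>real_of_int z\<bar>" by linarith
  then show ?thesis using assms(1,2) by (simp add: eq abs_mult divide_right_mono)
qed

text \<open>The triangle inequality in terms of exponents: since b is at least 2, losing half of a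
  distance costs at most one unit in the exponent.\<close>

lemma half_gap:
  fixes X Y Z c d :: real
  assumes "2 \<le> b" "b powr (- c) \<le> \<bar>Y - Z\<bar>" "\<bar>X - Y\<bar> \<le> b powr (- d)" "c + 1 \<le> d"
  shows "b powr (- c - 1) \<le> \<bar>X - Z\<bar>"
proof -
  have "b powr (- d) \<le> b powr (- c - 1)" using assms by (intro powr_mono) auto
  moreover have "b powr (- c) = b * b powr (- c - 1)" using assms by (simp add: powr_diff)
  moreover have "2 * b powr (- c - 1) \<le> b * b powr (- c - 1)" using assms by (intro mult_right_mono) auto
  ultimately show ?thesis using assms(2,3) by linarith
qed

text \<open>There are three cases: p/q is the given truncation; q is so small that p/q is far from the truncation; or
  q is large and the bound for \<xi> applies to p/q - R/b^m.\<close>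

lemma approximation_gap:
  fixes b q :: nat and p P R :: int and x \<xi> \<tau> \<tau>' \<mu> \<epsilon> :: real and n m n' :: nat
  assumes b: "2 \<le> b" and q: "0 < q"
    and \<tau>: "\<tau> > 9/2" "\<tau>' > 9/2" "\<mu> > \<tau>"
    and \<epsilon>: "0 < \<epsilon>" "\<epsilon> < 1/2" "(\<tau> + \<epsilon>) * (1 + \<epsilon>) < \<mu> * (1 - \<epsilon>)"
      "(2 + \<epsilon>) * (1 / (\<tau> - 1) + 1 / (\<tau>' - \<epsilon>)) + 1 / n \<le> 1"
      "(2 + \<epsilon>) * (1 + (\<tau> + \<epsilon>) / (\<tau> - 1 - 2 * \<epsilon>)) + (\<tau> - 1) / n < \<mu>"
    and n: "0 < n" "n < n'" "real m \<le> (\<tau> + \<epsilon>) * n" "(\<tau> - \<epsilon>) * n \<le> real m" "(\<tau>' - \<epsilon>) * m \<le> real n'"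
      "1 \<le> \<epsilon> * n" "1 < n * ((\<mu> - 1) / (\<tau> - 1) - 1)"
    and up: "\<bar>x - P / real b ^ n\<bar> \<le> 1 / real b ^ m"
    and low: "real b powr (- (1 + \<epsilon>) * m) \<le> \<bar>x - P / real b ^ n\<bar>"
    and red: "P / real b ^ n = p / q \<Longrightarrow> real b powr ((1 - \<epsilon>) * n) \<le> q"
    and shift: "\<bar>x - \<xi> - R / real b ^ m\<bar> \<le> 1 / real b ^ n'"
    and gen: "\<And>p::int. real (q * b ^ m) powr (- (2 + \<epsilon>)) < \<bar>\<xi> - p / real (q * b ^ m)\<bar>"
    and u: "real n \<le> (\<tau> - 1) * log b q" "(\<tau> - 1) * log b q \<le> real n'"
  shows "real q powr (- \<mu>) < \<bar>x - p / q\<bar>"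
proof -
  define u where "u = log b q"
  have b1: "1 < real b" using b by simp
  have qu: "real q = b powr u" using b q by (simp add: u_def)
  have bpow: "1 / real b ^ k = b powr (- real k)" "real b ^ k = b powr real k" for k :: nat
    using b by (simp_all add: powr_minus powr_realpow field_simps)
  have qmu: "real q powr (- \<mu>) = b powr (- \<mu> * u)" using b by (simp add: qu powr_powr mult.commute)
  have "0 < (\<tau> - 1) * u" using n(1) u(1) by (simp add: u_def)
  then have u0: "0 < u" using \<tau>(1) by (simp add: zero_less_mult_iff)
  note u = u[folded u_def]
  show ?thesis
  proof (cases "P / real b ^ n = p / q")
    case True
    \<comment> \<open>Almost reduced truncations make q nearly as large as b^n, whereas the error is
      nearly b^(-m) with m at most about \<tau> n.\<close>
    have "b powr ((1 - \<epsilon>) * n) \<le> b powr u" using red[OF True] by (simp add: qu)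
    then have "(1 - \<epsilon>) * n \<le> u" using b1 by (simp add: powr_le_cancel_iff)
    then have "\<mu> * ((1 - \<epsilon>) * n) \<le> \<mu> * u" using \<tau> by (intro mult_left_mono) auto
    moreover have "(1 + \<epsilon>) * m \<le> (1 + \<epsilon>) * ((\<tau> + \<epsilon>) * n)" using n(3) \<epsilon>(1) by (intro mult_left_mono) auto
    moreover have "(\<tau> + \<epsilon>) * (1 + \<epsilon>) * n < \<mu> * (1 - \<epsilon>) * n" using \<epsilon>(3) n(1) by (intro mult_strict_right_mono) auto
    ultimately have "(1 + \<epsilon>) * m < \<mu> * u" by (simp add: mult.assoc mult.left_commute)
    then have "b powr (- \<mu> * u) < b powr (- (1 + \<epsilon>) * m)"
      using b1 by (intro powr_less_mono) (simp_all only: minus_mult_left[symmetric] neg_less_iff_less)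
    also have "\<dots> \<le> \<bar>x - p / q\<bar>" using low True by simp
    finally show ?thesis by (simp add: qmu)
  next
    case False
    show ?thesis
    \<comment> \<open>In the first range the error b^(-m) of the truncation is smaller by a factor b
      than b^(-u-n), the least distance of distinct fractions with denominators q and b^n.\<close>
    proof (cases "u \<le> real m - n - 1")
      case True
      have "1 / (real q * real (b ^ n)) \<le> \<bar>P / real (b ^ n) - p / q\<bar>"
        using fraction_distance[of "b ^ n" q P p] False q b by (simp add: mult.commute)
      also have "1 / (real q * real (b ^ n)) = b powr (- (u + n))"
        by (simp only: qu bpow(2) of_nat_power powr_minus_divide powr_add)
      finally have "b powr (- (u + n) - 1) \<le> \<bar>x - p / q\<bar>"
        using up True b by (intro half_gap[of b "u + n" _ _ x m]) (auto simp: bpow(1))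
      \<comment> \<open>As n is at most (\<tau> - 1) u, the sum u + n is at most \<tau> u; the room
        between \<tau> and \<mu> pays for the extra 1 once n is large.\<close>
      moreover have "u + n + 1 < \<mu> * u"
      proof -
        have "n * ((\<mu> - 1) / (\<tau> - 1)) \<le> (\<tau> - 1) * u * ((\<mu> - 1) / (\<tau> - 1))"
          using u(1) \<tau> by (intro mult_right_mono) auto
        also have "\<dots> = (\<mu> - 1) * u" using \<tau>(1) by (simp add: field_simps)
        finally have "n * ((\<mu> - 1) / (\<tau> - 1)) \<le> (\<mu> - 1) * u" .
        moreover have "1 < n * ((\<mu> - 1) / (\<tau> - 1)) - n" using n(7) by (simp only: right_diff_distrib mult_1_right)
        moreover have "(\<mu> - 1) * u = \<mu> * u - u" by (simp add: left_diff_distrib)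
        ultimately show ?thesis by linarith
      qed
      then have "b powr (- \<mu> * u) < b powr (- (u + n) - 1)" using b1 by (intro powr_less_mono) auto
      ultimately show ?thesis by (simp add: qmu)
    next
      case False
      define D where "D = (2 + \<epsilon>) * (u + m)"
      have q': "real (q * b ^ m) powr (- (2 + \<epsilon>)) = b powr (- D)"
        by (simp only: of_nat_mult of_nat_power qu bpow(2) powr_add[symmetric] powr_powr D_def
            mult_minus_right mult.commute)
      have "\<xi> - real_of_int (p * b ^ m - R * q) / real (q * b ^ m) = (\<xi> + R / real b ^ m) - p / q"
        using q b by (simp add: field_simps)
      with gen[of "p * b ^ m - R * q"] have "b powr (- D) < \<bar>(\<xi> + R / real b ^ m) - p / q\<bar>"
        unfolding q' by simp
      moreover have "\<bar>x - (\<xi> + R / real b ^ m)\<bar> \<le> b powr (- real n')"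
        using shift by (simp add: bpow(1)[symmetric] algebra_simps)
      \<comment> \<open>The shift error b^(-n') must be negligible against b^(-D). What counts are
        the upper ends n'/(\<tau> - 1) of u and n'/(\<tau>' - \<epsilon>) of m; this is where the
        exponent of the other summand enters.\<close>
      moreover have "D + 1 \<le> n'"
      proof -
        have "u \<le> n' * (1 / (\<tau> - 1))" using u(2) \<tau>(1) by (simp add: field_simps)
        moreover have "real m \<le> n' * (1 / (\<tau>' - \<epsilon>))" using n(5) \<tau>(2) \<epsilon>(2) by (simp add: field_simps)
        ultimately have "D \<le> (2 + \<epsilon>) * (n' * (1 / (\<tau> - 1)) + n' * (1 / (\<tau>' - \<epsilon>)))"
          unfolding D_def using \<epsilon>(1) by (intro mult_left_mono) auto
        also have "\<dots> = n' * ((2 + \<epsilon>) * (1 / (\<tau> - 1) + 1 / (\<tau>' - \<epsilon>)))" by (simp only: algebra_simps)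
        also have "\<dots> \<le> n' * (1 - 1 / n)" using \<epsilon>(4) by (intro mult_left_mono) auto
        also have "\<dots> \<le> real n' - 1" using n(1,2) by (simp add: field_simps)
        finally show ?thesis by simp
      qed
      ultimately have "b powr (- D - 1) \<le> \<bar>x - p / q\<bar>"
        using b by (intro half_gap[of b D _ _ x n']) auto
      \<comment> \<open>Now the lower end of u counts: u > m - n - 1 bounds m by about
        \<tau>/(\<tau> - 1) times u.\<close>
      moreover have "D + 1 < \<mu> * u"
      proof -
        define r where "r = (\<tau> + \<epsilon>) / (\<tau> - 1 - 2 * \<epsilon>)"
        have d0: "0 < \<tau> - 1 - 2 * \<epsilon>" using \<tau>(1) \<epsilon>(2) by simp
        have "(\<tau> - 1 - 2 * \<epsilon>) * n = (\<tau> - \<epsilon>) * n - n - \<epsilon> * n" by (simp add: algebra_simps)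
        also have "\<dots> \<le> u" using n(4,6) False by linarith
        finally have "n \<le> u / (\<tau> - 1 - 2 * \<epsilon>)" using d0 by (simp add: field_simps)
        then have "(\<tau> + \<epsilon>) * n \<le> (\<tau> + \<epsilon>) * (u / (\<tau> - 1 - 2 * \<epsilon>))"
          using \<tau>(1) \<epsilon>(1) by (intro mult_left_mono) auto
        then have "real m \<le> r * u" using n(3) by (simp add: r_def)
        then have "D \<le> (2 + \<epsilon>) * (u + r * u)" unfolding D_def using \<epsilon>(1) by (intro mult_left_mono) auto
        also have "\<dots> = (2 + \<epsilon>) * (1 + r) * u" by (simp add: algebra_simps)
        finally have "D \<le> (2 + \<epsilon>) * (1 + r) * u" .
        moreover have "1 \<le> (\<tau> - 1) / n * u" using u(1) n(1) by (simp add: field_simps)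
        moreover have "((2 + \<epsilon>) * (1 + r) + (\<tau> - 1) / n) * u < \<mu> * u"
          using \<epsilon>(5) u0 unfolding r_def by (intro mult_strict_right_mono) auto
        ultimately show ?thesis by (simp only: distrib_right)
      qed
      then have "b powr (- \<mu> * u) < b powr (- D - 1)" using b1 by (intro powr_less_mono) auto
      ultimately show ?thesis by (simp add: qmu)
    qed
  qed
qed

text \<open>The fractions with denominators b^(n k) give the lower bound for the exponent;
  \<open>low\<close> and \<open>red\<close> prevent them from giving more than \<tau>. All other
  fractions are excluded because x is nearly a translate of \<xi> by a fraction with denominator
  b^(m k).\<close>

theorem sparse_expansion_exact_exponent:
  fixes b :: nat and n m :: "nat \<Rightarrow> nat" and P R :: "nat \<Rightarrow> int" and x \<xi> \<tau> \<tau>' :: real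
  assumes b: "2 \<le> b" and \<tau>: "\<tau> > (5 + sqrt 17) / 2" "\<tau>' > (5 + sqrt 17) / 2"
    and nm: "\<And>k. n k < m k" "\<And>k. m k < n (Suc k)"
    and lim: "(\<lambda>k. real (m k) / real (n k)) \<longlonglongrightarrow> \<tau>" "(\<lambda>k. real (n (Suc k)) / real (m k)) \<longlonglongrightarrow> \<tau>'"
    and up: "\<And>k. \<bar>x - P k / real b ^ n k\<bar> \<le> 1 / real b ^ m k"
    and low: "\<And>\<epsilon>::real. 0 < \<epsilon> \<Longrightarrow>
      \<forall>\<^sub>F k in sequentially. real b powr (- (1 + \<epsilon>) * m k) \<le> \<bar>x - P k / real b ^ n k\<bar>"
    and red: "\<And>\<epsilon>::real. 0 < \<epsilon> \<Longrightarrow> \<forall>\<^sub>F k in sequentially. \<forall>(p::int) (q::nat).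
      (0::nat) < q \<longrightarrow> P k / real b ^ n k = p / q \<longrightarrow> real b powr ((1 - \<epsilon>) * n k) \<le> q"
    and shift: "\<And>k. \<bar>x - \<xi> - R k / real b ^ m k\<bar> \<le> 1 / real b ^ n (Suc k)"
    and gen: "\<And>\<epsilon>::real. 0 < \<epsilon> \<Longrightarrow>
      inapproximable \<xi> (2 + \<epsilon>)"
  shows "x \<in> exact_exponent_set \<tau>"
proof -
  note T = sqrt17_threshold(2)[OF \<tau>(1)] sqrt17_threshold(2)[OF \<tau>(2)]
  have "strict_mono n" using nm by (auto simp: strict_mono_Suc_iff intro: less_trans)
  then have kn: "k \<le> n k" for k by (rule strict_mono_imp_increasing)
  have nlim: "filterlim n at_top sequentially"
    using kn by (intro filterlim_at_top_mono[OF filterlim_ident]) auto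
  have nev: "\<forall>\<^sub>F k in sequentially. N < n k" for N
    using eventually_compose_filterlim[OF eventually_gt_at_top nlim] .
  have rn: "filterlim (\<lambda>k. real (n k)) at_top sequentially"
    by (rule filterlim_compose[OF filterlim_real_sequentially nlim])
  have upper: "inapproximable x \<mu>" if "\<mu> > \<tau>" for \<mu>
  proof -
    from threshold_epsilon[OF \<tau> that] obtain \<epsilon> where \<epsilon>: "0 < \<epsilon>" "\<epsilon> < 1/2"
      "(\<tau> + \<epsilon>) * (1 + \<epsilon>) < \<mu> * (1 - \<epsilon>)"
      "(2 + \<epsilon>) * (1 / (\<tau> - 1) + 1 / (\<tau>' - \<epsilon>)) < 1"
      "(2 + \<epsilon>) * (1 + (\<tau> + \<epsilon>) / (\<tau> - 1 - 2 * \<epsilon>)) < \<mu>" .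
    define A where "A k \<longleftrightarrow> 0 < n k \<and> real (m k) \<le> (\<tau> + \<epsilon>) * n k \<and> (\<tau> - \<epsilon>) * n k \<le> real (m k) \<and>
      (\<tau>' - \<epsilon>) * m k \<le> real (n (Suc k)) \<and> 1 \<le> \<epsilon> * n k \<and> 1 < n k * ((\<mu> - 1) / (\<tau> - 1) - 1) \<and>
      (2 + \<epsilon>) * (1 / (\<tau> - 1) + 1 / (\<tau>' - \<epsilon>)) + 1 / n k \<le> 1 \<and>
      (2 + \<epsilon>) * (1 + (\<tau> + \<epsilon>) / (\<tau> - 1 - 2 * \<epsilon>)) + (\<tau> - 1) / n k < \<mu>" for k
    have evA: "\<forall>\<^sub>F k in sequentially. A k"
    proof -
      have 1: "\<forall>\<^sub>F k in sequentially. 0 < n k" by (rule nev)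
      have 2: "\<forall>\<^sub>F k in sequentially. real (m k) / n k < \<tau> + \<epsilon>"
        using lim(1) by (rule order_tendstoD) (use \<epsilon> in simp)
      have 3: "\<forall>\<^sub>F k in sequentially. \<tau> - \<epsilon> < real (m k) / n k"
        using lim(1) by (rule order_tendstoD) (use \<epsilon> in simp)
      have 4: "\<forall>\<^sub>F k in sequentially. \<tau>' - \<epsilon> < real (n (Suc k)) / m k"
        using lim(2) by (rule order_tendstoD) (use \<epsilon> in simp)
      have 5: "\<forall>\<^sub>F k in sequentially. 1 / \<epsilon> < real (n k)" using rn by (simp add: filterlim_at_top_dense)
      have 6: "\<forall>\<^sub>F k in sequentially. 1 / ((\<mu> - 1) / (\<tau> - 1) - 1) < real (n k)"
        using rn by (simp add: filterlim_at_top_dense)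
      have c: "(\<mu> - 1) / (\<tau> - 1) - 1 > 0" using T that by simp
      have "(\<lambda>k. (2 + \<epsilon>) * (1 / (\<tau> - 1) + 1 / (\<tau>' - \<epsilon>)) + 1 / n k) \<longlonglongrightarrow>
          (2 + \<epsilon>) * (1 / (\<tau> - 1) + 1 / (\<tau>' - \<epsilon>)) + 0"
        by (intro tendsto_intros tendsto_divide_0[OF tendsto_const] filterlim_at_top_imp_at_infinity rn)
      then have 7: "\<forall>\<^sub>F k in sequentially. (2 + \<epsilon>) * (1 / (\<tau> - 1) + 1 / (\<tau>' - \<epsilon>)) + 1 / n k < 1"
        by (rule order_tendstoD) (use \<epsilon>(4) in simp)
      have "(\<lambda>k. (2 + \<epsilon>) * (1 + (\<tau> + \<epsilon>) / (\<tau> - 1 - 2 * \<epsilon>)) + (\<tau> - 1) / n k) \<longlonglongrightarrow>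
          (2 + \<epsilon>) * (1 + (\<tau> + \<epsilon>) / (\<tau> - 1 - 2 * \<epsilon>)) + 0"
        by (intro tendsto_add tendsto_const tendsto_divide_0[OF tendsto_const] filterlim_at_top_imp_at_infinity rn)
      then have 8: "\<forall>\<^sub>F k in sequentially. (2 + \<epsilon>) * (1 + (\<tau> + \<epsilon>) / (\<tau> - 1 - 2 * \<epsilon>)) + (\<tau> - 1) / n k < \<mu>"
        by (rule order_tendstoD) (use \<epsilon>(5) in simp)
      show ?thesis
        using 1 2 3 4 5 6 7 8
      proof eventually_elim
        case (elim k)
        have "0 < m k" using nm(1)[of k] by simp
        then show ?case using elim \<epsilon>(1) c unfolding A_def by (simp add: field_simps)
      qed
    qed
    obtain Q0 where "\<forall>q\<ge>Q0. \<forall>p::int. real q powr (- (2 + \<epsilon>)) < \<bar>\<xi> - p / real q\<bar>"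
      using gen[OF \<epsilon>(1)] unfolding eventually_sequentially by (rule exE)
    note Q0 = this[rule_format]
    have "\<forall>\<^sub>F k in sequentially. A k \<and> real b powr (- (1 + \<epsilon>) * m k) \<le> \<bar>x - P k / real b ^ n k\<bar> \<and>
        (\<forall>(p::int) (q::nat). (0::nat) < q \<longrightarrow> P k / real b ^ n k = p / q \<longrightarrow> real b powr ((1 - \<epsilon>) * n k) \<le> q)"
      by (intro eventually_conj evA low[OF \<epsilon>(1)] red[OF \<epsilon>(1)])
    then obtain k0 where *: "\<forall>k\<ge>k0. A k \<and> real b powr (- (1 + \<epsilon>) * m k) \<le> \<bar>x - P k / real b ^ n k\<bar> \<and>
        (\<forall>(p::int) (q::nat). (0::nat) < q \<longrightarrow> P k / real b ^ n k = p / q \<longrightarrow> real b powr ((1 - \<epsilon>) * n k) \<le> q)"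
      unfolding eventually_sequentially by (rule exE)
    have k0: "\<And>k. k \<ge> k0 \<Longrightarrow> A k"
      "\<And>k. k \<ge> k0 \<Longrightarrow> real b powr (- (1 + \<epsilon>) * m k) \<le> \<bar>x - P k / real b ^ n k\<bar>"
      "\<And>k p q. k \<ge> k0 \<Longrightarrow> 0 < q \<Longrightarrow> P k / real b ^ n k = real_of_int p / real q \<Longrightarrow>
         real b powr ((1 - \<epsilon>) * n k) \<le> q"
      by (simp_all only: *)
    show ?thesis
      unfolding eventually_sequentially
    proof (intro exI allI impI)
      fix q and p :: int
      assume q: "q \<ge> max (max 1 Q0) (b ^ n k0)"
      then have q0: "0 < q" "Q0 \<le> q" "b ^ n k0 \<le> q" by auto
      define u where "u = log b q"
      have "log b (b ^ n k0) \<le> u"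
        unfolding u_def using q0(1,3) b by (subst log_le_cancel_iff) auto
      then have nu: "real (n k0) \<le> u" using b by (simp add: log_nat_power)
      then have k0u: "real (n k0) \<le> (\<tau> - 1) * u" using T(1) mult_right_mono[of 1 "\<tau> - 1" u] by simp
      \<comment> \<open>The window of k begins at u = n k / (\<tau> - 1), where the distance b^(-u -
        n k) between distinct fractions becomes at least b^(-\<tau> u). The lower bound b^(n k0) on
        q secures the left end also for k = k0.\<close>
      define k where "k = (LEAST k. k \<ge> k0 \<and> (\<tau> - 1) * u < n (Suc k))"
      obtain j :: nat where "(\<tau> - 1) * u < j" using reals_Archimedean2 by blast
      moreover have "j \<le> n (Suc (max j k0))" using kn[of "Suc (max j k0)"] by simp
      ultimately have "max j k0 \<ge> k0 \<and> (\<tau> - 1) * u < n (Suc (max j k0))" by linarith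
      then have k: "k \<ge> k0" "(\<tau> - 1) * u < n (Suc k)" unfolding k_def
        by (metis (mono_tags, lifting) LeastI)+
      have k': "real (n k) \<le> (\<tau> - 1) * u"
      proof (cases "k = k0")
        case False
        then have "k - 1 < k" "k - 1 \<ge> k0" "Suc (k - 1) = k" using k(1) by auto
        then show ?thesis using not_less_Least[of "k - 1" "\<lambda>k. k \<ge> k0 \<and> (\<tau> - 1) * u < n (Suc k)"]
          by (auto simp: k_def[symmetric])
      qed (use k0u in simp)
      show "real q powr (- \<mu>) < \<bar>x - p / real q\<bar>"
      proof (rule approximation_gap[of b q \<tau> \<tau>' \<mu> \<epsilon> "n k" "n (Suc k)" "m k" x "P k" p \<xi> "R k"])
        show "n k < n (Suc k)" using nm[of k] by simp
        show "real (q * b ^ m k) powr - (2 + \<epsilon>) < \<bar>\<xi> - real_of_int p' / real (q * b ^ m k)\<bar>" for p'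
        proof (rule Q0)
          have "q * 1 \<le> q * b ^ m k" using b by (intro mult_left_mono) auto
          then show "Q0 \<le> q * b ^ m k" using q0(2) by linarith
        qed
        show "(\<tau> - 1) * log (real b) (real q) \<le> real (n (Suc k))" using k(2) by (simp add: u_def)
      qed (use T that \<epsilon> b q0 up shift k k' k0(1)[OF k(1)] k0(2)[OF k(1)] k0(3)[OF k(1) q0(1)] in
            \<open>simp_all add: A_def u_def\<close>)
    qed
  qed
  \<comment> \<open>The bound just shown already yields irrationality, which the characterization of
    the exponent presupposes.\<close>
  have irr: "x \<notin> \<rat>"
  proof (rule irrational_if_eventually_positive)
    have "inapproximable x (\<tau> + 1)"
      by (rule upper) simp
    then show "\<forall>\<^sub>F q in sequentially. \<forall>p::int. 0 < \<bar>x - p / real q\<bar>"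
      by (rule eventually_mono) (meson le_less_trans powr_ge_zero)
  qed
  have lower: "approximable x \<mu>" if "0 < \<mu>" "\<mu> < \<tau>" for \<mu>
    unfolding frequently_sequentially
  proof (intro allI)
    fix N
    have "\<forall>\<^sub>F k in sequentially. \<mu> < real (m k) / n k"
      using lim(1) that(2) by (rule order_tendstoD)
    moreover note nev[of N]
    ultimately have "\<forall>\<^sub>F k in sequentially. \<mu> < real (m k) / n k \<and> N < n k" by (rule eventually_conj)
    then obtain k where k: "\<mu> < real (m k) / n k" "N < n k" using eventually_happens'[OF sequentially_bot] by blast
    have "n k \<le> b ^ n k" using b less_exp[of "n k"] power_mono[of 2 b "n k"] by linarith
    moreover have "\<bar>x - P k / real (b ^ n k)\<bar> \<le> real (b ^ n k) powr (- \<mu>)"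
    proof -
      have "1 / real b ^ m k = b powr (- real (m k))" using b by (simp add: powr_minus powr_realpow field_simps)
      also have "\<dots> \<le> b powr (real (n k) * (- \<mu>))" using k b by (intro powr_mono) (auto simp: field_simps)
      also have "\<dots> = (b powr real (n k)) powr (- \<mu>)" by (simp only: powr_powr)
      also have "b powr real (n k) = real (b ^ n k)" using b by (simp add: powr_realpow)
      finally show ?thesis using up[of k] by simp
    qed
    ultimately show "\<exists>q\<ge>N. \<exists>p::int. \<bar>x - p / real q\<bar> \<le> real q powr (- \<mu>)"
      using k(2) by (intro exI[of _ "b ^ n k"]) auto
  qed
  show ?thesis
    using exact_exponent_set_iff[of \<tau> x] irr lower upper T(1) by auto
qed

subsection \<open>Digit expansions\<close>

primrec digit_prefix :: "nat \<Rightarrow> (nat \<Rightarrow> nat) \<Rightarrow> nat \<Rightarrow> nat" where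
  "digit_prefix b a 0 = 0"
| "digit_prefix b a (Suc n) = b * digit_prefix b a n + a n"

definition digit_value :: "nat \<Rightarrow> (nat \<Rightarrow> nat) \<Rightarrow> real" where
  "digit_value b a = (\<Sum>i. real (a i) / real b ^ Suc i)"

lemma missing_digit_set_eq: "missing_digit_set b W = digit_value b ` {a. \<forall>i. a i \<in> W}"
  unfolding missing_digit_set_def digit_value_def by auto

lemma digit_prefix_cong:
  assumes "\<And>i. i < n \<Longrightarrow> a i = a' i"
  shows "digit_prefix b a n = digit_prefix b a' n"
  using assms by (induction n) auto

lemma digit_prefix_add:
  "digit_prefix b a (n + k) = b ^ k * digit_prefix b a n + digit_prefix b (\<lambda>i. a (n + i)) k"
  by (induction k) (simp_all add: algebra_simps)

lemma digit_prefix_less: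
  assumes "\<And>i. a i < b"
  shows "digit_prefix b a n < b ^ n"
proof (induction n)
  case (Suc n)
  have "digit_prefix b a n + 1 \<le> b ^ n" using Suc by simp
  then have "b * (digit_prefix b a n + 1) \<le> b * b ^ n" by (rule mult_left_mono) simp
  then show ?case using assms[of n] by simp
qed simp

lemma digit_prefix_pos:
  assumes "0 < b" "a 0 \<noteq> 0" "0 < n"
  shows "0 < digit_prefix b a n"
  using assms(3)
proof (induction n)
  case (Suc n)
  then show ?case using assms(1,2) by (cases n) auto
qed simp

lemma digit_prefix_partial_sum:
  assumes "0 < b"
  shows "real (digit_prefix b a n) / real b ^ n = (\<Sum>i<n. real (a i) / real b ^ Suc i)"
  using assms by (induction n) (simp_all add: field_simps)

text \<open>The extreme tail: digits all equal to b - 1 add up to one unit of the last position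
  kept. This bounds every tail, and it later makes a constant digit sequence rational.\<close>

lemma digit_series_geometric:
  assumes "2 \<le> (b::nat)"
  shows "(\<lambda>i. real (b - 1) / real b ^ Suc (i + n)) sums (1 / real b ^ n)"
proof -
  have "(\<lambda>i. real (b - 1) / real b ^ Suc n * (1 / real b) ^ i) sums
      (real (b - 1) / real b ^ Suc n * (1 / (1 - 1 / real b)))"
    using assms by (intro sums_mult geometric_sums) simp
  moreover have "real (b - 1) / real b ^ Suc n * (1 / (1 - 1 / real b)) = 1 / real b ^ n"
    using assms by (simp add: field_simps of_nat_diff)
  moreover have "(\<lambda>i. real (b - 1) / real b ^ Suc n * (1 / real b) ^ i) = (\<lambda>i. real (b - 1) / real b ^ Suc (i + n))"
    by (simp add: power_add power_divide fun_eq_iff field_simps)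
  ultimately show ?thesis by simp
qed

context
  fixes b :: nat and a :: "nat \<Rightarrow> nat"
  assumes b: "2 \<le> b" and a: "\<And>i. a i < b"
begin

lemma digit_term_le: "real (a i) / real b ^ k \<le> real (b - 1) / real b ^ k"
  using a[of i] b by (intro divide_right_mono) auto

lemma summable_digits: "summable (\<lambda>i. real (a i) / real b ^ Suc i)"
proof (rule summable_comparison_test')
  show "summable (\<lambda>i. real (b - 1) / real b ^ Suc i)"
    using digit_series_geometric[OF b, of 0] by (auto simp: sums_iff)
  show "norm (real (a i) / real b ^ Suc i) \<le> real (b - 1) / real b ^ Suc i" if "i \<ge> 0" for i
    using digit_term_le[of i "Suc i"] by simp
qed

lemma digit_value_split:
  "digit_value b a = real (digit_prefix b a n) / real b ^ n + (\<Sum>i. real (a (i + n)) / real b ^ Suc (i + n))"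
  using suminf_split_initial_segment[OF summable_digits, of n] b
  by (simp add: digit_value_def digit_prefix_partial_sum)

lemma summable_digit_tail: "summable (\<lambda>i. real (a (i + n)) / real b ^ Suc (i + n))"
  using summable_ignore_initial_segment[OF summable_digits, of n] .

lemma digit_value_ge_prefix: "real (digit_prefix b a n) / real b ^ n \<le> digit_value b a"
  unfolding digit_value_split[of n] using suminf_nonneg[OF summable_digit_tail] by simp

lemma digit_value_le_prefix: "digit_value b a \<le> real (digit_prefix b a n) / real b ^ n + 1 / real b ^ n"
proof -
  have "(\<Sum>i. real (a (i + n)) / real b ^ Suc (i + n)) \<le> 1 / real b ^ n"
    unfolding sums_unique[OF digit_series_geometric[OF b, of n]]
    by (intro suminf_le digit_term_le summable_digit_tail sums_summable[OF digit_series_geometric[OF b]])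
  then show ?thesis unfolding digit_value_split[of n] by simp
qed

lemma digit_value_approx: "\<bar>digit_value b a - real (digit_prefix b a n) / real b ^ n\<bar> \<le> 1 / real b ^ n"
  using digit_value_ge_prefix[of n] digit_value_le_prefix[of n] by simp

lemma digit_prefix_zeros:
  assumes "n \<le> m" "\<And>i. n \<le> i \<Longrightarrow> i < m \<Longrightarrow> a i = 0"
  shows "real (digit_prefix b a m) / real b ^ m = real (digit_prefix b a n) / real b ^ n"
  using assms
proof (induction m rule: dec_induct)
  case (step m)
  then have "real (digit_prefix b a m) / real b ^ m = real (digit_prefix b a n) / real b ^ n" by simp
  moreover have "real (digit_prefix b a (Suc m)) / real b ^ Suc m = real (digit_prefix b a m) / real b ^ m"
    using step b by simp
  ultimately show ?case by simp
qed simp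

lemma digit_value_approx_zeros:
  assumes "n \<le> m" "\<And>i. n \<le> i \<Longrightarrow> i < m \<Longrightarrow> a i = 0"
  shows "\<bar>digit_value b a - real (digit_prefix b a n) / real b ^ n\<bar> \<le> 1 / real b ^ m"
  using digit_value_approx[of m] digit_prefix_zeros[OF assms] by simp

text \<open>Digits are nonnegative, so truncations only grow. The digit with index i has weight
  b^(-(i+1)), hence \<open>Suc i\<close>.\<close>

lemma digit_value_lower:
  assumes "n \<le> i" "a i \<noteq> 0"
  shows "1 / real b ^ Suc i \<le> \<bar>digit_value b a - real (digit_prefix b a n) / real b ^ n\<bar>"
proof -
  have "real (digit_prefix b a n) / real b ^ n \<le> real (digit_prefix b a i) / real b ^ i"
    using assms(1) b by (simp add: digit_prefix_partial_sum sum_mono2)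
  moreover have "real (digit_prefix b a (Suc i)) / real b ^ Suc i
      = real (digit_prefix b a i) / real b ^ i + real (a i) / real b ^ Suc i"
    using b by (simp only: digit_prefix_partial_sum[of b a] sum.lessThan_Suc)
  moreover have "1 / real b ^ Suc i \<le> real (a i) / real b ^ Suc i"
    using assms(2) b by (intro divide_right_mono) auto
  ultimately show ?thesis using digit_value_ge_prefix[of "Suc i"] by simp
qed

text \<open>If all candidates failed, then by the pigeonhole principle a large power of one prime divisor of b would divide
  two prefixes, hence their nonzero but small difference.\<close>

lemma ex_prefix_small_gcd:
  assumes X: "X \<subseteq> {N..<N + g}" "b \<le> card X" and nz: "\<And>i. i \<in> X \<Longrightarrow> a i \<noteq> 0"
  shows "\<exists>M\<in>X. gcd (digit_prefix b a M) (b ^ M) \<le> b ^ (g * b)"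
proof (rule ccontr)
  assume "\<not> ?thesis"
  then have big: "b ^ (g * b) < gcd (digit_prefix b a M) (b ^ M)" if "M \<in> X" for M
    using that by (auto simp: not_le)
  \<comment> \<open>Otherwise the gcd would be a product of fewer than b prime powers, each at most
    b^g, and so at most b^(g b).\<close>
  have ex: "\<exists>p\<in>{2..b}. \<exists>e. p ^ e dvd digit_prefix b a M \<and> b ^ g < p ^ e \<and> prime p" if M: "M \<in> X" for M
  proof (rule ccontr)
    assume C: "\<not> ?thesis"
    define d where "d = gcd (digit_prefix b a M) (b ^ M)"
    have "d \<noteq> 0" using b by (simp add: d_def)
    have pb: "p \<in> {2..b}" if "p \<in> prime_factors d" for p
    proof -
      have "prime p" using that by (rule in_prime_factors_imp_prime)
      have "p dvd d" using that by (rule in_prime_factors_imp_dvd)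
      then have "p dvd b ^ M" unfolding d_def by (rule dvd_trans) simp
      then have "p dvd b" using \<open>prime p\<close> by (metis prime_dvd_power)
      then have "p \<le> b" using b by (intro dvd_imp_le) auto
      then show ?thesis using prime_ge_2_nat[OF \<open>prime p\<close>] by simp
    qed
    have "d = (\<Prod>p\<in>prime_factors d. p ^ multiplicity p d)"
      using prime_factorization_nat[of d] \<open>d \<noteq> 0\<close> by simp
    also have "\<dots> \<le> (\<Prod>p\<in>prime_factors d. b ^ g)"
    proof (rule prod_mono)
      fix p assume p: "p \<in> prime_factors d"
      have "p ^ multiplicity p d dvd digit_prefix b a M"
        by (rule dvd_trans[OF multiplicity_dvd]) (simp add: d_def)
      then have "\<not> b ^ g < p ^ multiplicity p d"
        using C pb[OF p] in_prime_factors_imp_prime[OF p] by blast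
      then show "0 \<le> p ^ multiplicity p d \<and> p ^ multiplicity p d \<le> b ^ g" by simp
    qed
    also have "\<dots> = (b ^ g) ^ card (prime_factors d)" by simp
    also have "\<dots> \<le> (b ^ g) ^ b"
    proof (rule power_increasing)
      have "card (prime_factors d) \<le> card {2..b}" using pb by (intro card_mono) auto
      then show "card (prime_factors d) \<le> b" using b by simp
      show "1 \<le> b ^ g" using b by simp
    qed
    finally show False using big[OF M] by (simp add: d_def power_mult)
  qed
  have "\<forall>M\<in>X. \<exists>pe. fst pe \<in> {2..b} \<and> fst pe ^ snd pe dvd digit_prefix b a M \<and> b ^ g < fst pe ^ snd pe"
  proof
    fix M assume "M \<in> X"
    from ex[OF this] obtain p e where "p \<in> {2..b}" "p ^ e dvd digit_prefix b a M" "b ^ g < p ^ e"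
      by (elim bexE exE conjE) (rule that)
    then show "\<exists>pe. fst pe \<in> {2..b} \<and> fst pe ^ snd pe dvd digit_prefix b a M \<and> b ^ g < fst pe ^ snd pe"
      by (intro exI[of _ "(p, e)"]) simp
  qed
  from bchoice[OF this] obtain h where h: "\<forall>M\<in>X. fst (h M) \<in> {2..b} \<and>
      fst (h M) ^ snd (h M) dvd digit_prefix b a M \<and> b ^ g < fst (h M) ^ snd (h M)"
    by (rule exE)
  define f e where "f M = fst (h M)" and "e M = snd (h M)" for M
  have fe: "\<And>M. M \<in> X \<Longrightarrow> f M \<in> {2..b}"
      "\<And>M. M \<in> X \<Longrightarrow> f M ^ e M dvd digit_prefix b a M" "\<And>M. M \<in> X \<Longrightarrow> b ^ g < f M ^ e M"
    using h by (simp_all add: f_def e_def)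
  \<comment> \<open>The primes lie in {2..b}, which has b - 1 elements, whereas X has at least b; so
    two positions share a prime.\<close>
  have "\<not> inj_on f X"
  proof
    assume "inj_on f X"
    then have "card X \<le> card {2..b}" using fe(1) by (intro card_inj_on_le) auto
    then show False using X(2) b by simp
  qed
  then obtain M M' where M: "M \<in> X" "M' \<in> X" "M < M'" "f M = f M'"
    unfolding inj_on_def by (metis linorder_neqE_nat)
  define k where "k = min (e M) (e M')"
  \<comment> \<open>This is the number formed by the digits from M up to M' - 1. Its leading digit
    is nonzero because M is in X, so it is positive, and it is less than b^g.\<close>
  define D where "D = digit_prefix b (\<lambda>i. a (M + i)) (M' - M)"
  have "digit_prefix b a M' = b ^ (M' - M) * digit_prefix b a M + D"
    using digit_prefix_add[of b a M "M' - M"] M(3) by (simp add: D_def)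
  moreover have "f M ^ k dvd digit_prefix b a M"
    by (rule dvd_trans[OF le_imp_power_dvd fe(2)[OF M(1)]]) (simp add: k_def)
  moreover have "f M ^ k dvd digit_prefix b a M'"
    unfolding M(4) by (rule dvd_trans[OF le_imp_power_dvd fe(2)[OF M(2)]]) (simp add: k_def)
  ultimately have "f M ^ k dvd D" by (metis dvd_add_right_iff dvd_mult)
  moreover have "0 < D" unfolding D_def
    by (rule digit_prefix_pos) (use M(3) nz[OF M(1)] b in simp_all)
  ultimately have "f M ^ k \<le> D" by (rule dvd_imp_le)
  moreover have "D < b ^ (M' - M)" unfolding D_def by (rule digit_prefix_less) (rule a)
  moreover have "b ^ (M' - M) \<le> b ^ g"
  proof (rule power_increasing)
    have "M \<in> {N..<N + g}" "M' \<in> {N..<N + g}" using X(1) M(1,2) by blast+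
    then show "M' - M \<le> g" unfolding atLeastLessThan_iff by linarith
  qed (use b in simp)
  moreover have "b ^ g < f M ^ k"
    using fe(3)[OF M(1)] fe(3)[OF M(2)] M(4) by (simp add: k_def min_def)
  ultimately show False by simp
qed

end

text \<open>In lowest terms the denominator is b^n divided by the gcd, and it divides the
  denominator of every other representation. A small gcd thus keeps all of them large.\<close>

lemma fraction_denominator_ge:
  fixes P q b :: nat and p :: int
  assumes "2 \<le> b" "0 < q" "real P / real b ^ n = real_of_int p / real q"
    "gcd P (b ^ n) \<le> b ^ g"
  shows "real b powr (real n - real g) \<le> real q"
proof -
  define d where "d = gcd P (b ^ n)"
  have d0: "0 < d" using assms(1) by (simp add: d_def)
  have "\<exists>P' B. P = P' * d \<and> b ^ n = B * d \<and> coprime P' B"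
    unfolding d_def by (rule gcd_coprime_exists) (use d0 in \<open>simp add: d_def\<close>)
  then obtain P' B where B: "P = P' * d" "b ^ n = B * d" "coprime P' B"
    by (elim exE conjE) (rule that)
  have "real_of_int (int P * int q) = real_of_int (p * int (b ^ n))"
    using assms(1-3) by (simp add: field_simps)
  then have eq: "int P * int q = p * int (b ^ n)" by (simp only: of_int_eq_iff)
  then have "int d * (int P' * int q) = int d * (p * int B)"
    unfolding B(1,2) of_nat_mult by (simp only: mult_ac)
  then have "int P' * int q = p * int B" using d0 by simp
  then have "int B dvd int P' * int q" by simp
  then have "B dvd P' * q" by (metis int_dvd_int_iff of_nat_mult)
  then have "B dvd q" using B(3) by (simp add: coprime_commute coprime_dvd_mult_right_iff)
  then have "B \<le> q" using assms(2) by (simp add: dvd_imp_le)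
  have "real b powr real n = real (b ^ n)" using assms(1) by (simp add: powr_realpow)
  also have "\<dots> = real d * real B" by (simp only: B(2) of_nat_mult mult.commute)
  also have "\<dots> \<le> real b powr real g * real q"
  proof (intro mult_mono)
    show "real d \<le> real b powr real g"
      using assms(1,4) by (simp add: powr_realpow d_def flip: of_nat_power)
  qed (use \<open>B \<le> q\<close> in auto)
  finally show ?thesis using assms(1) by (simp add: powr_diff field_simps)
qed

subsection \<open>Splitting the digits into alternating blocks\<close>

text \<open>Filling up with 0 keeps the digits in W when 0 is in W, and the parts belonging to
  complementary sets add up without carries.\<close>

definition digits_on :: "nat set \<Rightarrow> (nat \<Rightarrow> nat) \<Rightarrow> nat \<Rightarrow> nat" where
  "digits_on S a i = (if i \<in> S then a i else 0)"

text \<open>The hypothesis is applied once more beyond (1 + \<epsilon>/4) N, so the new digit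
  position differs from the c old ones. Two factors 1 + \<epsilon>/4 and the rounding still fit into
  1 + \<epsilon> for large N.\<close>

lemma many_nonzero_digits:
  fixes a :: "nat \<Rightarrow> nat" and \<epsilon> :: real
  assumes single: "\<And>\<epsilon>::real. 0 < \<epsilon> \<Longrightarrow>
    \<forall>\<^sub>F N in sequentially. \<exists>i\<ge>N. real i < (1 + \<epsilon>) * N \<and> a i \<noteq> 0"
  assumes "0 < \<epsilon>" "\<epsilon> \<le> 1"
  shows "\<forall>\<^sub>F N in sequentially. \<exists>X. finite X \<and> card X = c \<and>
    (\<forall>i\<in>X. N \<le> i \<and> real i < (1 + \<epsilon>) * N \<and> a i \<noteq> 0)"
  using assms(2,3)
proof (induction c arbitrary: \<epsilon>)
  case 0
  show ?case by (intro always_eventually allI exI[of _ "{}"]) simp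
next
  case (Suc c)
  define N' where "N' N = nat \<lceil>(1 + \<epsilon> / 4) * real N\<rceil>" for N
  have N': "(1 + \<epsilon> / 4) * N \<le> N' N" "N' N \<le> (1 + \<epsilon> / 4) * N + 1" for N
  proof -
    have "0 \<le> (1 + \<epsilon> / 4) * real N" using Suc.prems by simp
    then show "(1 + \<epsilon> / 4) * N \<le> N' N" "N' N \<le> (1 + \<epsilon> / 4) * N + 1"
      unfolding N'_def by linarith+
  qed
  have "N \<le> N' N" for N
  proof -
    have "real N \<le> (1 + \<epsilon> / 4) * N" using Suc.prems by (simp add: algebra_simps)
    then show ?thesis using N'(1)[of N] by linarith
  qed
  then have lim: "filterlim N' at_top sequentially"
    by (intro filterlim_at_top_mono[OF filterlim_ident]) auto
  have "0 < \<epsilon> / 4" "\<epsilon> / 4 \<le> 1" using Suc.prems by auto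
  note 1 = Suc.IH[OF this] and 2 = eventually_compose_filterlim[OF single[OF this(1)] lim]
  have 3: "\<forall>\<^sub>F N in sequentially. 8 / \<epsilon> < real N"
    using filterlim_real_sequentially by (simp add: filterlim_at_top_dense)
  from 1 2 3 show ?case
  proof eventually_elim
    case (elim N)
    from elim(1) obtain X where X: "finite X" "card X = c"
      "\<forall>i\<in>X. N \<le> i \<and> real i < (1 + \<epsilon> / 4) * N \<and> a i \<noteq> 0" by (elim exE conjE) (rule that)
    from elim(2) obtain j where j: "N' N \<le> j" "real j < (1 + \<epsilon> / 4) * N' N" "a j \<noteq> 0"
      by (elim exE conjE) (rule that)
    have jN: "(1 + \<epsilon> / 4) * N \<le> real j" using j(1) N'(1)[of N] by linarith
    then have "j \<notin> X" using X(3) by force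
    have "(1 + \<epsilon> / 4) * N' N \<le> (1 + \<epsilon> / 4) * ((1 + \<epsilon> / 4) * N + 1)"
      using N'(2) Suc.prems by (intro mult_left_mono) auto
    also have "\<dots> = N + \<epsilon> * N / 2 + \<epsilon> * (\<epsilon> * N) / 16 + 1 + \<epsilon> / 4" by (simp add: field_simps)
    also have "\<epsilon> * (\<epsilon> * N) \<le> 1 * (\<epsilon> * N)" using Suc.prems by (intro mult_right_mono) auto
    also have "N + \<epsilon> * N / 2 + 1 * (\<epsilon> * N) / 16 + 1 + \<epsilon> / 4 \<le> (1 + \<epsilon>) * N"
    proof -
      have "8 < \<epsilon> * N" using elim(3) Suc.prems by (simp add: field_simps)
      then show ?thesis using Suc.prems by (simp add: distrib_right)
    qed
    finally have "real j < (1 + \<epsilon>) * N" using j(2) by simp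
    moreover have "(1 + \<epsilon> / 4) * N \<le> (1 + \<epsilon>) * N" using Suc.prems by (intro mult_right_mono) auto
    moreover have "N \<le> j" using j(1) \<open>N \<le> N' N\<close> by simp
    ultimately show ?case using X j(3) \<open>j \<notin> X\<close>
      by (intro exI[of _ "insert j X"]) (auto intro: less_le_trans)
  qed
qed

text \<open>Replaces the statements for all \<epsilon> by one sublinear function: the least length
  of a window after N with c nonzero digits. Later c is b, the number of candidates required by the
  pigeonhole argument.\<close>

lemma exists_gap_function:
  fixes a :: "nat \<Rightarrow> nat"
  assumes single: "\<And>\<epsilon>::real. 0 < \<epsilon> \<Longrightarrow>
    \<forall>\<^sub>F N in sequentially. \<exists>i\<ge>N. real i < (1 + \<epsilon>) * N \<and> a i \<noteq> 0"
  shows "\<exists>G. (\<forall>N. \<exists>X. X \<subseteq> {N..<N + G N} \<and> c \<le> card X \<and> (\<forall>i\<in>X. a i \<noteq> 0)) \<and>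
    (\<lambda>N. real (G N) / real N) \<longlonglongrightarrow> 0"
proof -
  define Q where "Q N g \<longleftrightarrow> (\<exists>X. X \<subseteq> {N..<N + g} \<and> c \<le> card X \<and> (\<forall>i\<in>X. a i \<noteq> 0))" for N g
  define G where "G N = (LEAST g. Q N g)" for N
  have Q: "\<forall>\<^sub>F N in sequentially. Q N (nat \<lceil>\<epsilon> * N\<rceil>)" if "0 < \<epsilon>" "\<epsilon> \<le> 1" for \<epsilon> :: real
  proof -
    have "\<forall>\<^sub>F N in sequentially. \<exists>X. finite X \<and> card X = c \<and>
        (\<forall>i\<in>X. N \<le> i \<and> real i < (1 + \<epsilon>) * N \<and> a i \<noteq> 0)"
      by (rule many_nonzero_digits[OF _ that]) (rule single)
    then show ?thesis
    proof eventually_elim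
      case (elim N)
      then obtain X where X: "card X = c" "\<forall>i\<in>X. N \<le> i \<and> real i < (1 + \<epsilon>) * N \<and> a i \<noteq> 0"
        by (elim exE conjE) (rule that)
      have "i \<in> {N..<N + nat \<lceil>\<epsilon> * N\<rceil>}" if "i \<in> X" for i
      proof -
        have "N \<le> i" "real i < N + \<epsilon> * N" using X(2) that by (auto simp: distrib_right)
        moreover have "\<epsilon> * N \<le> nat \<lceil>\<epsilon> * N\<rceil>" by linarith
        ultimately have "real i < real (N + nat \<lceil>\<epsilon> * N\<rceil>)" by linarith
        then have "i < N + nat \<lceil>\<epsilon> * N\<rceil>" by (simp only: of_nat_less_iff)
        then show ?thesis using \<open>N \<le> i\<close> by simp
      qed
      then show ?case unfolding Q_def using X by (intro exI[of _ X]) auto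
    qed
  qed
  \<comment> \<open>A window must exist for every N, also for small ones, about which the asymptotic
    hypothesis says nothing; there a longer window reaching past N0 serves.\<close>
  have "\<exists>g. Q N g" for N
  proof -
    obtain N0 where "\<forall>N\<ge>N0. Q N N"
      using Q[of 1] unfolding eventually_sequentially by auto
    then have "Q (max N N0) (max N N0)" by simp
    then obtain X where X: "X \<subseteq> {max N N0..<max N N0 + max N N0}" "c \<le> card X" "\<forall>i\<in>X. a i \<noteq> 0"
      unfolding Q_def by (elim exE conjE) (rule that)
    have "{max N N0..<max N N0 + max N N0} \<subseteq> {N..<N + (max N N0 + max N N0)}" by auto
    with X(1) have "X \<subseteq> {N..<N + (max N N0 + max N N0)}" by (rule order_trans)
    then have "Q N (max N N0 + max N N0)" unfolding Q_def using X(2,3) by (intro exI[of _ X] conjI)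
    then show ?thesis by blast
  qed
  then have QG: "Q N (G N)" for N unfolding G_def by (metis LeastI)
  have "(\<lambda>N. real (G N) / real N) \<longlonglongrightarrow> 0"
  proof (rule tendstoI)
    fix e :: real assume "e > 0"
    define \<epsilon> where "\<epsilon> = min 1 (e / 2)"
    have \<epsilon>: "0 < \<epsilon>" "\<epsilon> \<le> 1" "2 * \<epsilon> \<le> e" using \<open>e > 0\<close> by (auto simp: \<epsilon>_def min_def)
    have "\<forall>\<^sub>F N in sequentially. 1 / \<epsilon> < real N"
      using filterlim_real_sequentially by (simp add: filterlim_at_top_dense)
    with Q[OF \<epsilon>(1,2)] show "\<forall>\<^sub>F N in sequentially. dist (real (G N) / real N) 0 < e"
    proof eventually_elim
      case (elim N)
      have "G N \<le> nat \<lceil>\<epsilon> * N\<rceil>" unfolding G_def by (rule Least_le) (rule elim(1))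
      moreover have "0 \<le> \<epsilon> * N" using \<epsilon>(1) by simp
      ultimately have "real (G N) < \<epsilon> * N + 1" by linarith
      also have "1 < \<epsilon> * N" using elim(2) \<epsilon>(1) by (simp add: field_simps)
      finally have "real (G N) < 2 * \<epsilon> * N" by simp
      also have "\<dots> \<le> e * N" using \<epsilon>(3) by (intro mult_right_mono) auto
      finally show ?case using elim(2) \<epsilon>(1) by (cases "N = 0") (auto simp: field_simps)
    qed
  qed
  then show ?thesis using QG unfolding Q_def by blast
qed

text \<open>S j is the set of digit positions of the summand whose block ends at M j; the next block belongs to the
  other summand, which explains the complement.\<close>

lemma exists_block_sequence:
  fixes lam :: "nat \<Rightarrow> real" and a G :: "nat \<Rightarrow> nat"
  assumes b: "2 \<le> b" and a: "\<And>i. a i < b" and lam: "\<And>j. 1 \<le> lam j"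
    and gap: "\<forall>N. \<exists>X. X \<subseteq> {N..<N + G N} \<and> b \<le> card X \<and> (\<forall>i\<in>X. a i \<noteq> 0)"
  defines "start j M \<equiv> nat \<lceil>lam j * real M\<rceil> + 1"
  shows "\<exists>M S. (\<forall>j. S j \<subseteq> {..<M j}) \<and> (\<forall>j. S (Suc j) = {..<M (Suc j)} - S j) \<and>
    (\<forall>j. start j (M j) \<le> M (Suc j) \<and> M (Suc j) \<le> start j (M j) + G (start j (M j)) \<and>
      gcd (digit_prefix b (digits_on (S (Suc j)) a) (M (Suc j))) (b ^ M (Suc j)) \<le> b ^ (G (start j (M j)) * b))"
proof -
  define Q where "Q j s t \<longleftrightarrow> (snd t = {..<fst t} - snd s) \<and>
    start j (fst s) \<le> fst t \<and> fst t \<le> start j (fst s) + G (start j (fst s)) \<and>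
    gcd (digit_prefix b (digits_on (snd t) a) (fst t)) (b ^ fst t) \<le> b ^ (G (start j (fst s)) * b)"
    for j and s t :: "nat \<times> nat set"
  have "\<exists>f. \<forall>j. snd (f j) \<subseteq> {..<fst (f j)} \<and> Q j (f j) (f (Suc j))"
  \<comment> \<open>The state pairs an endpoint with the positions of one summand, because the gcd
    condition at the next endpoint involves all earlier digits of the other summand.\<close>
  proof (rule dependent_nat_choice[where P = "\<lambda>_ s. snd s \<subseteq> {..<fst s}" and Q = Q])
    show "\<exists>s :: nat \<times> nat set. snd s \<subseteq> {..<fst s}" by (intro exI[of _ "(0, {})"]) simp
    fix s :: "nat \<times> nat set" and j assume s: "snd s \<subseteq> {..<fst s}"
    define N where "N = start j (fst s)"
    have "real (fst s) \<le> lam j * fst s" using mult_right_mono[OF lam[of j], of "real (fst s)"] by simp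
    then have N: "fst s \<le> N" unfolding N_def start_def by linarith
    obtain X where X: "X \<subseteq> {N..<N + G N}" "b \<le> card X" "\<forall>i\<in>X. a i \<noteq> 0"
      using gap by blast
    \<comment> \<open>The next endpoint is not yet known, so the candidates are tested on the whole
      complement of the old positions. Beyond the old endpoint this contains every position, so the
      nonzero digits at X survive.\<close>
    have "\<exists>M\<in>X. gcd (digit_prefix b (digits_on (- snd s) a) M) (b ^ M) \<le> b ^ (G N * b)"
    proof (rule ex_prefix_small_gcd[OF b _ X(1,2)])
      show "digits_on (- snd s) a i < b" for i using a[of i] b by (simp add: digits_on_def)
      show "digits_on (- snd s) a i \<noteq> 0" if "i \<in> X" for i
      proof -
        have "i \<ge> fst s" using X(1) that N by force
        then have "i \<notin> snd s" using s by force
        then show ?thesis using X(3) that by (simp add: digits_on_def)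
      qed
    qed
    then obtain M where M: "M \<in> X" "gcd (digit_prefix b (digits_on (- snd s) a) M) (b ^ M) \<le> b ^ (G N * b)"
      by (elim bexE) (rule that)
    have "digit_prefix b (digits_on (- snd s) a) M = digit_prefix b (digits_on ({..<M} - snd s) a) M"
      by (rule digit_prefix_cong) (simp add: digits_on_def)
    moreover have "N \<le> M" "M \<le> N + G N" using X(1) M(1) by (force dest: less_imp_le)+
    ultimately have "snd (M, {..<M} - snd s) \<subseteq> {..<fst (M, {..<M} - snd s)} \<and> Q j s (M, {..<M} - snd s)"
      using M(2) by (auto simp: Q_def N_def[symmetric])
    then show "\<exists>t. snd t \<subseteq> {..<fst t} \<and> Q j s t" by (rule exI)
  qed
  then obtain f where f: "\<forall>j. snd (f j) \<subseteq> {..<fst (f j)} \<and> Q j (f j) (f (Suc j))" by (rule exE)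
  show ?thesis
    by (rule exI[of _ "\<lambda>j. fst (f j)"], rule exI[of _ "\<lambda>j. snd (f j)"]) (use f[unfolded Q_def] in \<open>intro conjI allI; blast\<close>)
qed

text \<open>The summand on E is truncated at \<open>n k\<close>, where its zeros begin; the
  complementary summand is truncated at \<open>m k\<close> and vanishes from there to
  \<open>n (Suc k)\<close>. Minus the latter truncation is the shift by which the summand on E is
  nearly a translate of the whole number.\<close>

lemma alternating_block_exponent:
  fixes n m h a :: "nat \<Rightarrow> nat" and \<tau> \<tau>' :: real
  assumes b: "2 \<le> b" and a: "\<And>i. a i < b" and \<tau>: "\<tau> > (5 + sqrt 17) / 2" "\<tau>' > (5 + sqrt 17) / 2"
    and nm: "\<And>k. n k < m k" "\<And>k. m k < n (Suc k)"
    and lim: "(\<lambda>k. real (m k) / real (n k)) \<longlonglongrightarrow> \<tau>" "(\<lambda>k. real (n (Suc k)) / real (m k)) \<longlonglongrightarrow> \<tau>'"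
    and out: "\<And>i k. n k \<le> i \<Longrightarrow> i < m k \<Longrightarrow> i \<notin> E"
    and inn: "\<And>i k. m k \<le> i \<Longrightarrow> i < n (Suc k) \<Longrightarrow> i \<in> E"
    and single: "\<And>\<epsilon>::real. 0 < \<epsilon> \<Longrightarrow>
      \<forall>\<^sub>F N in sequentially. \<exists>i\<ge>N. real i < (1 + \<epsilon>) * N \<and> a i \<noteq> 0"
    and h: "\<forall>\<^sub>F k in sequentially. gcd (digit_prefix b (digits_on E a) (n k)) (b ^ n k) \<le> b ^ h k"
      "(\<lambda>k. real (h k) / real (n k)) \<longlonglongrightarrow> 0"
    and gen: "\<And>\<epsilon>::real. 0 < \<epsilon> \<Longrightarrow>
      inapproximable (digit_value b a) (2 + \<epsilon>)"
  shows "digit_value b (digits_on E a) \<in> exact_exponent_set \<tau>"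
proof -
  define d d' where "d = digits_on E a" and "d' = digits_on (- E) a"
  have d: "d i < b" and d': "d' i < b" for i
    using a[of i] by (auto simp: d_def d'_def digits_on_def)
  have sum: "digit_value b d + digit_value b d' = digit_value b a"
    unfolding digit_value_def suminf_add[OF summable_digits[where a = d, OF b d] summable_digits[where a = d', OF b d']]
    by (intro arg_cong[of _ _ suminf] ext) (simp add: d_def d'_def digits_on_def)
  have sm: "strict_mono n" using nm by (auto simp: strict_mono_Suc_iff intro: less_trans)
  then have kn: "k \<le> n k" for k by (rule strict_mono_imp_increasing)
  have nlim: "filterlim n at_top sequentially"
    using kn by (intro filterlim_at_top_mono[OF filterlim_ident]) auto
  have "k \<le> m k" for k using kn[of k] nm(1)[of k] by simp
  then have mlim: "filterlim m at_top sequentially"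
    by (intro filterlim_at_top_mono[OF filterlim_ident]) auto
  show ?thesis
    unfolding d_def[symmetric]
  proof (rule sparse_expansion_exact_exponent[OF b \<tau> nm lim,
        where P = "\<lambda>k. int (digit_prefix b d (n k))" and R = "\<lambda>k. - int (digit_prefix b d' (m k))"])
    show "\<bar>digit_value b d - real_of_int (int (digit_prefix b d (n k))) / real b ^ n k\<bar> \<le> 1 / real b ^ m k" for k
      using digit_value_approx_zeros[where a = d, OF b d, of "n k" "m k"] nm(1)[of k] out[of k]
      by (simp add: d_def digits_on_def)
    show "\<bar>digit_value b d - digit_value b a - real_of_int (- int (digit_prefix b d' (m k))) / real b ^ m k\<bar>
        \<le> 1 / real b ^ n (Suc k)" for k
      using digit_value_approx_zeros[where a = d', OF b d', of "m k" "n (Suc k)"] nm(2)[of k] inn[of k] sum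
      by (simp add: d'_def digits_on_def abs_minus_commute algebra_simps)
    show "inapproximable (digit_value b a) (2 + \<epsilon>)"
      if "0 < \<epsilon>" for \<epsilon> :: real using that by (rule gen)
    fix \<epsilon> :: real assume \<epsilon>: "0 < \<epsilon>"
    \<comment> \<open>The bound 1 keeps the next nonzero digit below 2 m k and hence, as \<tau>' >
      2, inside the block of E. The bound \<epsilon>/2 leaves room for the extra position in
      \<open>Suc i\<close>.\<close>
    define \<delta> where "\<delta> = min 1 (\<epsilon> / 2)"
    have \<delta>: "0 < \<delta>" "\<delta> \<le> 1" "\<delta> \<le> \<epsilon> / 2" using \<epsilon> by (auto simp: \<delta>_def)
    show "\<forall>\<^sub>F k in sequentially. real b powr (- (1 + \<epsilon>) * real (m k))
        \<le> \<bar>digit_value b d - real_of_int (int (digit_prefix b d (n k))) / real b ^ n k\<bar>"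
    proof -
      have 1: "\<forall>\<^sub>F k in sequentially. 2 < real (n (Suc k)) / m k"
        using lim(2) by (rule order_tendstoD) (use sqrt17_threshold(2)[OF \<tau>(2)] in simp)
      have 2: "\<forall>\<^sub>F k in sequentially. 2 / \<epsilon> < real (m k)"
        using filterlim_compose[OF filterlim_real_sequentially mlim] by (simp add: filterlim_at_top_dense)
      from eventually_compose_filterlim[OF single[OF \<delta>(1)] mlim] 1 2 show ?thesis
      proof eventually_elim
        case (elim k)
        from elim(1) obtain i where i: "m k \<le> i" "real i < (1 + \<delta>) * m k" "a i \<noteq> 0"
          by (elim exE conjE) (rule that)
        have m0: "0 < real (m k)" using nm(1)[of k] by simp
        have "(1 + \<delta>) * m k \<le> 2 * real (m k)" using \<delta>(2) by (intro mult_right_mono) auto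
        moreover have "2 * real (m k) < n (Suc k)" using elim(2) m0 by (simp add: field_simps)
        ultimately have "real i < real (n (Suc k))" using i(2) by linarith
        then have "i < n (Suc k)" by (simp only: of_nat_less_iff)
        then have "d i \<noteq> 0" using i(3) inn[OF i(1)] by (simp add: d_def digits_on_def)
        moreover have "n k \<le> i" using i(1) nm(1)[of k] by simp
        ultimately have lo: "1 / real b ^ Suc i \<le> \<bar>digit_value b d - real (digit_prefix b d (n k)) / real b ^ n k\<bar>"
          by (intro digit_value_lower[where a = d, OF b d])
        have "(1 + \<delta>) * m k \<le> (1 + \<epsilon> / 2) * m k" using \<delta>(3) by (intro mult_right_mono) auto
        then have "real (Suc i) \<le> m k + \<epsilon> / 2 * m k + 1" using i(2) by (simp add: distrib_right)
        also have "1 \<le> \<epsilon> / 2 * m k" using elim(3) \<epsilon> by (simp add: field_simps)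
        finally have "real (Suc i) \<le> (1 + \<epsilon>) * m k" by (simp add: distrib_right)
        then have "- (1 + \<epsilon>) * m k \<le> - real (Suc i)" by (simp only: minus_mult_left[symmetric] neg_le_iff_le)
        then have "b powr (- (1 + \<epsilon>) * m k) \<le> b powr (- real (Suc i))" by (rule powr_mono) (use b in simp)
        also have "\<dots> = 1 / real b ^ Suc i" using b by (simp only: powr_minus_divide powr_realpow)
        finally show ?case using lo by simp
      qed
    qed
    show "\<forall>\<^sub>F k in sequentially. \<forall>(p::int) (q::nat). (0::nat) < q \<longrightarrow>
        real_of_int (int (digit_prefix b d (n k))) / real b ^ n k = p / q \<longrightarrow>
        real b powr ((1 - \<epsilon>) * real (n k)) \<le> q"
    proof -
      have 1: "\<forall>\<^sub>F k in sequentially. real (h k) / n k < \<epsilon>"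
        using h(2) by (rule order_tendstoD) (rule \<epsilon>)
      have 2: "\<forall>\<^sub>F k in sequentially. 0 < n k"
        using eventually_compose_filterlim[OF eventually_gt_at_top nlim] .
      from h(1) 1 2 show ?thesis
      proof eventually_elim
        case (elim k)
        have hk: "real (h k) \<le> \<epsilon> * n k" using elim(2,3) by (simp add: field_simps)
        show ?case
        proof (intro allI impI)
          fix p :: int and q :: nat
          assume q: "0 < q" "real_of_int (int (digit_prefix b d (n k))) / real b ^ n k = p / q"
          have "b powr ((1 - \<epsilon>) * n k) \<le> b powr (real (n k) - real (h k))"
            using b hk by (intro powr_mono) (auto simp: algebra_simps)
          also have "\<dots> \<le> q"
            using q elim(1) by (intro fraction_denominator_ge[OF b q(1)]) (auto simp: d_def)
          finally show "real b powr ((1 - \<epsilon>) * real (n k)) \<le> q" .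
        qed
      qed
    qed
  qed
qed

text \<open>One sequence of endpoints M serves both summands. The one of parity p has its zeros from
  \<open>M (2 * k + p)\<close> to the next endpoint, so the ratio there is its own exponent, and the
  following ratio is the exponent of the other.\<close>

theorem ex_digit_splitting:
  fixes a :: "nat \<Rightarrow> nat" and lam0 lam1 :: real
  assumes b: "2 \<le> b" and a: "\<And>i. a i < b"
    and lams: "lam0 > (5 + sqrt 17) / 2" "lam1 > (5 + sqrt 17) / 2"
    and single: "\<And>\<epsilon>::real. 0 < \<epsilon> \<Longrightarrow>
      \<forall>\<^sub>F N in sequentially. \<exists>i\<ge>N. real i < (1 + \<epsilon>) * N \<and> a i \<noteq> 0"
    and gen: "\<And>\<epsilon>::real. 0 < \<epsilon> \<Longrightarrow>
      inapproximable (digit_value b a) (2 + \<epsilon>)"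
  shows "\<exists>E. digit_value b (digits_on E a) \<in> exact_exponent_set lam0 \<and>
    digit_value b (digits_on (- E) a) \<in> exact_exponent_set lam1"
proof -
  define lam where "lam j = (if even j then lam0 else lam1)" for j :: nat
  define L where "L = max lam0 lam1"
  have lam_thr: "lam j > (5 + sqrt 17) / 2" for j using lams by (simp add: lam_def)
  have lam1: "1 \<le> lam j" for j using sqrt17_threshold(2)[OF lam_thr[of j]] by simp
  have lamL: "lam j \<le> L" for j by (simp add: lam_def L_def)
  obtain G where G: "\<forall>N. \<exists>X. X \<subseteq> {N..<N + G N} \<and> b \<le> card X \<and> (\<forall>i\<in>X. a i \<noteq> 0)"
    "(\<lambda>N. real (G N) / real N) \<longlonglongrightarrow> 0"
  proof -
    have "\<exists>G. (\<forall>N. \<exists>X. X \<subseteq> {N..<N + G N} \<and> b \<le> card X \<and> (\<forall>i\<in>X. a i \<noteq> 0)) \<and>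
        (\<lambda>N. real (G N) / real N) \<longlonglongrightarrow> 0"
      by (rule exists_gap_function) (fact single)
    then show thesis by (elim exE conjE) (rule that)
  qed
  obtain M S where SM: "\<forall>j. S j \<subseteq> {..<M j}" "\<forall>j. S (Suc j) = {..<M (Suc j)} - S j"
    and "\<forall>j. nat \<lceil>lam j * real (M j)\<rceil> + 1 \<le> M (Suc j) \<and>
      M (Suc j) \<le> nat \<lceil>lam j * real (M j)\<rceil> + 1 + G (nat \<lceil>lam j * real (M j)\<rceil> + 1) \<and>
      gcd (digit_prefix b (digits_on (S (Suc j)) a) (M (Suc j))) (b ^ M (Suc j))
        \<le> b ^ (G (nat \<lceil>lam j * real (M j)\<rceil> + 1) * b)"
    using exists_block_sequence[where a = a and lam = lam, OF b a lam1 G(1)] by (elim exE conjE) (rule that)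
  moreover define st where "st j = nat \<lceil>lam j * real (M j)\<rceil> + 1" for j
  ultimately have Mst: "\<And>j. st j \<le> M (Suc j)" "\<And>j. M (Suc j) \<le> st j + G (st j)"
    and gcdM: "\<And>j. gcd (digit_prefix b (digits_on (S (Suc j)) a) (M (Suc j))) (b ^ M (Suc j)) \<le> b ^ (G (st j) * b)"
    by simp_all
  have st: "lam j * M j \<le> st j" "st j \<le> lam j * M j + 2" "M j < st j" for j
  proof -
    have "real (M j) \<le> lam j * M j" using mult_right_mono[OF lam1[of j], of "real (M j)"] by simp
    moreover have "0 \<le> lam j * M j" using lam1[of j] by simp
    ultimately show "lam j * M j \<le> st j" "st j \<le> lam j * M j + 2" "M j < st j"
      unfolding st_def by linarith+
  qed
  have MSuc: "M j < M (Suc j)" for j using st(3)[of j] Mst(1)[of j] by simp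
  then have sM: "strict_mono M" by (simp add: strict_mono_Suc_iff)
  then have jM: "j \<le> M j" for j by (rule strict_mono_imp_increasing)
  have Mlim: "filterlim M at_top sequentially"
    using jM by (intro filterlim_at_top_mono[OF filterlim_ident]) auto
  have "M j \<le> st j" for j using st(3)[of j] by simp
  then have stlim: "filterlim st at_top sequentially"
    by (intro filterlim_at_top_mono[OF Mlim]) auto
  have Gst: "(\<lambda>j. real (G (st j)) / real (st j)) \<longlonglongrightarrow> 0"
    by (rule filterlim_compose[OF G(2) stlim])

  have S2: "S (Suc (Suc j)) = S j \<union> {M (Suc j)..<M (Suc (Suc j))}" for j
  proof -
    have "S j \<subseteq> {..<M j}" "M j < M (Suc j)" "M (Suc j) < M (Suc (Suc j))" using SM(1) MSuc by auto
    then show ?thesis unfolding SM(2)[rule_format] by force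
  qed
  \<comment> \<open>Passing from j to j + 2 only adds positions from \<open>M (Suc j)\<close> on, so
    below this endpoint the union \<open>E p\<close> coincides with a single
    \<open>S j\<close>.\<close>
  have Sstable: "i \<in> S (j + 2 * k) \<longleftrightarrow> i \<in> S j" if i: "i < M (Suc j)" for i j k
  proof (induction k)
    case (Suc k)
    have "M (Suc j) \<le> M (Suc (j + 2 * k))" using sM by (simp add: strict_mono_less_eq)
    then have "i \<notin> {M (Suc (j + 2 * k))..<M (Suc (Suc (j + 2 * k)))}" using i by simp
    then show ?case using Suc S2[of "j + 2 * k"] by auto
  qed simp
  define E where "E p = (\<Union>k. S (2 * k + p))" for p
  have E: "i \<in> E p \<longleftrightarrow> i \<in> S (2 * k + p)" if i: "i < M (Suc (2 * k + p))" for i k p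
  proof
    assume "i \<in> E p"
    then obtain k' where k': "i \<in> S (2 * k' + p)" unfolding E_def UN_iff by (elim bexE) (rule that)
    show "i \<in> S (2 * k + p)"
    proof (cases "k \<le> k'")
      case True
      then have eq: "2 * k' + p = 2 * k + p + 2 * (k' - k)" by simp
      show ?thesis using k' Sstable[OF i, of "k' - k"] by (simp only: eq)
    next
      case False
      then have eq: "2 * k + p = 2 * k' + p + 2 * (k - k')" by simp
      have "i < M (2 * k' + p)" using k' SM(1) by auto
      then have "i < M (Suc (2 * k' + p))" using MSuc[of "2 * k' + p"] by simp
      from Sstable[OF this, of "k - k'"] show ?thesis using k' by (simp only: eq)
    qed
  next
    show "i \<in> E p" if "i \<in> S (2 * k + p)" unfolding E_def using that by (rule UN_I[OF UNIV_I])
  qed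
  have E1: "E 1 = - E 0"
  proof (rule set_eqI)
    fix i
    have 0: "i < M (Suc (2 * i + 0))" using jM[of "Suc (2 * i + 0)"] by simp
    then have 1: "i < M (Suc (2 * i + 1))" using MSuc[of "Suc (2 * i + 0)"] by simp
    show "i \<in> E 1 \<longleftrightarrow> i \<in> - E 0"
      using E[OF 0] E[OF 1] SM(2)[rule_format, of "2 * i"] 0 by simp
  qed

  \<comment> \<open>The next endpoint exceeds \<open>lam j * M j\<close> by the rounding, at most 2,
    and by the search for a good endpoint, at most \<open>G (st j)\<close>, which is of smaller
    order than \<open>M j\<close>.\<close>
  have ratio: "(\<lambda>j. real (M (Suc j)) / real (M j) - lam j) \<longlonglongrightarrow> 0"
  proof (rule tendsto_sandwich[OF _ _ tendsto_const])
    have M0: "\<forall>\<^sub>F j in sequentially. 0 < M j"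
      using eventually_compose_filterlim[OF eventually_gt_at_top Mlim] .
    then show "\<forall>\<^sub>F j in sequentially. 0 \<le> real (M (Suc j)) / real (M j) - lam j"
    proof eventually_elim
      case (elim j)
      have "lam j * M j \<le> M (Suc j)" using st(1)[of j] Mst(1)[of j] by linarith
      then show ?case using elim by (simp add: field_simps)
    qed
    from M0 show "\<forall>\<^sub>F j in sequentially. real (M (Suc j)) / real (M j) - lam j
        \<le> 2 / real (M j) + real (G (st j)) / real (st j) * (L + 2)"
    proof eventually_elim
      case (elim j)
      have stpos: "0 < real (st j)" using st(3)[of j] by simp
      have "lam j * M j + 2 \<le> L * M j + 2 * M j"
        using elim lamL[of j] by (intro add_mono mult_right_mono) auto
      then have "st j \<le> (L + 2) * M j" using st(2)[of j] by (simp add: distrib_right)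
      then have "real (G (st j)) / st j * st j \<le> real (G (st j)) / st j * ((L + 2) * M j)"
        by (intro mult_left_mono) auto
      then have "G (st j) \<le> real (G (st j)) / st j * (L + 2) * M j" using stpos by simp
      then have "M (Suc j) \<le> lam j * M j + 2 + real (G (st j)) / st j * (L + 2) * M j"
        using Mst(2)[of j] st(2)[of j] by linarith
      then have "M (Suc j) / real (M j) \<le> (lam j * M j + 2 + real (G (st j)) / st j * (L + 2) * M j) / M j"
        by (rule divide_right_mono) simp
      also have "\<dots> = lam j + 2 / M j + real (G (st j)) / st j * (L + 2)"
        using elim by (simp add: add_divide_distrib)
      finally show ?case by simp
    qed
    have "filterlim (\<lambda>j. real (M j)) at_top sequentially"
      by (rule filterlim_compose[OF filterlim_real_sequentially Mlim])
    then have "(\<lambda>j. 2 / real (M j) + real (G (st j)) / real (st j) * (L + 2)) \<longlonglongrightarrow> 0 + 0 * (L + 2)"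
      by (intro tendsto_add tendsto_mult tendsto_const Gst tendsto_divide_0[OF tendsto_const]
          filterlim_at_top_imp_at_infinity)
    then show "(\<lambda>j. 2 / real (M j) + real (G (st j)) / real (st j) * (L + 2)) \<longlonglongrightarrow> 0" by simp
  qed
  have hlim: "(\<lambda>j. real (G (st j) * b) / real (M (Suc j))) \<longlonglongrightarrow> 0"
  proof (rule tendsto_sandwich[OF _ _ tendsto_const])
    show "\<forall>\<^sub>F j in sequentially. 0 \<le> real (G (st j) * b) / real (M (Suc j))" by simp
    show "\<forall>\<^sub>F j in sequentially. real (G (st j) * b) / real (M (Suc j)) \<le> real (G (st j)) / real (st j) * b"
    proof (intro always_eventually allI)
      fix j
      have "0 < st j" using st(3)[of j] by simp
      then have "real (G (st j) * b) / real (M (Suc j)) \<le> real (G (st j) * b) / real (st j)"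
        using Mst(1)[of j] by (intro divide_left_mono mult_pos_pos) auto
      then show "real (G (st j) * b) / real (M (Suc j)) \<le> real (G (st j)) / real (st j) * b" by simp
    qed
    show "(\<lambda>j. real (G (st j)) / real (st j) * b) \<longlonglongrightarrow> 0"
      using tendsto_mult_right[OF Gst, of "real b"] by simp
  qed
  have lin: "filterlim (\<lambda>k. 2 * k + p) at_top sequentially" "filterlim (\<lambda>k. 2 * k + p - 1) at_top sequentially"
    for p :: nat
    by (intro filterlim_at_top_mono[OF filterlim_ident] always_eventually allI; simp)+
  have ratio': "(\<lambda>k. real (M (Suc (2 * k + p))) / real (M (2 * k + p))) \<longlonglongrightarrow> lam p" for p
  proof -
    have "(\<lambda>k. real (M (Suc (2 * k + p))) / real (M (2 * k + p)) - lam (2 * k + p)) \<longlonglongrightarrow> 0"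
      by (rule filterlim_compose[OF ratio lin(1)])
    moreover have "lam (2 * k + p) = lam p" for k by (simp add: lam_def)
    ultimately have "(\<lambda>k. real (M (Suc (2 * k + p))) / real (M (2 * k + p)) - lam p) \<longlonglongrightarrow> 0" by simp
    then show ?thesis by (simp add: LIM_zero_iff)
  qed
  have "digit_value b (digits_on (E p) a) \<in> exact_exponent_set (lam p)" for p
  proof (rule alternating_block_exponent[where a = a and \<tau>' = "lam (Suc p)"
        and n = "\<lambda>k. M (2 * k + p)" and m = "\<lambda>k. M (Suc (2 * k + p))"
        and h = "\<lambda>k. G (st (2 * k + p - 1)) * b"])
    show "(\<lambda>k. real (M (2 * Suc k + p)) / real (M (Suc (2 * k + p)))) \<longlonglongrightarrow> lam (Suc p)"
      using ratio'[of "Suc p"] by simp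
    show "i \<notin> E p" if "M (2 * k + p) \<le> i" "i < M (Suc (2 * k + p))" for i k
      using E[OF that(2)] SM(1) that(1) by force
    show "i \<in> E p" if "M (Suc (2 * k + p)) \<le> i" "i < M (2 * Suc k + p)" for i k
    proof -
      have "i \<in> S (2 * Suc k + p)" using S2[of "2 * k + p"] that by simp
      then show ?thesis unfolding E_def by (rule UN_I[OF UNIV_I])
    qed
    show "\<forall>\<^sub>F k in sequentially. gcd (digit_prefix b (digits_on (E p) a) (M (2 * k + p))) (b ^ M (2 * k + p))
        \<le> b ^ (G (st (2 * k + p - 1)) * b)"
      using eventually_gt_at_top[of 0]
    proof eventually_elim
      case (elim k)
      \<comment> \<open>The endpoint \<open>M (2 * k + p)\<close> comes from the step with index one
        less. Truncated subtraction breaks this for k = p = 0, hence k > 0.\<close>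
      then have k: "Suc (2 * k + p - 1) = 2 * k + p" by simp
      have "digit_prefix b (digits_on (E p) a) (M (2 * k + p)) =
          digit_prefix b (digits_on (S (2 * k + p)) a) (M (2 * k + p))"
      proof (rule digit_prefix_cong)
        fix i assume "i < M (2 * k + p)"
        then have "i < M (Suc (2 * k + p))" using MSuc[of "2 * k + p"] by simp
        then show "digits_on (E p) a i = digits_on (S (2 * k + p)) a i" by (simp add: digits_on_def E)
      qed
      then show ?case using gcdM[of "2 * k + p - 1"] unfolding k by simp
    qed
    have "(\<lambda>k. real (G (st (2 * k + p - 1)) * b) / real (M (Suc (2 * k + p - 1)))) \<longlonglongrightarrow> 0"
      by (rule filterlim_compose[OF hlim lin(2)])
    then show "(\<lambda>k. real (G (st (2 * k + p - 1)) * b) / real (M (2 * k + p))) \<longlonglongrightarrow> 0"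
    proof (rule Lim_transform_eventually)
      show "\<forall>\<^sub>F k in sequentially. real (G (st (2 * k + p - 1)) * b) / real (M (Suc (2 * k + p - 1)))
          = real (G (st (2 * k + p - 1)) * b) / real (M (2 * k + p))"
        using eventually_gt_at_top[of 0] by eventually_elim simp
    qed
  qed (use b a lam_thr MSuc ratio' single gen in simp_all)
  from this[of 0] this[of 1, unfolded E1] show ?thesis
    by (intro exI[of _ "E 0"]) (simp add: lam_def)
qed

text \<open>The two conditions on the point act separately: exponent 2 bounds its distance to all
  fractions from below, and b-ary exponent 1 bounds its runs of zero digits.\<close>

theorem exact_exponent_sumset:
  assumes b: "2 \<le> b" and W: "W \<subseteq> {0..b - 1}" "0 \<in> W"
    and lams: "lam0 > (5 + sqrt 17) / 2" "lam1 > (5 + sqrt 17) / 2"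
  shows "exact_exponent_set 2 \<inter> exact_b_ary_exponent_set b 1 \<inter> missing_digit_set b W
    \<subseteq> (exact_exponent_set lam0 \<inter> missing_digit_set b W) + (exact_exponent_set lam1 \<inter> missing_digit_set b W)"
proof
  fix \<xi> assume "\<xi> \<in> exact_exponent_set 2 \<inter> exact_b_ary_exponent_set b 1 \<inter> missing_digit_set b W"
  then have \<xi>: "\<xi> \<in> exact_exponent_set 2" "\<xi> \<in> exact_b_ary_exponent_set b 1" "\<xi> \<in> missing_digit_set b W"
    by auto
  have irr: "\<xi> \<notin> \<rat>" using \<xi>(1) by (rule exact_exponent_set_irrational) simp
  from \<xi>(3) obtain a where aW: "\<And>i. a i \<in> W" and \<xi>a: "\<xi> = digit_value b a"
    by (auto simp: missing_digit_set_eq)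
  have a: "a i < b" for i using aW[of i] W(1) b by force
  have gen: "inapproximable (digit_value b a) (2 + \<epsilon>)"
    if "0 < \<epsilon>" for \<epsilon> :: real
  proof -
    have "\<forall>\<mu>>2. inapproximable \<xi> \<mu>"
      using \<xi>(1) exact_exponent_set_iff[of 2 \<xi>] irr by simp
    from this[THEN spec, of "2 + \<epsilon>", THEN mp] show ?thesis using that unfolding \<xi>a by linarith
  qed
  \<comment> \<open>A run of zeros from N to (1 + \<epsilon>) N would make the truncation at N a
    b-ary approximation of order 1 + \<epsilon>.\<close>
  have single: "\<forall>\<^sub>F N in sequentially. \<exists>i\<ge>N. real i < (1 + \<epsilon>) * N \<and> a i \<noteq> 0" if \<epsilon>: "0 < \<epsilon>" for \<epsilon> :: real
  proof -
    have "b_inapproximable b \<xi> (1 + \<epsilon>)"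
    proof -
      have "\<forall>\<mu>>1. b_inapproximable b \<xi> \<mu>"
        using \<xi>(2) exact_b_ary_exponent_set_iff[OF b _ irr, of 1] by simp
      from this[THEN spec, of "1 + \<epsilon>", THEN mp] show ?thesis using \<epsilon> by linarith
    qed
    then show ?thesis
    proof eventually_elim
      case (elim N)
      show ?case
      proof (rule ccontr)
        assume C: "\<not> ?thesis"
        define m where "m = nat \<lceil>(1 + \<epsilon>) * real N\<rceil>"
        have "real N \<le> (1 + \<epsilon>) * N" using \<epsilon> by (simp add: distrib_right)
        then have Nm: "N \<le> m" and m: "(1 + \<epsilon>) * N \<le> m" unfolding m_def by linarith+
        have "a i = 0" if "N \<le> i" "i < m" for i
        proof -
          have "real i < (1 + \<epsilon>) * N" using that(2) unfolding m_def by linarith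
          then show ?thesis using C that(1) by blast
        qed
        then have "\<bar>\<xi> - real (digit_prefix b a N) / real b ^ N\<bar> \<le> 1 / real b ^ m"
          unfolding \<xi>a by (intro digit_value_approx_zeros[where a = a, OF b a Nm])
        also have "\<dots> = b powr (- real m)" using b by (simp add: powr_minus_divide powr_realpow)
        also have "\<dots> \<le> b powr (real N * - (1 + \<epsilon>))" using b m by (intro powr_mono) (auto simp: algebra_simps)
        also have "\<dots> = (b powr real N) powr (- (1 + \<epsilon>))" by (simp only: powr_powr)
        also have "\<dots> = (real b ^ N) powr (- (1 + \<epsilon>))" using b by (simp add: powr_realpow)
        finally show False using elim[rule_format, of "int (digit_prefix b a N)"] by simp
      qed
    qed
  qed
  obtain E where E: "digit_value b (digits_on E a) \<in> exact_exponent_set lam0"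
      "digit_value b (digits_on (- E) a) \<in> exact_exponent_set lam1"
  proof -
    have "\<exists>E. digit_value b (digits_on E a) \<in> exact_exponent_set lam0 \<and>
        digit_value b (digits_on (- E) a) \<in> exact_exponent_set lam1"
      by (rule ex_digit_splitting[OF b _ lams]) (fact a, fact single, fact gen)
    then show thesis by (elim exE conjE) (rule that)
  qed
  have K: "digit_value b (digits_on E' a) \<in> missing_digit_set b W" for E'
    unfolding missing_digit_set_eq using aW W(2) by (intro imageI) (simp add: digits_on_def)
  have d: "digits_on E' a i < b" for E' i using a[of i] by (simp add: digits_on_def)
  have "digit_value b (digits_on E a) + digit_value b (digits_on (- E) a) = \<xi>"
    unfolding \<xi>a digit_value_def suminf_add[OF summable_digits[where a = "digits_on E a", OF b d]
      summable_digits[where a = "digits_on (- E) a", OF b d]]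
    by (intro arg_cong[of _ _ suminf] ext) (simp add: digits_on_def)
  then show "\<xi> \<in> (exact_exponent_set lam0 \<inter> missing_digit_set b W)
      + (exact_exponent_set lam1 \<inter> missing_digit_set b W)"
    using E K by (auto simp: set_plus_def intro!: bexI)
qed

subsection \<open>Counting near missing digit sets\<close>

lemma powr_mult_of_nat: "0 < x \<Longrightarrow> x powr (y * real n) = (x powr y) ^ n"
  for x y :: real
  by (simp only: powr_powr[symmetric] powr_realpow powr_gt_zero)

lemma abs_midpoint_le:
  fixes x y r :: real
  assumes "\<bar>x - y\<bar> < 2 * r"
  shows "\<bar>x - (x + y) / 2\<bar> \<le> r" "\<bar>y - (x + y) / 2\<bar> \<le> r"
proof -
  have "x < y + 2 * r" "y < x + 2 * r" using assms by linarith+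
  then show "\<bar>x - (x + y) / 2\<bar> \<le> r" "\<bar>y - (x + y) / 2\<bar> \<le> r"
    by (simp_all add: abs_le_iff field_simps)
qed

locale digit_cantor_set =
  fixes b :: nat and W :: "nat set" and K :: "real set" and s :: real
  assumes b2: "2 \<le> b" and W_sub: "W \<subseteq> {0..b - 1}" and W_ne: "W \<noteq> {}"
  defines "K \<equiv> missing_digit_set b W" and "s \<equiv> log b (card W)"
begin

lemma finite_W: "finite W"
  using W_sub finite_subset by blast

lemma card_W: "1 \<le> card W"
  using finite_W W_ne by (simp add: Suc_le_eq card_gt_0_iff)

lemma s_nonneg: "0 \<le> s"
  using b2 card_W by (simp add: s_def)

lemma b_powr_s: "real b powr s = card W"
  using b2 card_W by (simp add: s_def)

lemma digits_less: "c \<in> W \<Longrightarrow> c < b"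
  using W_sub b2 by (metis One_nat_def Suc_pred atLeastAtMost_iff le_imp_less_Suc less_le_trans pos2 subsetD)

definition prefixes :: "nat \<Rightarrow> nat set" where
  "prefixes n = (\<lambda>a. digit_prefix b a n) ` {a. \<forall>i. a i \<in> W}"

lemma card_prefixes: "finite (prefixes n) \<and> card (prefixes n) \<le> card W ^ n"
proof (induction n)
  case 0
  have "prefixes 0 \<subseteq> {0}" by (auto simp: prefixes_def)
  then show ?case using card_mono[of "{0}" "prefixes 0"] finite_subset[of "prefixes 0" "{0}"] by simp
next
  case (Suc n)
  have sub: "prefixes (Suc n) \<subseteq> (\<lambda>(v, c). b * v + c) ` (prefixes n \<times> W)"
    by (force simp: prefixes_def image_iff)
  have fin: "finite (prefixes n \<times> W)" using Suc finite_W by simp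
  have "card (prefixes (Suc n)) \<le> card (prefixes n \<times> W)"
    using card_mono[OF finite_imageI[OF fin] sub] card_image_le[OF fin, of "\<lambda>(v, c). b * v + c"] by linarith
  also have "\<dots> \<le> card W ^ n * card W" using Suc by (simp add: card_cartesian_product)
  finally show ?case using finite_subset[OF sub finite_imageI[OF fin]] by (simp add: mult.commute)
qed

lemma K_near_prefix:
  assumes "x \<in> K"
  obtains v where "v \<in> prefixes n" "real v / real b ^ n \<le> x" "x \<le> real v / real b ^ n + 1 / real b ^ n"
proof -
  from assms obtain a where "a \<in> {a. \<forall>i. a i \<in> W}" "x = digit_value b a"
    unfolding K_def missing_digit_set_eq by (elim imageE) (rule that)
  then have a: "\<And>i. a i \<in> W" "x = digit_value b a" by simp_all
  have ab: "a i < b" for i by (rule digits_less) (rule a(1))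
  show thesis
  proof (rule that[of "digit_prefix b a n"])
    show "digit_prefix b a n \<in> prefixes n" using a(1) by (simp add: prefixes_def)
  qed (use digit_value_ge_prefix[where a = a, OF b2 ab] digit_value_le_prefix[where a = a, OF b2 ab] in
        \<open>simp_all add: a(2)\<close>)
qed

text \<open>The least n with b^(-n) at most \<delta> overshoots by a factor of at most b, and b^s =
  card W turns this into the factor card W.\<close>

lemma ex_scale:
  assumes "0 < \<delta>" "\<delta> \<le> 1"
  shows "\<exists>n. 1 / real b ^ n \<le> \<delta> \<and> real (card W) ^ n \<le> card W * \<delta> powr (- s)"
proof -
  define n where "n = nat \<lceil>log b (1 / \<delta>)\<rceil>"
  have b1: "1 < real b" using b2 by simp
  have l0: "0 \<le> log b (1 / \<delta>)" using assms b1 by simp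
  then have n: "log b (1 / \<delta>) \<le> n" "n \<le> log b (1 / \<delta>) + 1" unfolding n_def by linarith+
  have d: "real b powr (log b (1 / \<delta>)) = 1 / \<delta>" using assms b1 by simp
  have "real b powr (log b (1 / \<delta>)) \<le> real b powr n" using n(1) b1 by (intro powr_mono) auto
  then have "1 / \<delta> \<le> real b ^ n" using b1 by (simp only: d powr_realpow)
  then have "1 \<le> real b ^ n * \<delta>" using assms(1) by (simp add: pos_divide_le_eq)
  then have 1: "1 / real b ^ n \<le> \<delta>" using b1 by (simp add: pos_divide_le_eq mult.commute)
  have "real (card W) ^ n = (real b powr s) ^ n" by (simp only: b_powr_s)
  also have "\<dots> = real b powr (s * n)" using b1 by (simp add: powr_powr[symmetric] powr_realpow)
  also have "\<dots> \<le> real b powr (s * (log b (1 / \<delta>) + 1))"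
    using n(2) s_nonneg b1 by (intro powr_mono mult_left_mono) auto
  also have "s * (log b (1 / \<delta>) + 1) = log b (1 / \<delta>) * s + s" by (simp add: algebra_simps)
  also have "real b powr \<dots> = (real b powr log b (1 / \<delta>)) powr s * real b powr s"
    by (simp only: powr_add powr_powr)
  also have "\<dots> = card W * \<delta> powr (- s)"
    unfolding d b_powr_s using assms(1) by (simp add: powr_minus powr_divide field_simps)
  finally show ?thesis using 1 by blast
qed

text \<open>At scale \<delta> the set K lies in about \<delta>^(-s) intervals of length at most
  \<delta>. Enlarged by 4 \<delta> on both sides, such an interval holds at most 10 points with
  mutual distances at least \<delta>.\<close>

lemma card_separated:
  assumes \<delta>: "0 < \<delta>" "\<delta> \<le> 1"
    and near: "\<And>p. p \<in> P \<Longrightarrow> \<exists>x\<in>K. \<bar>p - x\<bar> \<le> 4 * \<delta>"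
    and sep: "\<And>p q. p \<in> P \<Longrightarrow> q \<in> P \<Longrightarrow> p \<noteq> q \<Longrightarrow> \<delta> \<le> \<bar>p - q\<bar>"
  shows "finite P" "real (card P) \<le> 10 * card W * \<delta> powr (- s)"
proof -
  from ex_scale[OF \<delta>] obtain n where n: "1 / real b ^ n \<le> \<delta>"
    "real (card W) ^ n \<le> card W * \<delta> powr (- s)" by blast
  have "\<exists>v. v \<in> prefixes n \<and> real v / real b ^ n - 4 * \<delta> \<le> p \<and> p \<le> real v / real b ^ n + 5 * \<delta>" if "p \<in> P" for p
  proof -
    from near[OF that] obtain x where x: "x \<in> K" "\<bar>p - x\<bar> \<le> 4 * \<delta>" by blast
    from x(1) obtain v where "v \<in> prefixes n" "real v / real b ^ n \<le> x"
      "x \<le> real v / real b ^ n + 1 / real b ^ n" by (rule K_near_prefix)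
    then show ?thesis using x(2) n(1) by (intro exI[of _ v]) auto
  qed
  from bchoice[OF ballI, OF this] obtain v where v: "\<forall>p\<in>P. v p \<in> prefixes n \<and>
      real (v p) / real b ^ n - 4 * \<delta> \<le> p \<and> p \<le> real (v p) / real b ^ n + 5 * \<delta>"
    by (rule exE)
  \<comment> \<open>The code of p consists of its interval and the number, from 0 to 9, of a slot of
    length \<delta> in the enlarged interval; points in one slot are closer than \<delta>.\<close>
  define f where "f p = (v p, nat \<lfloor>(p - real (v p) / real b ^ n + 4 * \<delta>) / \<delta>\<rfloor>)" for p
  have t: "0 \<le> (p - real (v p) / real b ^ n + 4 * \<delta>) / \<delta>" "(p - real (v p) / real b ^ n + 4 * \<delta>) / \<delta> \<le> 9"
    if "p \<in> P" for p
    using v that \<delta>(1) by (force simp: field_simps)+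
  have "inj_on f P"
  proof (rule inj_onI)
    fix p q assume pq: "p \<in> P" "q \<in> P" "f p = f q"
    show "p = q"
    proof (rule ccontr)
      assume "p \<noteq> q"
      then have "\<delta> \<le> \<bar>p - q\<bar>" using sep pq by blast
      define u where "u x = (x - real (v p) / real b ^ n + 4 * \<delta>) / \<delta>" for x
      have vq: "v q = v p" using pq(3) by (simp add: f_def)
      have "nat \<lfloor>u p\<rfloor> = nat \<lfloor>u q\<rfloor>" using pq(3) by (simp add: f_def u_def vq)
      moreover have "0 \<le> u p" "0 \<le> u q" using t(1)[OF pq(1)] t(1)[OF pq(2)] by (simp_all add: u_def vq)
      ultimately have "\<bar>u p - u q\<bar> < 1" by linarith
      moreover have "u p - u q = (p - q) / \<delta>" by (simp add: u_def diff_divide_distrib[symmetric])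
      ultimately show False using \<open>\<delta> \<le> \<bar>p - q\<bar>\<close> \<delta>(1) by (simp add: field_simps)
    qed
  qed
  moreover have "f ` P \<subseteq> prefixes n \<times> {..<10}"
  proof (rule image_subsetI)
    fix p assume "p \<in> P"
    have "\<lfloor>(p - real (v p) / real b ^ n + 4 * \<delta>) / \<delta>\<rfloor> \<le> 9" using t(2)[OF \<open>p \<in> P\<close>] by linarith
    then have "nat \<lfloor>(p - real (v p) / real b ^ n + 4 * \<delta>) / \<delta>\<rfloor> < 10" by linarith
    then show "f p \<in> prefixes n \<times> {..<10}" using v \<open>p \<in> P\<close> by (simp add: f_def)
  qed
  moreover have fin: "finite (prefixes n \<times> {..<10::nat})" using card_prefixes by simp
  ultimately show "finite P" by (meson inj_on_finite)
  have "card P \<le> card (prefixes n \<times> {..<10::nat})"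
    using \<open>inj_on f P\<close> \<open>f ` P \<subseteq> prefixes n \<times> {..<10}\<close> fin by (rule card_inj_on_le)
  also have "\<dots> \<le> 10 * card W ^ n" using card_prefixes[of n] by (simp add: card_cartesian_product)
  finally have "real (card P) \<le> real (10 * card W ^ n)" by (simp only: of_nat_le_iff)
  then show "real (card P) \<le> 10 * card W * \<delta> powr (- s)" using n(2) by simp
qed

lemma hausdorff_null_above_s:
  assumes "s < t"
  shows "hausdorff_measure t K = 0"
proof (rule hausdorff_null_limsup[where P = "\<lambda>n. (\<lambda>v. real v / real b ^ n) ` prefixes n" and r = "\<lambda>n. (1 / real b) ^ n"])
  have b1: "1 < real b" using b2 by simp
  show "0 \<le> t" using assms s_nonneg by simp
  show "finite ((\<lambda>v. real v / real b ^ n) ` prefixes n)" for n using card_prefixes by simp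
  show "0 < (1 / real b) ^ n" for n using b2 by simp
  show "(\<lambda>n. (1 / real b) ^ n) \<longlonglongrightarrow> 0" using b1 by (intro LIMSEQ_power_zero) simp
  show "summable (\<lambda>n. real (card ((\<lambda>v. real v / real b ^ n) ` prefixes n)) * (2 * (1 / real b) ^ n) powr t)"
  proof (rule summable_comparison_test')
    have "real b powr (s - t) < real b powr 0" using b1 assms by (intro powr_less_mono) auto
    then have "norm (real b powr (s - t)) < 1" using b1 by simp
    then show "summable (\<lambda>n. 2 powr t * (real b powr (s - t)) ^ n)"
      by (intro summable_mult summable_geometric)
    fix n :: nat
    have "card ((\<lambda>v. real v / real b ^ n) ` prefixes n) \<le> card W ^ n"
      using card_prefixes[of n] card_image_le[of "prefixes n" "\<lambda>v. real v / real b ^ n"] by linarith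
    then have "real (card ((\<lambda>v. real v / real b ^ n) ` prefixes n)) \<le> (real b powr s) ^ n"
      by (simp only: b_powr_s of_nat_power[symmetric] of_nat_le_iff)
    moreover have "(2 * (1 / real b) ^ n) powr t = 2 powr t * (real b powr (- t)) ^ n"
      using b1 by (simp add: powr_mult powr_minus_divide powr_divide powr_power power_one_over flip: powr_realpow)
         (simp add: powr_powr mult.commute power_one_over flip: powr_realpow)
    ultimately have "real (card ((\<lambda>v. real v / real b ^ n) ` prefixes n)) * (2 * (1 / real b) ^ n) powr t
        \<le> (real b powr s) ^ n * (2 powr t * (real b powr (- t)) ^ n)"
      by (simp add: mult_right_mono)
    also have "\<dots> = 2 powr t * (real b powr (s - t)) ^ n"
      by (simp add: power_mult_distrib[symmetric] powr_add[symmetric])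
    finally show "norm (real (card ((\<lambda>v. real v / real b ^ n) ` prefixes n)) * (2 * (1 / real b) ^ n) powr t)
        \<le> 2 powr t * (real b powr (s - t)) ^ n" by simp
  qed
  fix x m assume "x \<in> K"
  then obtain v where v: "v \<in> prefixes m" "real v / real b ^ m \<le> x" "x \<le> real v / real b ^ m + 1 / real b ^ m"
    by (rule K_near_prefix)
  then show "\<exists>n\<ge>m. \<exists>p\<in>(\<lambda>v. real v / real b ^ n) ` prefixes n. dist p x \<le> (1 / real b) ^ n"
    by (intro exI[of _ m]) (auto simp: dist_real_def power_one_over intro!: bexI[of _ v])
qed

lemma hausdorff_dim_le: "hausdorff_dim K \<le> ereal s"
  by (rule hausdorff_dim_leI[OF s_nonneg]) (rule hausdorff_null_above_s)

text \<open>Only the points of P n near K count. By separation there are at most a constant times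
  c^(n s) of them, and the balls around them have total content of order c^(-\<epsilon> s n), which
  is summable as s > 0. The constant 1/4 is the one for fractions with denominators in a dyadic
  interval, where c = 4.\<close>

lemma hausdorff_null_limsup_separated:
  fixes \<delta> :: "nat \<Rightarrow> real"
  assumes "0 < s" "0 < \<epsilon>" and c: "1 < c" and A: "A \<subseteq> K"
    and sep: "\<And>n p q. p \<in> P n \<Longrightarrow> q \<in> P n \<Longrightarrow> p \<noteq> q \<Longrightarrow> c powr (- real n) / 4 \<le> \<bar>p - q\<bar>"
    and cov: "\<And>x m. x \<in> A \<Longrightarrow> \<exists>n\<ge>m. \<exists>p\<in>P n. \<bar>p - x\<bar> \<le> c powr (- (1 + \<epsilon>) * n)"
  shows "hausdorff_measure s A = 0"
proof (rule hausdorff_null_limsup[where r = "\<lambda>n. c powr (- (1 + \<epsilon>) * n)"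
      and P = "\<lambda>n. {p \<in> P n. \<exists>x\<in>K. \<bar>p - x\<bar> \<le> c powr (- (1 + \<epsilon>) * n)}"])
  let ?Q = "\<lambda>n. {p \<in> P n. \<exists>x\<in>K. \<bar>p - x\<bar> \<le> c powr (- (1 + \<epsilon>) * n)}"
  define \<delta> where "\<delta> n = c powr (- real n) / 4" for n :: nat
  have \<delta>: "0 < \<delta> n" "\<delta> n \<le> 1" for n
  proof -
    have "c powr (- real n) \<le> c powr 0" using c by (intro powr_mono) auto
    then show "0 < \<delta> n" "\<delta> n \<le> 1" using c by (simp_all add: \<delta>_def)
  qed
  have near: "\<exists>x\<in>K. \<bar>p - x\<bar> \<le> 4 * \<delta> n" if "p \<in> ?Q n" for p n
  proof -
    have "c powr (- (1 + \<epsilon>) * n) \<le> 4 * \<delta> n"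
      using c \<open>0 < \<epsilon>\<close> unfolding \<delta>_def by (simp add: algebra_simps)
    then show ?thesis using that by force
  qed
  have sep': "\<delta> n \<le> \<bar>p - q\<bar>" if "p \<in> ?Q n" "q \<in> ?Q n" "p \<noteq> q" for n p q
    unfolding \<delta>_def using that by (intro sep) auto
  note card = card_separated[OF \<delta> near sep']
  show "finite (?Q n)" for n by (rule card(1))
  show "0 \<le> s" by (rule s_nonneg)
  show "0 < c powr (- (1 + \<epsilon>) * n)" for n using c by simp
  have geo: "c powr (- (1 + \<epsilon>) * n) = (c powr (- (1 + \<epsilon>))) ^ n" for n :: nat
    using c by (simp add: powr_powr[symmetric] powr_realpow)
  have "c powr (- (1 + \<epsilon>)) < c powr 0" using c \<open>0 < \<epsilon>\<close> by (intro powr_less_mono) auto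
  then show "(\<lambda>n. c powr (- (1 + \<epsilon>) * real n)) \<longlonglongrightarrow> 0"
    unfolding geo using c by (intro LIMSEQ_power_zero) simp
  show "summable (\<lambda>n. real (card (?Q n)) * (2 * c powr (- (1 + \<epsilon>) * n)) powr s)"
  proof (rule summable_comparison_test')
    have "c powr (- (\<epsilon> * s)) < c powr 0" using c \<open>0 < \<epsilon>\<close> \<open>0 < s\<close> by (intro powr_less_mono) auto
    then have "norm (c powr (- (\<epsilon> * s))) < 1" using c by simp
    then show "summable (\<lambda>n. 10 * card W * 8 powr s * (c powr (- (\<epsilon> * s))) ^ n)"
      by (intro summable_mult summable_geometric)
    fix n :: nat
    define T where "T = real (card (?Q n)) * (2 * c powr (- (1 + \<epsilon>) * n)) powr s"
    have "T \<le> 10 * card W * \<delta> n powr (- s) * (2 * c powr (- (1 + \<epsilon>) * n)) powr s"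
      unfolding T_def by (rule mult_right_mono[OF card(2) powr_ge_zero])
    also have "\<delta> n powr (- s) = 4 powr s * c powr (n * s)"
    proof -
      have "\<delta> n = (4 * c powr real n) powr (- 1)"
        using c by (simp add: \<delta>_def powr_minus_divide)
      then have "\<delta> n powr (- s) = (4 * c powr real n) powr (- 1 * - s)" by (simp only: powr_powr)
      also have "- 1 * - s = s" by simp
      finally have "\<delta> n powr (- s) = (4 * c powr real n) powr s" .
      then show ?thesis by (simp add: powr_mult powr_powr)
    qed
    also have "(2 * c powr (- (1 + \<epsilon>) * n)) powr s = 2 powr s * c powr (- (1 + \<epsilon>) * n * s)"
      using c by (simp add: powr_mult powr_powr)
    also have "10 * card W * (4 powr s * c powr (n * s)) * (2 powr s * c powr (- (1 + \<epsilon>) * n * s))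
        = 10 * card W * (4 powr s * 2 powr s) * (c powr (n * s) * c powr (- (1 + \<epsilon>) * n * s))"
      by (simp only: mult_ac)
    also have "4 powr s * 2 powr s = (8::real) powr s" using powr_mult[of 4 2 s] by simp
    also have "c powr (n * s) * c powr (- (1 + \<epsilon>) * n * s) = c powr (- (\<epsilon> * s) * n)"
      by (simp add: powr_add[symmetric] algebra_simps)
    also have "\<dots> = (c powr (- (\<epsilon> * s))) ^ n" using c by (intro powr_mult_of_nat) simp
    finally have "T \<le> 10 * card W * 8 powr s * (c powr (- (\<epsilon> * s))) ^ n" .
    moreover have "0 \<le> T" by (simp add: T_def)
    ultimately show "norm (real (card (?Q n)) * (2 * c powr (- (1 + \<epsilon>) * n)) powr s)
        \<le> 10 * card W * 8 powr s * (c powr (- (\<epsilon> * s))) ^ n"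
      unfolding T_def[symmetric] by simp
  qed
  fix x m assume "x \<in> A"
  then show "\<exists>n\<ge>m. \<exists>p\<in>?Q n. dist p x \<le> c powr (- (1 + \<epsilon>) * n)"
    using cov[OF \<open>x \<in> A\<close>, of m] A by (auto simp: dist_real_def)
qed

lemma hausdorff_null_b_ary_approximable:
  assumes "0 < s" "0 < \<epsilon>"
  shows "hausdorff_measure s {\<xi> \<in> K. b_approximable b \<xi> (1 + \<epsilon>)} = 0"
proof (rule hausdorff_null_limsup_separated[OF assms, where c = b and P = "\<lambda>N. range (\<lambda>p::int. p / real b ^ N)"])
  show "1 < real b" using b2 by simp
  show "real b powr (- real n) / 4 \<le> \<bar>p - q\<bar>"
    if "p \<in> range (\<lambda>p::int. p / real b ^ n)" "q \<in> range (\<lambda>p::int. p / real b ^ n)" "p \<noteq> q" for n p q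
  proof -
    from that obtain i j :: int where ij: "p = i / real b ^ n" "q = j / real b ^ n" "i \<noteq> j" by auto
    then have "1 \<le> \<bar>real_of_int i - real_of_int j\<bar>" by linarith
    then have "1 / real b ^ n \<le> \<bar>p - q\<bar>"
      using b2 by (simp add: ij diff_divide_distrib[symmetric] divide_right_mono)
    moreover have "real b powr (- real n) = 1 / real b ^ n" using b2 by (simp add: powr_minus_divide powr_realpow)
    ultimately show ?thesis by (simp add: field_simps)
  qed
  fix x m assume "x \<in> {\<xi> \<in> K. b_approximable b \<xi> (1 + \<epsilon>)}"
  then have fr: "b_approximable b x (1 + \<epsilon>)"
    by blast
  obtain N and p :: int where N: "N \<ge> m" "\<bar>x - p / real b ^ N\<bar> \<le> (real b ^ N) powr (- (1 + \<epsilon>))"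
    using fr[unfolded frequently_sequentially, THEN spec, of m] by (elim exE conjE) (rule that)
  have "(real b ^ N) powr (- (1 + \<epsilon>)) = (real b powr real N) powr (- (1 + \<epsilon>))"
    using b2 by (simp add: powr_realpow)
  also have "\<dots> = real b powr (- (1 + \<epsilon>) * N)" by (simp only: powr_powr mult.commute)
  finally show "\<exists>n\<ge>m. \<exists>p\<in>range (\<lambda>p::int. p / real b ^ n). \<bar>p - x\<bar> \<le> real b powr (- (1 + \<epsilon>) * n)"
    using N by (intro exI[of _ N]) (auto simp: abs_minus_commute)
qed auto

text \<open>Distinct fractions with denominators below 2^(n+1) are at least 4^(-n)/4 apart, while an
  approximation of order 2 + 2 \<epsilon> with denominator at least 2^n is as close as 4^(-(1 +
  \<epsilon>) n).\<close>

lemma hausdorff_null_very_well_approximable: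
  assumes "0 < s" "0 < \<epsilon>"
  shows "hausdorff_measure s {\<xi> \<in> K. approximable \<xi> (2 + 2 * \<epsilon>)} = 0"
proof (rule hausdorff_null_limsup_separated[OF assms, where c = 4 and
      P = "\<lambda>n. {x. \<exists>(p::int) q::nat. 2 ^ n \<le> q \<and> q < 2 ^ Suc n \<and> x = p / real q}"])
  show "4 powr (- real n) / 4 \<le> \<bar>x - y\<bar>"
    if "x \<in> {x. \<exists>(p::int) q::nat. 2 ^ n \<le> q \<and> q < 2 ^ Suc n \<and> x = p / real q}"
      "y \<in> {x. \<exists>(p::int) q::nat. 2 ^ n \<le> q \<and> q < 2 ^ Suc n \<and> x = p / real q}" "x \<noteq> y" for n x y
  proof -
    from that obtain p p' :: int and q q' :: nat where q: "2 ^ n \<le> q" "q < 2 ^ Suc n" "x = p / real q"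
      "2 ^ n \<le> q'" "q' < 2 ^ Suc n" "y = p' / real q'" by (elim CollectE exE conjE) (rule that)
    have q0: "0 < q" "0 < q'" using q(1,4) by - (rule gr0I, simp)+
    have "1 / (real q * real q') \<le> \<bar>x - y\<bar>"
      using fraction_distance[OF q0, of p p'] that(3) q by simp
    moreover have "1 / (4 * 4 ^ n) \<le> 1 / (real q * real q')"
    proof (rule divide_left_mono)
      have "real q \<le> real (2 ^ Suc n)" "real q' \<le> real (2 ^ Suc n)"
        using q(2,5) by (simp_all only: of_nat_le_iff less_imp_le)
      then have "real q \<le> 2 ^ Suc n" "real q' \<le> 2 ^ Suc n" by (simp_all only: of_nat_power of_nat_numeral)
      then have "real q * real q' \<le> 2 ^ Suc n * 2 ^ Suc n" by (intro mult_mono) auto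
      also have "\<dots> = 4 * (2 * 2) ^ n" unfolding power_mult_distrib by simp
      finally show "real q * real q' \<le> 4 * 4 ^ n" by simp
    qed (use q0 in auto)
    moreover have "4 powr (- real n) / 4 = 1 / (4 * 4 ^ n)" by (simp add: powr_minus_divide powr_realpow)
    ultimately show ?thesis by simp
  qed
  fix x m assume "x \<in> {\<xi> \<in> K. approximable \<xi> (2 + 2 * \<epsilon>)}"
  then have fr: "approximable x (2 + 2 * \<epsilon>)"
    by blast
  obtain q and p :: int where q: "q \<ge> 2 ^ m" "\<bar>x - p / real q\<bar> \<le> real q powr (- (2 + 2 * \<epsilon>))"
    using fr[unfolded frequently_sequentially, THEN spec, of "2 ^ m"] by (elim exE conjE) (rule that)
  have "0 < q" using q(1) by (cases q) auto
  then have "\<exists>n. 2 ^ n \<le> q \<and> q < 2 ^ (n + 1)" by (intro ex_power_ivl1) auto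
  then obtain n where n: "2 ^ n \<le> q" "q < 2 ^ Suc n" by (elim exE conjE) (rule that, simp_all)
  have "2 ^ m < (2::nat) ^ Suc n" using q(1) n(2) by simp
  then have "m \<le> n" by (simp del: power_Suc)
  have "real (2 ^ n) \<le> real q" using n(1) by (simp only: of_nat_le_iff)
  then have "(2::real) powr n \<le> real q" by (simp add: powr_realpow)
  then have "real q powr (- (2 + 2 * \<epsilon>)) \<le> (2 powr n) powr (- (2 + 2 * \<epsilon>))"
    using assms(2) by (intro powr_mono2') auto
  also have "\<dots> = (2 powr 2) powr (- (1 + \<epsilon>) * n)" by (simp only: powr_powr) (simp add: algebra_simps)
  finally have "\<bar>p / real q - x\<bar> \<le> 4 powr (- (1 + \<epsilon>) * n)" using q(2) by (simp add: abs_minus_commute)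
  then show "\<exists>n\<ge>m. \<exists>y\<in>{x. \<exists>(p::int) q::nat. 2 ^ n \<le> q \<and> q < 2 ^ Suc n \<and> x = p / real q}.
      \<bar>y - x\<bar> \<le> 4 powr (- (1 + \<epsilon>) * n)"
    using n \<open>m \<le> n\<close> by (intro exI[of _ n]) blast
qed auto

text \<open>Disjoint balls of comparable radius have separated centres, so their number is bounded
  by counting near K. The dyadic size classes then form a geometric series with ratio 2^(s -
  t).\<close>

lemma packing_premeasure_null:
  assumes t: "s < t"
  shows "packing_premeasure t K = 0"
proof -
  define g where "g m = 10 * card W * 2 powr t * (2 powr (s - t)) ^ m" for m :: nat
  have g0: "0 \<le> g m" for m by (simp add: g_def)
  have "(2::real) powr (s - t) < 2 powr 0" using t by (intro powr_less_mono) auto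
  then have sg: "summable g" unfolding g_def by (intro summable_mult summable_geometric) simp
  have le: "packing_premeasure_at ((1/2) ^ m0) t K \<le> ennreal (\<Sum>m. g (m + m0))" for m0
    unfolding packing_premeasure_at_def
  proof (rule SUP_least)
    fix F :: "(real \<times> real) set"
    assume "F \<in> {F. finite F \<and> F \<subseteq> K \<times> {0<..(1/2) ^ m0} \<and> disjoint_family_on (\<lambda>(x, r). cball x r) F}"
    then have F: "finite F" "F \<subseteq> K \<times> {0<..(1/2) ^ m0}" "disjoint_family_on (\<lambda>(x, r). cball x r) F" by auto
    \<comment> \<open>In class m the radius is at most (1/2)^m and more than half of it. Radii up to
      (1/2)^m0 leave only classes from m0 on, so the total is a tail of the series.\<close>
    define lev where "lev z = nat \<lfloor>log 2 (1 / snd z)\<rfloor>" for z :: "real \<times> real"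
    have lev: "m0 \<le> lev z" "snd z \<le> (1/2) ^ lev z" "(1/2) ^ lev z < 2 * snd z" "fst z \<in> K" if "z \<in> F" for z
    proof -
      have z: "0 < snd z" "snd z \<le> (1/2) ^ m0" "fst z \<in> K" using subsetD[OF F(2) that] by (simp_all add: mem_Times_iff)
      show "fst z \<in> K" by (rule z(3))
      have "2 ^ m0 \<le> 1 / snd z" using z by (simp add: field_simps power_one_over)
      then have "log 2 (2 ^ m0) \<le> log 2 (1 / snd z)" using z(1) by (subst log_le_cancel_iff) auto
      then have l: "m0 \<le> log 2 (1 / snd z)" by (simp add: log_nat_power)
      then show "m0 \<le> lev z" unfolding lev_def by linarith
      have lz: "lev z \<le> log 2 (1 / snd z)" "log 2 (1 / snd z) < lev z + 1" using l unfolding lev_def by linarith+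
      have pw: "2 powr log 2 (1 / snd z) = 1 / snd z" using z(1) by simp
      have "2 powr lev z \<le> 2 powr log 2 (1 / snd z)" using lz(1) by (intro powr_mono) auto
      then show "snd z \<le> (1/2) ^ lev z" unfolding pw using z(1) by (simp add: powr_realpow field_simps power_one_over)
      have "2 powr log 2 (1 / snd z) < 2 powr (lev z + 1)" using lz(2) by (intro powr_less_mono) auto
      then show "(1/2) ^ lev z < 2 * snd z"
        unfolding pw using z(1) by (simp add: powr_add powr_realpow field_simps power_one_over)
    qed
    have level_sum: "(\<Sum>z\<in>{z \<in> F. lev z = m}. (2 * snd z) powr t) \<le> g m" for m
    proof -
      define Fm where "Fm = {z \<in> F. lev z = m}"
      \<comment> \<open>If the centres were closer, their midpoint would lie in both balls, since
        both radii exceed half of (1/2)^m.\<close>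
      have dist: "(1/2) ^ m \<le> \<bar>fst z - fst z'\<bar>" if "z \<in> Fm" "z' \<in> Fm" "z \<noteq> z'" for z z'
      proof (rule ccontr)
        assume C: "\<not> ?thesis"
        have zz: "z \<in> F" "z' \<in> F" "(1/2) ^ m < 2 * snd z" "(1/2) ^ m < 2 * snd z'"
          using that lev(3)[of z] lev(3)[of z'] by (auto simp: Fm_def)
        have "cball (fst z) (snd z) \<inter> cball (fst z') (snd z') = {}"
          using F(3) zz(1,2) that(3) unfolding disjoint_family_on_def by (force simp: split_beta)
        moreover have "(fst z + fst z') / 2 \<in> cball (fst z) (snd z) \<inter> cball (fst z') (snd z')"
        proof -
          have "\<bar>fst z - fst z'\<bar> < 2 * snd z" "\<bar>fst z - fst z'\<bar> < 2 * snd z'" using C zz(3,4) by linarith+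
          then show ?thesis by (simp only: Int_iff mem_cball dist_real_def abs_midpoint_le simp_thms)
        qed
        ultimately show False by blast
      qed
      have inj: "inj_on fst Fm"
      proof (rule inj_onI)
        fix z z' assume z: "z \<in> Fm" "z' \<in> Fm" "fst z = fst z'"
        show "z = z'"
        proof (rule ccontr)
          assume "z \<noteq> z'"
          from dist[OF z(1,2) this] z(3) have "(1/2) ^ m \<le> (0::real)" by simp
          moreover have "(0::real) < (1/2) ^ m" by simp
          ultimately show False by linarith
        qed
      qed
      have "real (card (fst ` Fm)) \<le> 10 * card W * ((1/2) ^ m) powr (- s)"
      proof (rule card_separated(2))
        show "((1::real)/2) ^ m \<le> 1" by (simp add: power_le_one)
        show "\<exists>x\<in>K. \<bar>p - x\<bar> \<le> 4 * (1/2) ^ m" if "p \<in> fst ` Fm" for p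
          using that lev(4) by (intro bexI[of _ p]) (auto simp: Fm_def)
        show "(1/2) ^ m \<le> \<bar>p - q\<bar>" if "p \<in> fst ` Fm" "q \<in> fst ` Fm" "p \<noteq> q" for p q
          using that dist by auto
      qed simp
      then have cardFm: "real (card Fm) \<le> 10 * card W * ((1/2) ^ m) powr (- s)"
        by (simp add: card_image[OF inj])
      have "(\<Sum>z\<in>Fm. (2 * snd z) powr t) \<le> (\<Sum>z\<in>Fm. (2 * (1/2) ^ m) powr t)"
      proof (rule sum_mono)
        fix z assume "z \<in> Fm"
        then have zF: "z \<in> F" and "lev z = m" by (simp_all add: Fm_def)
        then have "0 < snd z" "snd z \<le> (1/2) ^ m"
          using lev(2)[OF zF] subsetD[OF F(2) zF] by (simp_all add: mem_Times_iff)
        then show "(2 * snd z) powr t \<le> (2 * (1/2) ^ m) powr t"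
          using t s_nonneg by (intro powr_mono2) auto
      qed
      also have "\<dots> = card Fm * (2 * (1/2) ^ m) powr t" by simp
      also have "\<dots> \<le> 10 * card W * ((1/2) ^ m) powr (- s) * (2 * (1/2) ^ m) powr t"
        using cardFm by (intro mult_right_mono) auto
      also have "\<dots> = 10 * card W * 2 powr t * (((1/2) ^ m) powr (- s) * ((1/2) ^ m) powr t)"
        by (simp add: powr_mult)
      also have "((1/2::real) ^ m) powr (- s) * ((1/2) ^ m) powr t = (2 powr (s - t)) ^ m"
      proof -
        have h: "(1/2::real) ^ m = 2 powr (- real m)" by (simp add: powr_minus_divide powr_realpow power_one_over)
        have "(2::real) powr (- real m * - s) * 2 powr (- real m * t) = 2 powr ((s - t) * m)"
          by (simp add: powr_add[symmetric] algebra_simps)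
        then show ?thesis unfolding h powr_powr by (simp add: powr_powr[symmetric] powr_realpow)
      qed
      finally show ?thesis unfolding Fm_def g_def .
    qed
    have "(\<Sum>(x, r)\<in>F. ennreal ((2 * r) powr t)) = ennreal (\<Sum>z\<in>F. (2 * snd z) powr t)"
      by (simp add: split_beta sum_ennreal)
    also have "\<dots> \<le> ennreal (\<Sum>m. g (m + m0))"
    proof (rule ennreal_leI)
      have "(\<Sum>z\<in>F. (2 * snd z) powr t) = (\<Sum>m\<in>lev ` F. \<Sum>z\<in>{z \<in> F. lev z = m}. (2 * snd z) powr t)"
        by (rule sum.image_gen) (rule F(1))
      also have "\<dots> \<le> (\<Sum>m\<in>lev ` F. g m)" by (intro sum_mono level_sum)
      also have "\<dots> = (\<Sum>m\<in>(\<lambda>m. m - m0) ` lev ` F. g (m + m0))"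
        using lev(1) by (intro sum.reindex_bij_witness[of _ "\<lambda>m. m + m0" "\<lambda>m. m - m0"]) force+
      also have "\<dots> \<le> (\<Sum>m. g (m + m0))"
        using F(1) g0 summable_ignore_initial_segment[OF sg] by (intro sum_le_suminf) auto
      finally show "(\<Sum>z\<in>F. (2 * snd z) powr t) \<le> (\<Sum>m. g (m + m0))" .
    qed
    finally show "(\<Sum>(x, r)\<in>F. ennreal ((2 * r) powr t)) \<le> ennreal (\<Sum>m. g (m + m0))" .
  qed
  have "packing_premeasure t K \<le> 0"
  proof (rule ennreal_le_epsilon)
    fix e :: real assume "0 < e"
    obtain m0 where m0: "norm (\<Sum>m. g (m + m0)) < e"
      using suminf_exist_split[OF \<open>0 < e\<close> sg] by blast
    have "packing_premeasure t K \<le> packing_premeasure_at ((1/2) ^ m0) t K"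
      unfolding packing_premeasure_def by (rule INF_lower) simp
    also note le[of m0]
    also have "ennreal (\<Sum>m. g (m + m0)) \<le> ennreal e" using m0 by (intro ennreal_leI) simp
    finally show "packing_premeasure t K \<le> 0 + ennreal e" by simp
  qed
  then show ?thesis by simp
qed

end

subsection \<open>Positive Hausdorff measure\<close>

text \<open>Covering sets of diameter 0 receive positive numbers d i at an arbitrarily small cost in
  the sum. Later arguments need a positive scale for each covering set, to choose a digit level or a
  radius.\<close>

lemma hausdorff_null_cover:
  assumes "hausdorff_measure s A = 0" "0 < s" "0 < \<delta>" "0 < \<eta>"
  shows "\<exists>U d. A \<subseteq> (\<Union>i. U i) \<and> (\<forall>i::nat. bounded (U i) \<and> diameter (U i) \<le> d i \<and> 0 < d i \<and> d i \<le> \<delta>) \<and>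
    (\<Sum>i. ennreal (d i powr s)) \<le> ennreal \<eta>"
proof -
  have "hausdorff_premeasure \<delta> s A < ennreal (\<eta> / 2)"
    using hausdorff_measure_zeroD[OF assms(1,3)] \<open>0 < \<eta>\<close> by simp
  from hausdorff_premeasure_lessD[OF this] obtain U where U: "A \<subseteq> (\<Union>i. U i)"
      "\<forall>i. bounded (U i)" "\<forall>i. diameter (U i) \<le> \<delta>" "(\<Sum>i. diam_powr s (U i)) < ennreal (\<eta> / 2)"
    by (elim exE conjE) (rule that)
  note U = U(1) U(2,3)[rule_format] U(4)
  define e where "e i = (\<eta> / 2) * (1/2) ^ Suc i" for i :: nat
  have e0: "0 < e i" for i using \<open>0 < \<eta>\<close> by (simp add: e_def)
  \<comment> \<open>The s-th power of the substitute is at most e i, and the e i add up to half of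
    \<eta>.\<close>
  define d where "d i = (if 0 < diameter (U i) then diameter (U i) else min \<delta> (e i powr (1 / s)))" for i
  have d: "diameter (U i) \<le> d i" "0 < d i" "d i \<le> \<delta>" for i
  proof -
    have "0 < e i powr (1 / s)" using e0[of i] by simp
    moreover from this have "0 < diameter (U i) \<or> diameter (U i) \<le> e i powr (1 / s)" by linarith
    ultimately show "diameter (U i) \<le> d i" "0 < d i" "d i \<le> \<delta>"
      using U(3)[of i] \<open>0 < \<delta>\<close> by (auto simp: d_def min_def)
  qed
  have dp: "ennreal (d i powr s) \<le> diam_powr s (U i) + ennreal (e i)" for i
  proof (cases "0 < diameter (U i)")
    case True
    then have "U i \<noteq> {}" by auto
    then have "diam_powr s (U i) = ennreal (d i powr s)"
      using True \<open>0 < s\<close> by (simp add: diam_powr_def d_def)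
    then show ?thesis by simp
  next
    case False
    have "d i powr s \<le> (e i powr (1 / s)) powr s"
      using False d(2)[of i] \<open>0 < s\<close> by (intro powr_mono2) (simp_all add: d_def)
    also have "\<dots> = e i" using \<open>0 < s\<close> e0[of i] by (simp add: powr_powr)
    finally have "ennreal (d i powr s) \<le> ennreal (e i)" by (rule ennreal_leI)
    then show ?thesis by (simp add: add_increasing)
  qed
  have "e sums (\<eta> / 2)" unfolding e_def using sums_mult[OF power_half_series, of "\<eta> / 2"] by simp
  then have es: "(\<Sum>i. ennreal (e i)) = ennreal (\<eta> / 2)"
    using e0 \<open>0 < \<eta>\<close> by (intro sums_unique[symmetric] sums_ennreal[THEN iffD2]) (auto intro: less_imp_le)
  have "(\<Sum>i. ennreal (d i powr s)) \<le> (\<Sum>i. diam_powr s (U i) + ennreal (e i))"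
    by (intro suminf_le dp) auto
  also have "\<dots> = (\<Sum>i. diam_powr s (U i)) + ennreal (\<eta> / 2)"
    unfolding es[symmetric] by (intro suminf_add[symmetric]) auto
  also have "\<dots> \<le> ennreal (\<eta> / 2) + ennreal (\<eta> / 2)" using U(4) by (intro add_right_mono) simp
  also have "\<dots> = ennreal \<eta>" using \<open>0 < \<eta>\<close> by (simp flip: ennreal_plus)
  finally have "(\<Sum>i. ennreal (d i powr s)) \<le> ennreal \<eta>" .
  then show ?thesis using U(1,2) d by (intro exI[of _ U] exI[of _ d] conjI allI)
qed

text \<open>The floor at level n is the quotient by w of the floor at level n + 1, which is the
  recursion of the prefixes read backwards.\<close>

lemma digit_prefix_mod:
  assumes "\<And>i. a i = nat \<lfloor>y * real w ^ Suc i\<rfloor> mod w" "0 \<le> y" "y < 1" "0 < w"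
  shows "digit_prefix w a n = nat \<lfloor>y * real w ^ n\<rfloor>"
proof (induction n)
  case 0
  then show ?case using assms(2,3) by (simp add: floor_eq_iff)
next
  case (Suc n)
  have "\<lfloor>y * real w ^ n\<rfloor> = \<lfloor>y * real w ^ Suc n\<rfloor> div int w"
  proof -
    have "\<lfloor>y * real w ^ Suc n / real w\<rfloor> = \<lfloor>y * real w ^ Suc n\<rfloor> div int w"
      using floor_divide_real_eq_div[of "int w" "y * real w ^ Suc n"] by simp
    then show ?thesis using \<open>0 < w\<close> by simp
  qed
  then have "nat \<lfloor>y * real w ^ n\<rfloor> = nat \<lfloor>y * real w ^ Suc n\<rfloor> div w"
    by (simp add: nat_div_distrib' assms(2))
  then show ?case using Suc assms(1)[of n] by simp
qed

lemma digit_prefix_inj: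
  assumes "\<And>i. a i < b" "\<And>i. a' i < b" "digit_prefix b a n = digit_prefix b a' n" "i < n"
  shows "a i = a' i"
  using assms(3,4)
proof (induction n)
  case (Suc n)
  have b: "0 < b" using assms(1)[of 0] by simp
  have "digit_prefix b a (Suc n) mod b = digit_prefix b a' (Suc n) mod b"
    "digit_prefix b a (Suc n) div b = digit_prefix b a' (Suc n) div b" using Suc.prems(1) by simp_all
  then have "a n = a' n" "digit_prefix b a n = digit_prefix b a' n"
    using assms(1)[of n] assms(2)[of n] b by simp_all
  then show ?case using Suc by (cases "i = n") auto
qed simp

context digit_cantor_set
begin

text \<open>Replacing the digits in W by the digits below card W maps K onto the unit interval; as this multiplies
  s-dimensional content by at most a constant, Lebesgue measure bounds the measure of K from below.\<close>

lemma hausdorff_positive: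
  assumes W2: "2 \<le> card W"
  shows "hausdorff_measure s K \<noteq> 0"
proof
  assume null: "hausdorff_measure s K = 0"
  define w where "w = card W"
  have w2: "2 \<le> w" using W2 by (simp add: w_def)
  have s0: "0 < s" using b2 W2 by (simp add: s_def)
  obtain f where f: "bij_betw f {..<w} W"
    using ex_bij_betw_nat_finite[OF finite_W] by (auto simp: atLeast0LessThan w_def)
  \<comment> \<open>The map is built in the direction from [0, 1) to K: base-w digits of y are
    replaced by elements of W. The first n digits assigned to y determine the interval of length
    w^(-n) containing y.\<close>
  define c where "c y i = nat \<lfloor>y * real w ^ Suc i\<rfloor> mod w" for y :: real and i
  define a where "a y i = f (c y i)" for y :: real and i
  have cw: "c y i < w" for y i using w2 by (simp add: c_def)
  have aW: "a y i \<in> W" for y i using bij_betwE[OF f] cw by (simp add: a_def)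
  have ab: "a y i < b" for y i by (rule digits_less) (rule aW)
  define x where "x y = digit_value b (a y)" for y :: real
  have xK: "x y \<in> K" for y using aW by (auto simp: x_def K_def missing_digit_set_eq)
  have pref: "digit_prefix w (c y) n = nat \<lfloor>y * real w ^ n\<rfloor>" if "y \<in> {0..<1}" for y n
    using that w2 by (intro digit_prefix_mod) (auto simp: c_def)
  have same: "nat \<lfloor>y * real w ^ n\<rfloor> = nat \<lfloor>y' * real w ^ n\<rfloor>"
    if y: "y \<in> {0..<1}" "y' \<in> {0..<1}" and eq: "digit_prefix b (a y) n = digit_prefix b (a y') n" for y y' n
  proof -
    have "c y i = c y' i" if "i < n" for i
    proof -
      have "a y i = a y' i" by (rule digit_prefix_inj[OF ab ab eq that])
      then show ?thesis using bij_betw_imp_inj_on[OF f] cw unfolding a_def by (auto dest: inj_onD)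
    qed
    then have "digit_prefix w (c y) n = digit_prefix w (c y') n" by (rule digit_prefix_cong)
    then show ?thesis using pref y by simp
  qed
  \<comment> \<open>A set of diameter about b^(-n) involves few prefixes of length n, hence few
    intervals of length w^(-n), and b^s = w makes their total length of order d^s. The measurable
    superset J avoids the question whether the set of these y is measurable.\<close>
  have cover: "\<exists>J. J \<in> sets lborel \<and> {y \<in> {0..<1}. x y \<in> U} \<subseteq> J \<and> emeasure lborel J \<le> ennreal (5 * w * d powr s)"
    if U: "bounded U" "diameter U \<le> d" "0 < d" "d \<le> 1" for U d
  proof (cases "\<exists>y0\<in>{0..<1}. x y0 \<in> U")
    case False
    then show ?thesis by (intro exI[of _ "{}"]) auto
  next
    case True
    then obtain y0 where y0: "y0 \<in> {0..<1}" "x y0 \<in> U" by blast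
    define n where "n = nat \<lfloor>log b (1 / d)\<rfloor>"
    have b1: "1 < real b" using b2 by simp
    have l0: "0 \<le> log b (1 / d)" using U b1 by simp
    then have n: "n \<le> log b (1 / d)" "log b (1 / d) < n + 1" unfolding n_def by linarith+
    have dl: "real b powr log b (1 / d) = 1 / d" using U(3) b1 by simp
    have "real b powr n \<le> real b powr log b (1 / d)" using n(1) b1 by (intro powr_mono) auto
    then have dn: "real b ^ n * d \<le> 1" using b1 U(3) unfolding dl by (simp add: powr_realpow field_simps)
    have "(real b powr log b (1 / d)) powr s \<le> (real b powr (n + 1)) powr s"
      using n(2) b1 s0 by (intro powr_mono2 powr_mono) auto
    then have "(1 / d) powr s \<le> (real b powr (n + 1)) powr s" by (simp only: dl)
    also have "\<dots> = (real b powr s) powr real (Suc n)" by (simp add: powr_powr mult.commute)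
    also have "\<dots> = real w ^ Suc n" using w2 by (simp only: b_powr_s w_def[symmetric] powr_realpow)
    finally have wn: "1 / real w ^ n \<le> w * d powr s"
      using U(3) w2 by (simp add: powr_divide field_simps)
    define v0 where "v0 = int (digit_prefix b (a y0) n)"
    \<comment> \<open>Multiplied by b^n, points of U differ by at most 1, and each exceeds its
      prefix by at most 1; so two prefixes differ by at most 2.\<close>
    define V where "V = {v0 - 2..v0 + 2}"
    \<comment> \<open>For every prefix that occurs one representative y is chosen; by
      \<open>same\<close> all other y with this prefix lie in the same interval.\<close>
    define J where "J = (\<Union>v\<in>V. if \<exists>y\<in>{0..<1}. int (digit_prefix b (a y) n) = v
       then (let k = nat \<lfloor>(SOME y. y \<in> {0..<1} \<and> int (digit_prefix b (a y) n) = v) * real w ^ n\<rfloor>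
             in {real k / real w ^ n..(real k + 1) / real w ^ n}) else {})"
    show ?thesis
    proof (intro exI[of _ J] conjI)
      show "J \<in> sets lborel" unfolding J_def V_def Let_def by (intro sets.finite_UN) auto
      show "{y \<in> {0..<1}. x y \<in> U} \<subseteq> J"
      proof
        fix y assume "y \<in> {y \<in> {0..<1}. x y \<in> U}"
        then have y: "y \<in> {0..<1}" "x y \<in> U" by auto
        define v where "v = int (digit_prefix b (a y) n)"
        have "\<bar>x y - x y0\<bar> \<le> d"
          using diameter_bounded_bound[OF U(1) y(2) y0(2)] U(2) by (simp add: dist_real_def)
        then have "real b ^ n * \<bar>x y - x y0\<bar> \<le> real b ^ n * d" using b1 by (intro mult_left_mono) auto
        then have 1: "real b ^ n * \<bar>x y - x y0\<bar> \<le> 1" using dn by simp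
        have 2: "\<bar>real b ^ n * x y' - real (digit_prefix b (a y') n) - 1/2\<bar> \<le> 1/2" for y'
        proof -
          have bn: "0 < real b ^ n" using b1 by simp
          have "real (digit_prefix b (a y') n) \<le> real b ^ n * x y'"
            using digit_value_ge_prefix[where a = "a y'" and n = n, OF b2 ab] bn
            by (simp add: x_def pos_divide_le_eq mult.commute)
          moreover have "x y' \<le> (real (digit_prefix b (a y') n) + 1) / real b ^ n"
            using digit_value_le_prefix[where a = "a y'" and n = n, OF b2 ab]
            by (simp add: x_def add_divide_distrib)
          then have "real b ^ n * x y' \<le> real (digit_prefix b (a y') n) + 1"
            using bn by (simp add: pos_le_divide_eq mult.commute)
          ultimately show ?thesis by linarith
        qed
        have "\<bar>real b ^ n * x y - real b ^ n * x y0\<bar> \<le> 1"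
          using 1 b1 by (simp add: abs_mult right_diff_distrib[symmetric])
        then have "\<bar>real_of_int v - real_of_int v0\<bar> \<le> 2"
          using 2[of y] 2[of y0] unfolding v_def v0_def of_int_of_nat_eq by linarith
        then have vV: "v \<in> V" unfolding V_def atLeastAtMost_iff by linarith
        have ex: "\<exists>y\<in>{0..<1}. int (digit_prefix b (a y) n) = v" using y(1) v_def by blast
        define z where "z = (SOME y. y \<in> {0..<1} \<and> int (digit_prefix b (a y) n) = v)"
        have z: "z \<in> {0..<1}" "int (digit_prefix b (a z) n) = v"
          using someI_ex[of "\<lambda>y. y \<in> {0..<1} \<and> int (digit_prefix b (a y) n) = v"] ex
          unfolding z_def[symmetric] by blast+
        have k: "nat \<lfloor>z * real w ^ n\<rfloor> = nat \<lfloor>y * real w ^ n\<rfloor>"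
          using z y(1) by (intro same) (simp_all add: v_def)
        have wn0: "0 < real w ^ n" using w2 by simp
        have "0 \<le> y * real w ^ n" using y(1) wn0 by simp
        then have "real (nat \<lfloor>y * real w ^ n\<rfloor>) \<le> y * real w ^ n" "y * real w ^ n \<le> real (nat \<lfloor>y * real w ^ n\<rfloor>) + 1"
          by linarith+
        then have "y \<in> {real (nat \<lfloor>z * real w ^ n\<rfloor>) / real w ^ n..(real (nat \<lfloor>z * real w ^ n\<rfloor>) + 1) / real w ^ n}"
          unfolding k using wn0 by (simp add: pos_divide_le_eq pos_le_divide_eq)
        then show "y \<in> J" unfolding J_def Let_def using vV ex by (intro UN_I[OF vV]) (simp add: z_def)
      qed
      have "emeasure lborel J \<le> (\<Sum>v\<in>V. ennreal (1 / real w ^ n))"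
        unfolding J_def
      proof (rule order_trans[OF emeasure_subadditive_finite sum_mono])
        show "finite V" by (simp add: V_def)
      next
        fix v
        show "emeasure lborel (if \<exists>y\<in>{0..<1}. int (digit_prefix b (a y) n) = v
          then let k = nat \<lfloor>(SOME y. y \<in> {0..<1} \<and> int (digit_prefix b (a y) n) = v) * real w ^ n\<rfloor>
             in {real k / real w ^ n..(real k + 1) / real w ^ n} else {}) \<le> ennreal (1 / real w ^ n)"
          using w2 by (auto simp: Let_def divide_right_mono diff_divide_distrib[symmetric])
      qed (auto simp: Let_def)
      also have "\<dots> = ennreal (5 * (1 / real w ^ n))"
      proof -
        have "(\<Sum>v\<in>V. ennreal (1 / real w ^ n)) = ennreal (\<Sum>v\<in>V. 1 / real w ^ n)"
          by (rule sum_ennreal) simp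
        also have "(\<Sum>v\<in>V. 1 / real w ^ n) = 5 * (1 / real w ^ n)" by (simp add: V_def)
        finally show ?thesis .
      qed
      also have "\<dots> \<le> ennreal (5 * w * d powr s)" using wn by (intro ennreal_leI) simp
      finally show "emeasure lborel J \<le> ennreal (5 * w * d powr s)" .
    qed
  qed
  \<comment> \<open>With this total the bounds 5 w d^s add up to at most 1/2, less than the length
    of [0, 1).\<close>
  have "0 < 1 / (10 * real w)" using w2 by simp
  from hausdorff_null_cover[OF null s0 zero_less_one this]
  obtain U d where U: "K \<subseteq> (\<Union>i. U i)"
      "\<forall>i::nat. bounded (U i) \<and> diameter (U i) \<le> d i \<and> 0 < d i \<and> d i \<le> 1"
      "(\<Sum>i. ennreal (d i powr s)) \<le> ennreal (1 / (10 * real w))"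
    by (elim exE conjE) (rule that)
  have "\<forall>i. \<exists>J. J \<in> sets lborel \<and> {y \<in> {0..<1}. x y \<in> U i} \<subseteq> J \<and>
      emeasure lborel J \<le> ennreal (5 * w * d i powr s)"
    using U(2) cover by simp
  from choice[OF this] obtain J where J: "\<forall>i. J i \<in> sets lborel \<and> {y \<in> {0..<1}. x y \<in> U i} \<subseteq> J i \<and>
      emeasure lborel (J i) \<le> ennreal (5 * w * d i powr s)" by (rule exE)
  have sub: "{0..<1} \<subseteq> (\<Union>i. J i)"
  proof
    fix y :: real assume y: "y \<in> {0..<1}"
    from xK[of y] U(1) have "x y \<in> (\<Union>i. U i)" by (rule subsetD[rotated])
    then obtain i where "x y \<in> U i" by (rule UN_E)
    then have "y \<in> J i" using J y by blast
    then show "y \<in> (\<Union>i. J i)" by (rule UN_I[OF UNIV_I])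
  qed
  have "emeasure lborel {0..<1::real} \<le> emeasure lborel (\<Union>i. J i)"
    using sub J by (intro emeasure_mono sets.countable_UN) auto
  also have "\<dots> \<le> (\<Sum>i. emeasure lborel (J i))"
    using J by (intro emeasure_subadditive_countably) auto
  also have "\<dots> \<le> (\<Sum>i. ennreal (5 * w) * ennreal (d i powr s))"
    using J by (intro suminf_le) (auto simp: ennreal_mult[symmetric])
  also have "\<dots> = ennreal (5 * w) * (\<Sum>i. ennreal (d i powr s))" by simp
  also have "\<dots> \<le> ennreal (5 * w) * ennreal (1 / (10 * real w))" using U(3) by (intro mult_left_mono) auto
  also have "\<dots> = ennreal (1/2)" using w2 by (simp add: ennreal_mult[symmetric])
  finally have "ennreal 1 \<le> ennreal (1/2)" by simp
  then show False by (subst (asm) ennreal_le_iff) auto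
qed

end

subsection \<open>Packing measure and sumsets\<close>

lemma packing_measure_mono:
  assumes "A \<subseteq> B"
  shows "packing_measure t A \<le> packing_measure t B"
  unfolding packing_measure_def using assms by (intro INF_superset_mono) auto

text \<open>Balls of radius d/2 around separated points form a packing, each contributing d^u, and a
  largest separated set is a net. So a finite premeasure bounds the covering numbers at every small
  scale with one constant M.\<close>

lemma packing_premeasure_cover:
  fixes U :: "real set"
  assumes "packing_premeasure u U < top"
  shows "\<exists>\<delta>>0. \<exists>M\<ge>0. \<forall>d. 0 < d \<longrightarrow> d \<le> \<delta> \<longrightarrow>
    (\<exists>F. finite F \<and> U \<subseteq> (\<Union>x\<in>F. cball x d) \<and> real (card F) * d powr u \<le> M)"
proof -
  from assms obtain \<delta> where \<delta>: "\<delta> > 0" "packing_premeasure_at \<delta> u U < top"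
    unfolding packing_premeasure_def INF_less_iff by auto
  define M where "M = enn2real (packing_premeasure_at \<delta> u U)"
  have M: "packing_premeasure_at \<delta> u U = ennreal M" using \<delta>(2) by (simp add: M_def)
  have M0: "0 \<le> M" by (simp add: M_def)
  have "\<exists>F. finite F \<and> U \<subseteq> (\<Union>x\<in>F. cball x d) \<and> real (card F) * d powr u \<le> M"
    if d: "0 < d" "d \<le> \<delta>" for d
  proof -
    \<comment> \<open>The separation is strict so that the closed balls of radius d/2 are
      disjoint.\<close>
    define S where "S F \<longleftrightarrow> finite F \<and> F \<subseteq> U \<and> (\<forall>x\<in>F. \<forall>y\<in>F. x \<noteq> y \<longrightarrow> d < \<bar>x - y\<bar>)" for F
    have card: "real (card F) * d powr u \<le> M" if "S F" for F
    proof -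
      have F: "finite F" "F \<subseteq> U" "\<And>x y. x \<in> F \<Longrightarrow> y \<in> F \<Longrightarrow> x \<noteq> y \<Longrightarrow> d < \<bar>x - y\<bar>"
        using that by (auto simp: S_def)
      define P where "P = F \<times> {d / 2}"
      have "disjoint_family_on (\<lambda>(x, r). cball x r) P"
        unfolding disjoint_family_on_def
      proof (intro ballI impI)
        fix z z' assume z: "z \<in> P" "z' \<in> P" "z \<noteq> z'"
        then obtain x y where xy: "z = (x, d / 2)" "z' = (y, d / 2)" "x \<in> F" "y \<in> F" "x \<noteq> y"
          by (auto simp: P_def)
        have "d < dist x y" using F(3)[OF xy(3-5)] by (simp add: dist_real_def)
        then have "cball x (d / 2) \<inter> cball y (d / 2) = {}" by (intro disjoint_cballI) simp
        then show "(case z of (x, r) \<Rightarrow> cball x r) \<inter> (case z' of (x, r) \<Rightarrow> cball x r) = {}"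
          by (simp add: xy(1,2))
      qed
      then have "P \<in> {F. finite F \<and> F \<subseteq> U \<times> {0<..\<delta>} \<and> disjoint_family_on (\<lambda>(x, r). cball x r) F}"
        using F(1,2) d by (auto simp: P_def)
      then have "(\<Sum>(x, r)\<in>P. ennreal ((2 * r) powr u)) \<le> packing_premeasure_at \<delta> u U"
        unfolding packing_premeasure_at_def by (rule SUP_upper)
      also have "(\<Sum>(x, r)\<in>P. ennreal ((2 * r) powr u)) = (\<Sum>z\<in>P. ennreal (d powr u))"
        by (intro sum.cong) (auto simp: P_def)
      also have "\<dots> = ennreal (\<Sum>z\<in>P. d powr u)" by (rule sum_ennreal) simp
      also have "(\<Sum>z\<in>P. d powr u) = real (card F) * d powr u"
        by (simp add: P_def card_cartesian_product)
      finally show ?thesis using M0 by (simp add: M)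
    qed
    have dp: "0 < d powr u" using d by simp
    have bound: "card F < nat \<lceil>M / d powr u\<rceil> + 1" if "S F" for F
    proof -
      have "real (card F) \<le> M / d powr u" using card[OF that] dp by (simp add: pos_le_divide_eq)
      then show ?thesis by linarith
    qed
    have "S {}" by (simp add: S_def)
    from ex_has_greatest_nat[of S, OF this, of card] bound
    obtain F where F: "S F" "\<And>F'. S F' \<Longrightarrow> card F' \<le> card F" by blast
    have "U \<subseteq> (\<Union>x\<in>F. cball x d)"
    proof
      fix y assume y: "y \<in> U"
      show "y \<in> (\<Union>x\<in>F. cball x d)"
      proof (rule ccontr)
        assume C: "\<not> ?thesis"
        then have far: "d < \<bar>x - y\<bar>" if "x \<in> F" for x using that by (force simp: dist_real_def)
        then have "y \<notin> F" using d(1) by force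
        have "S (insert y F)"
          using F(1) y far by (auto simp: S_def abs_minus_commute)
        from F(2)[OF this] show False using F(1) \<open>y \<notin> F\<close> by (simp add: S_def)
      qed
    qed
    then show ?thesis using F(1) card[OF F(1)] by (intro exI[of _ F]) (simp add: S_def)
  qed
  then show ?thesis using \<delta>(1) M0 by blast
qed

text \<open>Cover A by small intervals and, for each of their lengths d, cover B by the balls of radius d around
  a maximal packing by balls of radius d/2.\<close>

lemma hausdorff_null_sumset:
  fixes A B :: "real set"
  assumes A: "hausdorff_measure t A = 0" and B: "packing_measure u B = 0" and tu: "0 < t" "0 \<le> u"
  shows "hausdorff_measure (t + u) (A + B) = 0"
proof -
  have "packing_measure u B < 1" using B by simp
  then obtain U where U: "B \<subseteq> (\<Union>i. U i)" "(\<Sum>i. packing_premeasure u (U i :: real set)) < 1"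
    unfolding packing_measure_def INF_less_iff by auto
  \<comment> \<open>From the null cover only the finiteness of each premeasure is extracted;
    smallness will come from A alone.\<close>
  have fin: "packing_premeasure u (U i) < top" for i
    using ennreal_suminf_lessD[OF U(2), of i] by (rule less_le_trans) simp
  have "hausdorff_measure (t + u) (A + U i) = 0" for i
  proof (rule hausdorff_measure_zeroI)
    fix \<delta> e :: real assume \<delta>: "0 < \<delta>" and e: "0 < e"
    from packing_premeasure_cover[OF fin[of i]] obtain \<delta>0 M where \<delta>0: "0 < \<delta>0" and M: "0 \<le> M"
      and cov: "\<forall>d. 0 < d \<longrightarrow> d \<le> \<delta>0 \<longrightarrow>
        (\<exists>F. finite F \<and> U i \<subseteq> (\<Union>x\<in>F. cball x d) \<and> real (card F) * d powr u \<le> M)"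
      by (elim exE conjE) (rule that)
    \<comment> \<open>The factor 3 comes from the diameter 3 d of a set of diameter d plus a ball of
      radius d; the summand 1 keeps M' positive when M = 0.\<close>
    define M' where "M' = M * 3 powr (t + u) + 1"
    have M': "0 < M'" using M by (simp add: M'_def add_nonneg_pos)
    have "0 < min \<delta>0 (\<delta> / 3)" "0 < e / M'" using \<delta> \<delta>0 e M' by auto
    from hausdorff_null_cover[OF A tu(1) this] obtain V d where V: "A \<subseteq> (\<Union>j. V j)"
      "\<forall>j::nat. bounded (V j) \<and> diameter (V j) \<le> d j \<and> 0 < d j \<and> d j \<le> min \<delta>0 (\<delta> / 3)"
      "(\<Sum>j. ennreal (d j powr t)) \<le> ennreal (e / M')"
      by (elim exE conjE) (rule that)
    \<comment> \<open>Each V j needs a cover of U i at its own scale d j; at most M d^(-u) balls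
      suffice there, whatever the scale is.\<close>
    have piece: "hausdorff_premeasure \<delta> (t + u) (V j + U i) \<le> ennreal (M' * d j powr t)" for j
    proof -
      have dj: "bounded (V j)" "diameter (V j) \<le> d j" "0 < d j" "d j \<le> \<delta>0" "3 * d j \<le> \<delta>"
        using V(2)[THEN spec, of j] by simp_all
      obtain F where F: "finite F" "U i \<subseteq> (\<Union>x\<in>F. cball x (d j))" "real (card F) * d j powr u \<le> M"
        using cov dj(3,4) by blast
      have dist: "dist z z' \<le> 3 * d j" if z: "z \<in> V j + cball x (d j)" "z' \<in> V j + cball x (d j)" for x z z'
      proof -
        from z obtain v c v' c' where vc: "z = v + c" "z' = v' + c'" "v \<in> V j" "v' \<in> V j"
          "c \<in> cball x (d j)" "c' \<in> cball x (d j)" by (auto elim!: set_plus_elim)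
        have "dist v v' \<le> d j" using diameter_bounded_bound[OF dj(1) vc(3,4)] dj(2) by simp
        moreover have "dist x c \<le> d j" "dist x c' \<le> d j" using vc(5,6) by simp_all
        ultimately show ?thesis unfolding vc(1,2) dist_real_def by linarith
      qed
      have "hausdorff_premeasure \<delta> (t + u) (V j + U i) \<le> ennreal (real (card F) * (3 * d j) powr (t + u))"
      proof (rule hausdorff_premeasure_finite_cover[OF F(1)])
        show "V j + U i \<subseteq> (\<Union>x\<in>F. V j + cball x (d j))"
        proof
          fix z assume "z \<in> V j + U i"
          then obtain v c where vc: "z = v + c" "v \<in> V j" "c \<in> U i" by (rule set_plus_elim)
          from vc(3) F(2) have "c \<in> (\<Union>x\<in>F. cball x (d j))" by (rule subsetD[rotated])
          then obtain x where x: "x \<in> F" "c \<in> cball x (d j)" by (rule UN_E)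
          have "z \<in> V j + cball x (d j)" unfolding vc(1) by (rule set_plus_intro[OF vc(2) x(2)])
          with x(1) show "z \<in> (\<Union>x\<in>F. V j + cball x (d j))" by (rule UN_I)
        qed
        show "bounded (V j + cball x (d j))" for x unfolding bounded_two_points using dist by blast
        show "diameter (V j + cball x (d j)) \<le> 3 * d j" for x
          using dist dj(3) by (intro diameter_leI) auto
      qed (use dj tu in auto)
      also have "\<dots> \<le> ennreal (M' * d j powr t)"
      proof (rule ennreal_leI)
        have "real (card F) * (3 * d j) powr (t + u) = 3 powr (t + u) * d j powr t * (real (card F) * d j powr u)"
          using dj(3) by (simp add: powr_mult powr_add)
        also have "\<dots> \<le> 3 powr (t + u) * d j powr t * M" using F(3) by (intro mult_left_mono) auto
        also have "\<dots> = (M * 3 powr (t + u)) * d j powr t" by simp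
        also have "\<dots> \<le> M' * d j powr t" by (intro mult_right_mono) (auto simp: M'_def)
        finally show "real (card F) * (3 * d j) powr (t + u) \<le> M' * d j powr t" .
      qed
      finally show ?thesis .
    qed
    have "A + U i \<subseteq> (\<Union>j. V j + U i)"
    proof
      fix z assume "z \<in> A + U i"
      then obtain v c where vc: "z = v + c" "v \<in> A" "c \<in> U i" by (rule set_plus_elim)
      from vc(2) V(1) have "v \<in> (\<Union>j. V j)" by (rule subsetD[rotated])
      then obtain j where "v \<in> V j" by (rule UN_E)
      then have "z \<in> V j + U i" using vc(1,3) by (auto intro: set_plus_intro)
      then show "z \<in> (\<Union>j. V j + U i)" by (rule UN_I[OF UNIV_I])
    qed
    then have "hausdorff_premeasure \<delta> (t + u) (A + U i) \<le> hausdorff_premeasure \<delta> (t + u) (\<Union>j. V j + U i)"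
      by (rule hausdorff_premeasure_mono)
    also have "\<dots> \<le> (\<Sum>j. hausdorff_premeasure \<delta> (t + u) (V j + U i))" by (rule hausdorff_premeasure_UN)
    also have "\<dots> \<le> (\<Sum>j. ennreal M' * ennreal (d j powr t))"
      using piece M' by (intro suminf_le) (auto simp: ennreal_mult[symmetric])
    also have "\<dots> = ennreal M' * (\<Sum>j. ennreal (d j powr t))" by simp
    also have "\<dots> \<le> ennreal M' * ennreal (e / M')" using V(3) by (intro mult_left_mono) auto
    also have "\<dots> = ennreal e" using M' e by (simp add: ennreal_mult[symmetric])
    finally show "hausdorff_premeasure \<delta> (t + u) (A + U i) \<le> ennreal e" .
  qed
  then have "hausdorff_measure (t + u) (\<Union>i. A + U i) = 0" by (rule hausdorff_null_UN)
  moreover have "A + B \<subseteq> (\<Union>i. A + U i)"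
  proof
    fix z assume "z \<in> A + B"
    then obtain v c where vc: "z = v + c" "v \<in> A" "c \<in> B" by (rule set_plus_elim)
    from vc(3) U(1) have "c \<in> (\<Union>i. U i)" by (rule subsetD[rotated])
    then obtain i where "c \<in> U i" by (rule UN_E)
    then have "z \<in> A + U i" using vc(1,2) by (auto intro: set_plus_intro)
    then show "z \<in> (\<Union>i. A + U i)" by (rule UN_I[OF UNIV_I])
  qed
  ultimately show ?thesis by (rule hausdorff_null_subset)
qed

text \<open>The upper bound 2/\<tau> of the Jarnik-Besicovitch theorem: of order q fractions of
  denominator q, with balls of radius q^(-\<mu>), lead to the sum of q^(1 - \<mu> t), which
  converges for \<mu> t > 2.\<close>

lemma hausdorff_null_exact_exponent_set:
  assumes \<tau>: "1 < \<tau>" "2 < \<tau> * t" and t: "0 < t"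
  shows "hausdorff_measure t (exact_exponent_set \<tau> \<inter> {0..1}) = 0"
proof -
  \<comment> \<open>A value below \<tau>, so that infinitely many denominators approximate to this
    order, and still with \<mu> t > 2.\<close>
  define \<mu> where "\<mu> = (\<tau> + max 1 (2 / t)) / 2"
  have "2 / t < \<tau>" using \<tau>(2) t by (simp add: field_simps)
  then have \<mu>: "1 < \<mu>" "2 / t < \<mu>" "\<mu> < \<tau>" using \<tau>(1) by (auto simp: \<mu>_def max_def)
  then have \<mu>t: "2 < \<mu> * t" using t by (simp add: field_simps)
  show ?thesis
  proof (rule hausdorff_null_limsup[where r = "\<lambda>n. real (Suc n) powr (- \<mu>)" and
        P = "\<lambda>n. (\<lambda>p. real_of_int p / real (Suc n)) ` {- int (Suc n)..2 * int (Suc n)}"])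
    let ?P = "\<lambda>n. (\<lambda>p. real_of_int p / real (Suc n)) ` {- int (Suc n)..2 * int (Suc n)}"
    show "0 \<le> t" using t by simp
    show "(\<lambda>n. real (Suc n) powr (- \<mu>)) \<longlonglongrightarrow> 0"
      using \<mu>(1) by (intro tendsto_neg_powr filterlim_compose[OF filterlim_real_sequentially filterlim_Suc]) auto
    show "summable (\<lambda>n. real (card (?P n)) * (2 * real (Suc n) powr (- \<mu>)) powr t)"
    proof (rule summable_comparison_test')
      have "summable (\<lambda>n. real n powr (1 - \<mu> * t))" using \<mu>t by (subst summable_real_powr_iff) simp
      then have "summable (\<lambda>n. real (Suc n) powr (1 - \<mu> * t))" by (subst summable_Suc_iff)
      then show "summable (\<lambda>n. 4 * 2 powr t * real (Suc n) powr (1 - \<mu> * t))" by (rule summable_mult)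
      fix n :: nat
      have "card (?P n) \<le> card {- int (Suc n)..2 * int (Suc n)}" by (rule card_image_le) simp
      also have "\<dots> \<le> 4 * Suc n" by simp
      finally have "real (card (?P n)) \<le> real (4 * Suc n)" by (simp only: of_nat_le_iff)
      then have "real (card (?P n)) * (2 * real (Suc n) powr (- \<mu>)) powr t
          \<le> real (4 * Suc n) * (2 * real (Suc n) powr (- \<mu>)) powr t"
        by (rule mult_right_mono) simp
      also have "\<dots> = 4 * 2 powr t * (real (Suc n) * real (Suc n) powr (- \<mu> * t))"
        by (simp only: powr_mult powr_powr of_nat_mult mult_ac of_nat_numeral)
      also have "real (Suc n) * real (Suc n) powr (- \<mu> * t) = real (Suc n) powr 1 * real (Suc n) powr (- \<mu> * t)"
        by simp
      also have "\<dots> = real (Suc n) powr (1 - \<mu> * t)" by (simp only: powr_add[symmetric]) simp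
      finally show "norm (real (card (?P n)) * (2 * real (Suc n) powr (- \<mu>)) powr t)
          \<le> 4 * 2 powr t * real (Suc n) powr (1 - \<mu> * t)" by simp
    qed
    fix x m assume x: "x \<in> exact_exponent_set \<tau> \<inter> {0..1}"
    then have irr: "x \<notin> \<rat>" using \<tau>(1) by (blast dest: exact_exponent_set_irrational)
    have fr: "approximable x \<mu>"
      using x exact_exponent_set_iff[of \<tau> x] irr \<mu> by simp
    obtain q and p :: int where q: "q \<ge> Suc m" "\<bar>x - p / real q\<bar> \<le> real q powr (- \<mu>)"
      using fr[unfolded frequently_sequentially, THEN spec, of "Suc m"] by (elim exE conjE) (rule that)
    obtain n where n: "q = Suc n" using q(1) by (cases q) auto
    have "real q powr (- \<mu>) \<le> real q powr 0" using \<mu>(1) n by (intro powr_mono) auto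
    then have "\<bar>x - p / real q\<bar> \<le> 1" using q(2) n by simp
    \<comment> \<open>The point lies in [0, 1] and the error is at most 1, which explains the range
      of numerators.\<close>
    then have "- 1 \<le> p / real q" "p / real q \<le> 2" using x by auto
    then have "- real q \<le> p" "p \<le> 2 * real q" using n by (simp_all add: pos_le_divide_eq pos_divide_le_eq del: of_nat_Suc)
    then have "real_of_int (- int q) \<le> p" "p \<le> real_of_int (2 * int q)" by simp_all
    then have "p \<in> {- int q..2 * int q}" by (simp only: of_int_le_iff atLeastAtMost_iff simp_thms)
    then have "p / real (Suc n) \<in> ?P n" unfolding n by (rule imageI)
    moreover have "dist (p / real (Suc n)) x \<le> real (Suc n) powr (- \<mu>)"
      using q(2) unfolding n dist_real_def by (simp only: abs_minus_commute)
    ultimately show "\<exists>n\<ge>m. \<exists>p\<in>?P n. dist p x \<le> real (Suc n) powr (- \<mu>)"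
      using q(1) n by (intro exI[of _ n] conjI bexI) auto
  qed auto
qed

context digit_cantor_set
begin

section \<open>Generic points of K and the dimensions of the sets of exact exponent\<close>

lemma K_sub_Icc: "K \<subseteq> {0..1}"
proof
  fix x assume "x \<in> K"
  then obtain v where v: "v \<in> prefixes 0" "real v / real b ^ 0 \<le> x" "x \<le> real v / real b ^ 0 + 1 / real b ^ 0"
    by (rule K_near_prefix)
  then show "x \<in> {0..1}" by (auto simp: prefixes_def)
qed

text \<open>The exceptional points form countable unions of null sets over the excesses 1/(k+1),
  while K is not null. The lower bounds for the two exponents hold for every irrational number, by
  Dirichlet's theorem and by rounding b^N \<xi> down.\<close>

lemma hausdorff_positive_generic:
  assumes W2: "2 \<le> card W"
  shows "hausdorff_measure s (exact_exponent_set 2 \<inter> exact_b_ary_exponent_set b 1 \<inter> K) \<noteq> 0"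
proof
  let ?G = "exact_exponent_set 2 \<inter> exact_b_ary_exponent_set b 1 \<inter> K"
  define B1 where "B1 k = {\<xi> \<in> K. approximable \<xi> (2 + 2 * (1 / real (Suc k)))}" for k
  define B2 where "B2 k = {\<xi> \<in> K. b_approximable b \<xi> (1 + 1 / real (Suc k))}" for k
  assume null: "hausdorff_measure s ?G = 0"
  have s0: "0 < s" using b2 W2 by (simp add: s_def)
  have "hausdorff_measure s (B1 k) = 0" "hausdorff_measure s (B2 k) = 0" for k
    unfolding B1_def B2_def using s0
    by (intro hausdorff_null_very_well_approximable hausdorff_null_b_ary_approximable; simp)+
  then have "hausdorff_measure s (\<Union>k. B1 k) = 0" "hausdorff_measure s (\<Union>k. B2 k) = 0"
    by (intro hausdorff_null_UN; simp)+
  then have "hausdorff_measure s (?G \<union> ((\<Union>k. B1 k) \<union> (\<Union>k. B2 k))) = 0"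
    by (intro hausdorff_null_Un null)
  moreover have "K \<subseteq> ?G \<union> ((\<Union>k. B1 k) \<union> (\<Union>k. B2 k))"
  proof
    fix \<xi> assume \<xi>K: "\<xi> \<in> K"
    show "\<xi> \<in> ?G \<union> ((\<Union>k. B1 k) \<union> (\<Union>k. B2 k))"
    proof (rule ccontr)
      assume C: "\<not> ?thesis"
      then have "\<xi> \<notin> B1 k" "\<xi> \<notin> B2 k" for k by auto
      then have n1: "inapproximable \<xi> (2 + 2 * (1 / real (Suc k)))"
        and n2: "b_inapproximable b \<xi> (1 + 1 / real (Suc k))" for k
        unfolding B1_def B2_def using \<xi>K by (simp_all add: not_frequently not_le del: of_nat_Suc)
      \<comment> \<open>Irrationality has to come first, since both characterizations of the
        exponents by denominators presuppose it.\<close>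
      have irr: "\<xi> \<notin> \<rat>"
      proof (rule irrational_if_eventually_positive)
        from n1[of 0] show "\<forall>\<^sub>F q in sequentially. \<forall>p::int. 0 < \<bar>\<xi> - p / real q\<bar>"
          by (rule eventually_mono) (meson le_less_trans powr_ge_zero)
      qed
      have "\<xi> \<in> exact_exponent_set 2"
      proof (rule exact_exponent_set_iff[THEN iffD2, OF _ irr], simp, intro conjI allI impI)
        show "approximable \<xi> \<mu>" if "0 < \<mu>" "\<mu> < 2" for \<mu>
          using that by (intro frequently_dirichlet irr) auto
        fix \<mu> :: real assume "2 < \<mu>"
        then obtain k where k: "1 / real (Suc k) < (\<mu> - 2) / 2" using reals_Archimedean[of "(\<mu> - 2) / 2"]
          by (auto simp: inverse_eq_divide)
        from n1[of k] eventually_gt_at_top[of 0]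
        show "inapproximable \<xi> \<mu>"
        proof eventually_elim
          case (elim q)
          have "real q powr (- \<mu>) \<le> real q powr (- (2 + 2 * (1 / real (Suc k))))"
            using k elim(2) by (intro powr_mono) auto
          then show ?case using elim(1) by (meson le_less_trans)
        qed
      qed
      moreover have "\<xi> \<in> exact_b_ary_exponent_set b 1"
      proof (rule exact_b_ary_exponent_set_iff[THEN iffD2, OF b2 _ irr], simp, intro conjI allI impI)
        have bN: "1 \<le> real b ^ N" for N using b2 by simp
        show "b_approximable b \<xi> \<mu>" if "0 < \<mu>" "\<mu> < 1" for \<mu>
        proof (rule eventually_frequently[OF sequentially_bot], intro always_eventually allI)
          fix N
          have bp: "0 < real b ^ N" using bN[of N] by linarith
          have "\<xi> - \<lfloor>real b ^ N * \<xi>\<rfloor> / real b ^ N = (real b ^ N * \<xi> - \<lfloor>real b ^ N * \<xi>\<rfloor>) / real b ^ N"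
            using bp by (simp add: field_simps)
          moreover have "\<bar>real b ^ N * \<xi> - \<lfloor>real b ^ N * \<xi>\<rfloor>\<bar> \<le> 1" by linarith
          ultimately have "\<bar>\<xi> - \<lfloor>real b ^ N * \<xi>\<rfloor> / real b ^ N\<bar> \<le> 1 / real b ^ N"
            using bp by (simp add: abs_divide divide_right_mono)
          also have "\<dots> = (real b ^ N) powr (- 1)" using bp by (simp add: powr_minus_divide)
          also have "\<dots> \<le> (real b ^ N) powr (- \<mu>)" using that bN by (intro powr_mono) auto
          finally show "\<exists>p::int. \<bar>\<xi> - p / real b ^ N\<bar> \<le> (real b ^ N) powr (- \<mu>)" by blast
        qed
        fix \<mu> :: real assume "1 < \<mu>"
        then obtain k where k: "1 / real (Suc k) < \<mu> - 1" using reals_Archimedean[of "\<mu> - 1"]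
          by (auto simp: inverse_eq_divide)
        from n2[of k] show "b_inapproximable b \<xi> \<mu>"
        proof eventually_elim
          case (elim N)
          have "(real b ^ N) powr (- \<mu>) \<le> (real b ^ N) powr (- (1 + 1 / real (Suc k)))"
            using k bN[of N] by (intro powr_mono) auto
          then show ?case using elim by (meson le_less_trans)
        qed
      qed
      ultimately show False using C \<xi>K by blast
    qed
  qed
  ultimately have "hausdorff_measure s K = 0" by (rule hausdorff_null_subset)
  then show False using hausdorff_positive[OF W2] by simp
qed

text \<open>Subtracting the least digit w0 from all digits moves K by the rational number w0/(b - 1)
  to a missing digit set of equal size that admits the digit 0. Irrationality exponents survive this
  translation but b-ary exponents need not, so the generic points are taken in the translated
  set.\<close>

lemma hausdorff_positive_sumset:
  assumes W2: "2 \<le> card W" and lams: "lam0 > (5 + sqrt 17) / 2" "lam1 > (5 + sqrt 17) / 2"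
  shows "hausdorff_measure s ((exact_exponent_set lam0 \<inter> K) + (exact_exponent_set lam1 \<inter> K)) \<noteq> 0"
proof
  assume null: "hausdorff_measure s ((exact_exponent_set lam0 \<inter> K) + (exact_exponent_set lam1 \<inter> K)) = 0"
  define w0 where "w0 = Min W"
  define W' where "W' = (\<lambda>c. c - w0) ` W"
  define c0 where "c0 = (\<Sum>i. real w0 / real b ^ Suc i)"
  have w0: "w0 \<in> W" "\<And>c. c \<in> W \<Longrightarrow> w0 \<le> c"
    using finite_W W_ne by (simp_all add: w0_def)
  have inj: "inj_on (\<lambda>c. c - w0) W" using w0(2) by (auto simp: inj_on_def) (metis eq_diff_iff)
  interpret K': digit_cantor_set b W' "missing_digit_set b W'" "log b (card W')"
  proof unfold_locales
    show "W' \<subseteq> {0..b - 1}" using W_sub by (force simp: W'_def)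
    show "W' \<noteq> {}" using W_ne by (simp add: W'_def)
  qed (use b2 in auto)
  have cW': "card W' = card W" using card_image[OF inj] by (simp add: W'_def)
  have 0: "0 \<in> W'" unfolding W'_def using w0(1) by (intro image_eqI[of _ _ w0]) simp_all
  have w0b: "w0 < b" using w0(1) digits_less by blast
  have c0: "c0 \<in> \<rat>"
  proof -
    have "(\<lambda>i. real w0 / real (b - 1) * (real (b - 1) / real b ^ Suc (i + 0))) sums (real w0 / real (b - 1) * (1 / real b ^ 0))"
      by (intro sums_mult digit_series_geometric[OF b2])
    then have "c0 = real w0 / real (b - 1)" unfolding c0_def using b2 by (simp add: sums_iff)
    then show ?thesis by simp
  qed
  have shift: "x + c0 \<in> K" if "x \<in> missing_digit_set b W'" for x
  proof -
    from that obtain a where "a \<in> {a. \<forall>i. a i \<in> W'}" "x = digit_value b a"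
      unfolding missing_digit_set_eq by (elim imageE) (rule that)
    then have a: "\<And>i. a i \<in> W'" "x = digit_value b a" by simp_all
    have aW: "a i + w0 \<in> W" for i
    proof -
      from a(1)[of i] obtain c where "c \<in> W" "a i = c - w0" unfolding W'_def by (elim imageE) (rule that)
      then show ?thesis using w0(2) by simp
    qed
    have ab: "a i < b" for i by (rule K'.digits_less) (rule a(1))
    have sw: "summable (\<lambda>i. real w0 / real b ^ Suc i)"
      by (rule summable_digits[where a = "\<lambda>_. w0", OF b2]) (rule w0b)
    have "x + c0 = digit_value b (\<lambda>i. a i + w0)"
      unfolding a(2) c0_def digit_value_def suminf_add[OF summable_digits[where a = a, OF b2 ab] sw]
      by (simp add: add_divide_distrib)
    then show ?thesis using aW unfolding K_def missing_digit_set_eq by auto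
  qed
  have transl: "x + c0 \<in> exact_exponent_set lam \<inter> K"
    if "x \<in> exact_exponent_set lam \<inter> missing_digit_set b W'" "lam > (5 + sqrt 17) / 2" for x lam
    using that exact_exponent_set_translate[of x lam c0] c0 shift sqrt17_threshold(2)[OF that(2)] by auto
  \<comment> \<open>Each of the two summands is moved by c0, hence their sum by 2 c0.\<close>
  have "hausdorff_measure s ((\<lambda>z. z - 2 * c0) `
      ((exact_exponent_set lam0 \<inter> K) + (exact_exponent_set lam1 \<inter> K))) = 0"
    by (rule hausdorff_null_lipschitz_image[OF null s_nonneg, of 1]) (auto simp: dist_real_def)
  moreover have "exact_exponent_set 2 \<inter> exact_b_ary_exponent_set b 1 \<inter> missing_digit_set b W' \<subseteq>
      (\<lambda>z. z - 2 * c0) ` ((exact_exponent_set lam0 \<inter> K) + (exact_exponent_set lam1 \<inter> K))"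
  proof (rule order_trans[OF exact_exponent_sumset[OF b2 K'.W_sub 0 lams]], rule subsetI)
    fix z assume "z \<in> (exact_exponent_set lam0 \<inter> missing_digit_set b W') + (exact_exponent_set lam1 \<inter> missing_digit_set b W')"
    then obtain x y where z: "z = x + y" "x \<in> exact_exponent_set lam0 \<inter> missing_digit_set b W'"
      "y \<in> exact_exponent_set lam1 \<inter> missing_digit_set b W'" by (rule set_plus_elim)
    have "(x + c0) + (y + c0) \<in> (exact_exponent_set lam0 \<inter> K) + (exact_exponent_set lam1 \<inter> K)"
      by (intro set_plus_intro transl z(2,3) lams)
    moreover have "z = (x + c0) + (y + c0) - 2 * c0" by (simp add: z(1))
    ultimately show "z \<in> (\<lambda>z. z - 2 * c0) ` ((exact_exponent_set lam0 \<inter> K) + (exact_exponent_set lam1 \<inter> K))"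
      by (rule rev_image_eqI)
  qed
  ultimately have "hausdorff_measure s (exact_exponent_set 2 \<inter> exact_b_ary_exponent_set b 1 \<inter> missing_digit_set b W') = 0"
    by (rule hausdorff_null_subset)
  then show False using K'.hausdorff_positive_generic W2 by (simp add: cW' s_def)
qed

lemma hausdorff_dim_eq: "hausdorff_dim K = ereal s"
proof (rule antisym[OF hausdorff_dim_le])
  show "ereal s \<le> hausdorff_dim K"
  proof (cases "2 \<le> card W")
    case True
    then show ?thesis by (intro hausdorff_dim_geI hausdorff_positive)
  next
    case False
    then have "card W = 1" using card_W by simp
    then show ?thesis using hausdorff_dim_nonneg[of K] by (simp add: s_def zero_ereal_def)
  qed
qed

text \<open>Addition is a Lipschitz map of the product onto the sumset, so a null product would make
  the sumset null.\<close>

lemma hausdorff_dim_product_ge: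
  assumes lams: "lam0 > (5 + sqrt 17) / 2" "lam1 > (5 + sqrt 17) / 2"
  shows "ereal s \<le> hausdorff_dim ((exact_exponent_set lam0 \<inter> K) \<times> (exact_exponent_set lam1 \<inter> K))"
proof (cases "2 \<le> card W")
  case True
  let ?A = "exact_exponent_set lam0 \<inter> K" and ?B = "exact_exponent_set lam1 \<inter> K"
  show ?thesis
  proof (rule hausdorff_dim_geI, rule notI)
    assume null: "hausdorff_measure s (?A \<times> ?B) = 0"
    have "hausdorff_measure s ((\<lambda>(x, y). x + y) ` (?A \<times> ?B)) = 0"
    proof (rule hausdorff_null_lipschitz_image[OF null s_nonneg, of 2])
      fix u v :: "real \<times> real"
      show "dist (case u of (x, y) \<Rightarrow> x + y) (case v of (x, y) \<Rightarrow> x + y) \<le> 2 * dist u v"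
        using dist_fst_le[of u v] dist_snd_le[of u v] by (simp add: split_beta dist_real_def)
    qed simp
    moreover have "?A + ?B \<subseteq> (\<lambda>(x, y). x + y) ` (?A \<times> ?B)" by (force simp: set_plus_def)
    ultimately have "hausdorff_measure s (?A + ?B) = 0" by (rule hausdorff_null_subset)
    then show False using hausdorff_positive_sumset[OF True lams] by simp
  qed
next
  case False
  \<comment> \<open>Here K is a single rational point and the product is empty. Its dimension is
    still at least s = 0, as the defining infimum runs over nonnegative exponents.\<close>
  then have "card W = 1" using card_W by simp
  then show ?thesis using hausdorff_dim_nonneg by (simp add: s_def zero_ereal_def)
qed

lemma packing_dim_le:
  assumes "A \<subseteq> K"
  shows "packing_dim A \<le> ereal s"
proof (rule ereal_le_epsilon2)
  fix e :: real assume "0 < e"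
  then have "packing_premeasure (s + e) K = 0" by (intro packing_premeasure_null) simp
  \<comment> \<open>The constant sequence K is an admissible countable cover of A.\<close>
  then have "(\<Sum>i::nat. packing_premeasure (s + e) K) = 0" by simp
  moreover have "packing_measure (s + e) A \<le> (\<Sum>i::nat. packing_premeasure (s + e) K)"
    unfolding packing_measure_def using assms by (intro INF_lower) auto
  ultimately have "s + e \<in> {s. 0 \<le> s \<and> packing_measure s A = 0}" using s_nonneg \<open>0 < e\<close> by simp
  then have "packing_dim A \<le> ereal (s + e)" unfolding packing_dim_def by (rule INF_lower)
  then show "packing_dim A \<le> ereal s + ereal e" by simp
qed

text \<open>Allowing any superset A lets one statement serve both for K and for its points of
  exponent lam.\<close>

lemma packing_dim_ge:
  assumes A: "exact_exponent_set lam \<inter> K \<subseteq> A" and lam: "lam > (5 + sqrt 17) / 2"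
  shows "ereal s \<le> packing_dim A"
  unfolding packing_dim_def
proof (rule INF_greatest)
  fix u assume "u \<in> {u. 0 \<le> u \<and> packing_measure u A = 0}"
  then have u: "0 \<le> u" "packing_measure u A = 0" by auto
  have null: "packing_measure u (exact_exponent_set lam \<inter> K) = 0"
    using packing_measure_mono[OF A, of u] u(2) by simp
  show "ereal s \<le> ereal u"
  proof (rule ccontr)
    assume "\<not> ereal s \<le> ereal u"
    then have us: "u < s" by simp
    have "card W \<noteq> 1" using us u(1) by (auto simp: s_def)
    then have W2: "2 \<le> card W" using card_W by simp
    \<comment> \<open>Chosen with 2/lam' < s - u: the set for lam' is then null in dimension s - u,
      and adding a set of packing measure 0 in dimension u would leave a sumset null in dimension
      s.\<close>
    define lam' where "lam' = max ((5 + sqrt 17) / 2) (2 / (s - u)) + 1"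
    have l': "lam' > (5 + sqrt 17) / 2" "2 / (s - u) < lam'"
      unfolding lam'_def by linarith+
    have "2 < lam' * (s - u)" using l'(2) us by (simp add: field_simps)
    then have "hausdorff_measure (s - u) (exact_exponent_set lam' \<inter> {0..1}) = 0"
      using us sqrt17_threshold(2)[OF l'(1)] by (intro hausdorff_null_exact_exponent_set) auto
    then have "hausdorff_measure (s - u) (exact_exponent_set lam' \<inter> K) = 0"
      by (rule hausdorff_null_subset) (use K_sub_Icc in blast)
    from hausdorff_null_sumset[OF this null _ u(1)]
    have "hausdorff_measure s ((exact_exponent_set lam' \<inter> K) + (exact_exponent_set lam \<inter> K)) = 0"
      using us by simp
    then show False using hausdorff_positive_sumset[OF W2 l'(1) lam] by simp
  qed
qed

end

theorem theorem3p13: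
  fixes lam0 lam1 :: real and b :: nat and W :: "nat set" and K :: "real set"
  assumes "min lam0 lam1 > (5 + sqrt 17) / 2"
    and "b \<ge> 3"
    and "W \<subseteq> {0..b - 1}"
    and "W \<noteq> {}"
    and "K = missing_digit_set b W"
  shows
    "(0 \<in> W \<longrightarrow>
        exact_exponent_set 2 \<inter> exact_b_ary_exponent_set b 1 \<inter> K
          \<subseteq> (exact_exponent_set lam0 \<inter> K) + (exact_exponent_set lam1 \<inter> K)) \<and>
     (hausdorff_dim ((exact_exponent_set lam0 \<inter> K) \<times> (exact_exponent_set lam1 \<inter> K))
        \<ge> hausdorff_dim K \<and>
      hausdorff_dim K = ereal (ln (real (card W)) / ln (real b))) \<and>
     (\<forall>lam::real. lam > (5 + sqrt 17) / 2 \<longrightarrow>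
        packing_dim (exact_exponent_set lam \<inter> K) = ereal (ln (real (card W)) / ln (real b)) \<and>
        ereal (ln (real (card W)) / ln (real b)) = packing_dim K)"
proof -
  interpret digit_cantor_set b W "missing_digit_set b W" "log b (card W)"
    using assms by unfold_locales auto
  have b2: "2 \<le> b" and lams: "lam0 > (5 + sqrt 17) / 2" "lam1 > (5 + sqrt 17) / 2"
    using assms by auto
  have s: "ln (real (card W)) / ln (real b) = log b (card W)" by (simp add: log_def)
  show ?thesis
    unfolding s assms(5)
  proof (intro conjI impI allI)
    show "exact_exponent_set 2 \<inter> exact_b_ary_exponent_set b 1 \<inter> missing_digit_set b W
        \<subseteq> (exact_exponent_set lam0 \<inter> missing_digit_set b W) + (exact_exponent_set lam1 \<inter> missing_digit_set b W)"
      if "0 \<in> W" by (rule exact_exponent_sumset[OF b2 assms(3) that lams])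
    show "hausdorff_dim (missing_digit_set b W)
        \<le> hausdorff_dim ((exact_exponent_set lam0 \<inter> missing_digit_set b W) \<times> (exact_exponent_set lam1 \<inter> missing_digit_set b W))"
      unfolding hausdorff_dim_eq by (rule hausdorff_dim_product_ge[OF lams])
    show "hausdorff_dim (missing_digit_set b W) = ereal (log b (card W))" by (rule hausdorff_dim_eq)
    fix lam :: real assume lam: "lam > (5 + sqrt 17) / 2"
    show "packing_dim (exact_exponent_set lam \<inter> missing_digit_set b W) = ereal (log b (card W))"
      by (intro antisym packing_dim_le packing_dim_ge[OF _ lam]) auto
    show "ereal (log b (card W)) = packing_dim (missing_digit_set b W)"
      by (intro antisym packing_dim_le packing_dim_ge[OF _ lam]) auto
  qed
qed

end
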